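(* Let $G=(V,E)$ be a DAG, $\ell:V\to\Sigma$ a labeling function into a finite alphabet $\Sigma$, and $S\in\Sigma^m$ a string. One can decide whether $S$ has a match in $G,\ell$ in time $O((|V|+|E|)k^2+m^2)$, where $k=\max_{v\in V}\min(\mu_s(v),\mu_t(v))$.
   Context: A path is a sequence $v_1,\dots,v_p$ of distinct vertices with $(v_i,v_{i+1})\in E$ for all $i$; a single vertex is a path. The label of a path $P=v_1,\dots,v_p$ is $\ell(P)=\ell(v_1)\cdots\ell(v_p)$. $S$ has a match in $G,\ell$ if some path $P$ of $G$ satisfies $\ell(P)=S$. A source is a vertex of in-degree $0$, a sink a vertex of out-degree $0$. For $v\in V$, $\mu_s(v)$ is the number of paths from a source of $G$ to $v$, and $\mu_t(v)$ is the number of paths from $v$ to a sink of $G$. *)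

theory Defs
  imports "Graph_Theory.Pair_Digraph" "Graph_Theory.Vertex_Walk"
begin

section \<open>Matches of strings in labeled graphs\<close>

text \<open>
  Paths are the nonempty sequences of distinct vertices given by \<open>vpath\<close>; in particular the
  empty string has no match.
\<close>

definition has_match :: "'v pair_pre_digraph \<Rightarrow> ('v \<Rightarrow> 'a) \<Rightarrow> 'a list \<Rightarrow> bool" where
  "has_match G l S \<longleftrightarrow> (\<exists>P. vpath P (with_proj G) \<and> map l P = S)"

definition is_source :: "'v pair_pre_digraph \<Rightarrow> 'v \<Rightarrow> bool" where
  "is_source G v \<longleftrightarrow> v \<in> pverts G \<and> in_degree (with_proj G) v = 0"

definition is_sink :: "'v pair_pre_digraph \<Rightarrow> 'v \<Rightarrow> bool" where
  "is_sink G v \<longleftrightarrow> v \<in> pverts G \<and> out_degree (with_proj G) v = 0"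

definition mu_s :: "'v pair_pre_digraph \<Rightarrow> 'v \<Rightarrow> nat" where
  "mu_s G v = card {P. vpath P (with_proj G) \<and> is_source G (hd P) \<and> last P = v}"

definition mu_t :: "'v pair_pre_digraph \<Rightarrow> 'v \<Rightarrow> nat" where
  "mu_t G v = card {P. vpath P (with_proj G) \<and> hd P = v \<and> is_sink G (last P)}"

definition st_width :: "'v pair_pre_digraph \<Rightarrow> nat" where
  "st_width G = Max ((\<lambda>v. min (mu_s G v) (mu_t G v)) ` pverts G)"


section \<open>Word RAM programs\<close>

text \<open>
  A program works on named registers and named random-access arrays, all of whose cells hold
  machine words, that is, natural numbers below the word range \<open>W\<close> (\<open>W = 2 ^ w\<close> for word
  length \<open>w\<close>). A program mentions only finitely many registers and arrays. Every constant,
  register access, array access, arithmetic operation, comparison, connective, assignment and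
  branch costs one unit of time. Addition and multiplication wrap around modulo \<open>W\<close>;
  subtraction is truncated at 0.
\<close>

type_synonym name = string

record state =
  reg :: "name \<Rightarrow> nat"
  arr :: "name \<Rightarrow> nat \<Rightarrow> nat"

datatype aexp =
    Const nat
  | Var name
  | Cell name aexp
  | Plus aexp aexp
  | Minus aexp aexp
  | Times aexp aexp

datatype bexp =
    Less aexp aexp
  | Neg bexp
  | Conj bexp bexp

datatype com =
    Skip
  | Assign name aexp
  | Store name aexp aexp
  | Seq com com
  | Cond bexp com com
  | While bexp com

primrec aval :: "nat \<Rightarrow> aexp \<Rightarrow> state \<Rightarrow> nat" where
  "aval W (Const i) s = i mod W"
| "aval W (Var x) s = reg s x"
| "aval W (Cell a e) s = arr s a (aval W e s)"
| "aval W (Plus e f) s = (aval W e s + aval W f s) mod W"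
| "aval W (Minus e f) s = aval W e s - aval W f s"
| "aval W (Times e f) s = (aval W e s * aval W f s) mod W"

primrec acost :: "aexp \<Rightarrow> nat" where
  "acost (Const i) = 1"
| "acost (Var x) = 1"
| "acost (Cell a e) = acost e + 1"
| "acost (Plus e f) = acost e + acost f + 1"
| "acost (Minus e f) = acost e + acost f + 1"
| "acost (Times e f) = acost e + acost f + 1"

primrec bval :: "nat \<Rightarrow> bexp \<Rightarrow> state \<Rightarrow> bool" where
  "bval W (Less e f) s \<longleftrightarrow> aval W e s < aval W f s"
| "bval W (Neg b) s \<longleftrightarrow> \<not> bval W b s"
| "bval W (Conj b c) s \<longleftrightarrow> bval W b s \<and> bval W c s"

primrec bcost :: "bexp \<Rightarrow> nat" where
  "bcost (Less e f) = acost e + acost f + 1"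
| "bcost (Neg b) = bcost b + 1"
| "bcost (Conj b c) = bcost b + bcost c + 1"

text \<open>
  \<open>exec W p s t s'\<close>: with word range \<open>W\<close>, program \<open>p\<close> started in \<open>s\<close> halts in \<open>s'\<close> after
  exactly \<open>t\<close> units of time.
\<close>

inductive exec :: "nat \<Rightarrow> com \<Rightarrow> state \<Rightarrow> nat \<Rightarrow> state \<Rightarrow> bool" for W :: nat where
  exec_Skip: "exec W Skip s 1 s"
| exec_Assign:
    "exec W (Assign x e) s (acost e + 1) (s\<lparr>reg := (reg s)(x := aval W e s)\<rparr>)"
| exec_Store:
    "exec W (Store a e f) s (acost e + acost f + 1)
       (s\<lparr>arr := (arr s)(a := (arr s a)(aval W e s := aval W f s))\<rparr>)"
| exec_Seq:
    "exec W p s t s' \<Longrightarrow> exec W q s' t' s'' \<Longrightarrow> exec W (Seq p q) s (t + t') s''"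
| exec_CondTrue:
    "bval W b s \<Longrightarrow> exec W p s t s' \<Longrightarrow> exec W (Cond b p q) s (bcost b + 1 + t) s'"
| exec_CondFalse:
    "\<not> bval W b s \<Longrightarrow> exec W q s t s' \<Longrightarrow> exec W (Cond b p q) s (bcost b + 1 + t) s'"
| exec_WhileFalse:
    "\<not> bval W b s \<Longrightarrow> exec W (While b p) s (bcost b + 1) s"
| exec_WhileTrue:
    "bval W b s \<Longrightarrow> exec W p s t s' \<Longrightarrow> exec W (While b p) s' t' s'' \<Longrightarrow>
     exec W (While b p) s (bcost b + 1 + t + t') s''"


section \<open>Input format\<close>

definition list_cells :: "nat list \<Rightarrow> nat \<Rightarrow> nat" where
  "list_cells xs i = (if i < length xs then xs ! i else 0)"

text \<open>
  The input is a graph with vertex set \<open>{..<n}\<close>, given by a list \<open>es\<close> of its edges in some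
  order, a labeling \<open>l\<close> of its vertices and a string \<open>S\<close>, both over the alphabet
  \<open>{..<\<sigma>}\<close>. All registers and cells that do not belong to the input are initially 0.
\<close>

definition input_state ::
  "nat \<Rightarrow> (nat \<times> nat) list \<Rightarrow> nat \<Rightarrow> (nat \<Rightarrow> nat) \<Rightarrow> nat list \<Rightarrow> state" where
  "input_state n es \<sigma> l S =
     \<lparr> reg = (\<lambda>_. 0)(''n'' := n, ''e'' := length es, ''sigma'' := \<sigma>, ''m'' := length S),
       arr = (\<lambda>_ _. 0)(''tail'' := list_cells (map fst es), ''head'' := list_cells (map snd es),
                      ''label'' := list_cells (map l [0..<n]), ''string'' := list_cells S) \<rparr>"

end

theory Submission
  imports Defs "HOL-Library.Sublist"
begin

text \<open>
  Reading the label of a path into the Knuth-Morris-Pratt automaton of \<open>S\<close> yields a state that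
  determines all prefixes of \<open>S\<close> spelled by suffixes of the path. Hence the states reached by
  the source paths to \<open>v\<close>, of which there are at most \<open>min (\<mu>\<^sub>s v) (m + 1)\<close>, determine all
  prefixes of \<open>S\<close> that have a match ending in \<open>v\<close>; dually, the reversed graph and the reversed string
  handle the suffixes of \<open>S\<close> that have a match starting in \<open>v\<close>.
  The numbers \<open>\<mu>\<^sub>s\<close> increase and \<open>\<mu>\<^sub>t\<close> decrease along edges, so the set \<open>A\<close> of vertices with
  \<open>\<mu>\<^sub>s \<le> \<mu>\<^sub>t\<close> is closed under predecessors and its complement under successors. States are
  therefore propagated forwards on \<open>A\<close> and backwards on the complement only, with at most \<open>k\<close>
  states per vertex. A match lies in one of the two parts or uses an edge from \<open>A\<close> to the complement;
  in the latter case one of at most \<open>k\<^sup>2\<close> pairs of states at the ends of that edge splits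
  \<open>S\<close>, which a precomputed table of size \<open>(m + 1)\<^sup>2\<close> tells in constant time.
\<close>

section \<open>Prefix matches and the matching automaton\<close>

text \<open>The paths ending in \<open>v\<close> may be far more numerous than the source paths to
  \<open>v\<close>, but in a finite acyclic graph every path extends backwards to a source, and a
  prefix spelled by a path is spelled by a suffix of the extension. So source paths suffice. One
  path may spell many prefixes of \<open>S\<close>, and carrying them all would spoil the bound of k
  items per vertex; hence one automaton state per path. The price falls due where the two parts
  meet: a pair of states stands for two sets of lengths, and the question is whether they contain i
  and j with i + j = m. Failure links answer it by a recursion on both states. Path counts can be
  exponential in the size of the graph and need not fit into machine words. The program therefore
  compares counts cut off at m + 1, and this comparison defines \<open>A\<close> in the proof.
  Cutting off is monotone, so the closure properties survive, and a vertex whose counts are both cut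
  off still carries at most min(mu_s, mu_t) states, because there are only m + 1 states.\<close>

definition prefix_matches :: "'a list \<Rightarrow> 'a list \<Rightarrow> nat set" where
  "prefix_matches S w = {i. i \<le> length S \<and> suffix (take i S) w}"

text \<open>The state of the Knuth-Morris-Pratt automaton of \<open>S\<close> after reading
  \<open>w\<close>, defined by the spelled prefixes rather than by transitions. The maximum exists
  because the empty prefix always counts.\<close>

definition longest_match :: "'a list \<Rightarrow> 'a list \<Rightarrow> nat" where
  "longest_match S w = Max (prefix_matches S w)"

definition kmp_step :: "'a list \<Rightarrow> nat \<Rightarrow> 'a \<Rightarrow> nat" where
  "kmp_step S a c = longest_match S (take a S @ [c])"

text \<open>The longest proper border of \<open>take a S\<close>: \<open>tl\<close> removes the
  first letter, so that only proper suffixes compete.\<close>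

definition kmp_fail :: "'a list \<Rightarrow> nat \<Rightarrow> nat" where
  "kmp_fail S a = longest_match S (tl (take a S))"

lemma finite_prefix_matches [simp]: "finite (prefix_matches S w)"
  by (rule finite_subset[of _ "{..length S}"]) (auto simp: prefix_matches_def)

lemma zero_in_prefix_matches [simp]: "0 \<in> prefix_matches S w"
  by (simp add: prefix_matches_def)

lemma longest_match_in_prefix_matches: "longest_match S w \<in> prefix_matches S w"
  unfolding longest_match_def by (rule Max_in) (auto intro: zero_in_prefix_matches)

lemma le_longest_match: "i \<in> prefix_matches S w \<Longrightarrow> i \<le> longest_match S w"
  by (simp add: longest_match_def)

lemma longest_match_le: "longest_match S w \<le> length S"
  using longest_match_in_prefix_matches[of S w] by (simp add: prefix_matches_def)

lemma longest_match_le_length: "longest_match S w \<le> length w"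
  using longest_match_in_prefix_matches[of S w] suffix_length_le by (fastforce simp: prefix_matches_def min_def split: if_splits)

lemma longest_match_eqI:
  assumes "i \<in> prefix_matches S w" "\<And>j. j \<in> prefix_matches S w \<Longrightarrow> j \<le> i"
  shows "longest_match S w = i"
  unfolding longest_match_def using assms by (intro Max_eqI) auto

text \<open>Of two suffixes of one word the shorter is a suffix of the longer, so every spelled
  prefix is already a suffix of the longest one. This is why a single number can replace the
  set.\<close>

lemma prefix_matches_take_longest_match: "prefix_matches S (take (longest_match S w) S) = prefix_matches S w"
proof (intro set_eqI iffI)
  fix i assume "i \<in> prefix_matches S (take (longest_match S w) S)"
  then show "i \<in> prefix_matches S w"
    using longest_match_in_prefix_matches[of S w] by (auto simp: prefix_matches_def intro: suffix_order.trans)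
next
  fix i assume i: "i \<in> prefix_matches S w"
  show "i \<in> prefix_matches S (take (longest_match S w) S)"
    using i longest_match_in_prefix_matches[of S w] le_longest_match[OF i] longest_match_le[of S w]
    by (auto simp: prefix_matches_def intro: suffix_length_suffix)
qed

text \<open>Splitting the last letter off a nonempty prefix leaves a prefix spelled by
  \<open>w\<close>. So the new set depends on \<open>w\<close> only through the old one, which is
  what makes transitions on states possible.\<close>

lemma prefix_matches_snoc: "prefix_matches S (w @ [c]) = insert 0 (Suc ` {i \<in> prefix_matches S w. i < length S \<and> S ! i = c})"
proof (intro set_eqI iffI)
  fix i assume i: "i \<in> prefix_matches S (w @ [c])"
  show "i \<in> insert 0 (Suc ` {i \<in> prefix_matches S w. i < length S \<and> S ! i = c})"
  proof (cases i)
    case (Suc j)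
    then have "j < length S" "suffix (take j S @ [S ! j]) (w @ [c])"
      using i by (auto simp: prefix_matches_def take_Suc_conv_app_nth)
    then show ?thesis using Suc by (auto simp: prefix_matches_def)
  qed simp
next
  fix i assume "i \<in> insert 0 (Suc ` {i \<in> prefix_matches S w. i < length S \<and> S ! i = c})"
  then show "i \<in> prefix_matches S (w @ [c])"
    by (auto simp: prefix_matches_def take_Suc_conv_app_nth)
qed

lemma longest_match_snoc: "longest_match S (w @ [c]) = kmp_step S (longest_match S w) c"
  by (simp add: longest_match_def kmp_step_def prefix_matches_snoc prefix_matches_take_longest_match[unfolded longest_match_def])

lemma kmp_step_le: "kmp_step S a c \<le> length S"
  by (simp add: kmp_step_def longest_match_le)

lemma kmp_fail_le: "kmp_fail S a \<le> length S"
  by (simp add: kmp_fail_def longest_match_le)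

lemma kmp_fail_less: "0 < a \<Longrightarrow> a \<le> length S \<Longrightarrow> kmp_fail S a < a"
  using longest_match_le_length[of S "tl (take a S)"] by (auto simp: kmp_fail_def min_def split: if_splits)

lemma kmp_fail_simps [simp]: "kmp_fail S 0 = 0" "kmp_fail S (Suc 0) = 0"
  using longest_match_le_length[of S "tl (take (Suc 0) S)"] longest_match_le_length[of S "[]"]
  by (simp_all add: kmp_fail_def)

text \<open>For \<open>0 < a\<close> the letter removed by \<open>tl\<close> is not the appended
  one, so the failure value at \<open>Suc a\<close> is one transition away from that at
  \<open>a\<close>. The latter is smaller than \<open>a\<close> and its row already tabulated, so no
  inner loop along failure links arises.\<close>

lemma kmp_fail_Suc: "0 < a \<Longrightarrow> a < length S \<Longrightarrow> kmp_fail S (Suc a) = kmp_step S (kmp_fail S a) (S ! a)"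
proof -
  assume a: "0 < a" "a < length S"
  then have "take a S \<noteq> []" by auto
  then have "tl (take (Suc a) S) = tl (take a S) @ [S ! a]"
    using a by (simp add: take_Suc_conv_app_nth tl_append2)
  then show ?thesis by (simp add: kmp_fail_def longest_match_snoc)
qed

lemma prefix_matches_take_0: "prefix_matches S (take 0 S) = {0}"
  by (auto simp: prefix_matches_def)

text \<open>A suffix of a nonempty word is the word itself or a suffix of its tail. Iterated, this
  lists the whole set as the chain of failure states from \<open>a\<close> down to 0; the recursions
  for transitions and for crossings both come from it.\<close>

lemma prefix_matches_take:
  assumes "0 < a" "a \<le> length S"
  shows "prefix_matches S (take a S) = insert a (prefix_matches S (take (kmp_fail S a) S))"
proof -
  obtain x xs where x: "take a S = x # xs" using assms by (cases "take a S") auto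
  have "suffix (take i S) (x # xs) \<longleftrightarrow> i = a \<or> suffix (take i S) xs" if "i \<le> length S" for i
  proof -
    have "take i S = x # xs \<longleftrightarrow> i = a" using x assms that
      by (metis length_take min.absorb2)
    then show ?thesis by (simp add: suffix_Cons)
  qed
  then have "prefix_matches S (take a S) = insert a (prefix_matches S xs)" using assms by (auto simp: prefix_matches_def x)
  then show ?thesis by (simp add: kmp_fail_def prefix_matches_take_longest_match x)
qed

text \<open>On a mismatch \<open>a\<close> itself cannot be prolonged, and the remaining candidates
  are those of the failure state. A table entry thus costs one lookup in an earlier row.\<close>

lemma kmp_step_rec:
  assumes "a \<le> length S"
  shows "kmp_step S a c = (if a < length S \<and> S ! a = c then Suc a
                      else if 0 < a then kmp_step S (kmp_fail S a) c else 0)"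
proof -
  have le: "i \<le> a" if "i \<in> prefix_matches S (take a S)" for i
    using that suffix_length_le by (fastforce simp: prefix_matches_def min_def split: if_splits)
  have a: "a \<in> prefix_matches S (take a S)" using assms by (simp add: prefix_matches_def)
  consider "a < length S \<and> S ! a = c" | "\<not> (a < length S \<and> S ! a = c)" "0 < a"
    | "\<not> (a < length S \<and> S ! a = c)" "a = 0" by blast
  then show ?thesis
  proof cases
    case 1
    then show ?thesis unfolding kmp_step_def using le a
      by (auto intro!: longest_match_eqI simp: prefix_matches_snoc)
  next
    case 2
    then have "prefix_matches S (take a S @ [c]) = prefix_matches S (take (kmp_fail S a) S @ [c])"
      using prefix_matches_take[OF \<open>0 < a\<close> assms] by (auto simp: prefix_matches_snoc)
    then have "kmp_step S a c = kmp_step S (kmp_fail S a) c" by (simp only: kmp_step_def longest_match_def)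
    then show ?thesis using 2 by argo
  next
    case 3
    have "prefix_matches S ([] @ [c]) = {0}" using 3 prefix_matches_take_0[of S] unfolding prefix_matches_snoc by auto
    then show ?thesis using 3 by (simp add: kmp_step_def longest_match_def)
  qed
qed

lemma kmp_step_notin: "c \<notin> set S \<Longrightarrow> kmp_step S a c = 0"
  unfolding kmp_step_def by (rule longest_match_eqI) (auto simp: prefix_matches_snoc)

definition cross :: "'a list \<Rightarrow> 'a list \<Rightarrow> nat \<Rightarrow> nat \<Rightarrow> bool" where
  "cross S R a b \<longleftrightarrow> (\<exists>i \<in> prefix_matches S (take a S). \<exists>j \<in> prefix_matches R (take b R). i + j = length S)"

text \<open>A pair (i, j) is (a, b) itself, or has i in the set of the failure state of
  \<open>a\<close>, or j in that of \<open>b\<close>. So a product of two chains is tested by three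
  checks, each in constant time once the smaller entries are known.\<close>

lemma cross_rec:
  assumes "a \<le> length S" "b \<le> length R"
  shows "cross S R a b \<longleftrightarrow> a + b = length S \<or> 0 < a \<and> cross S R (kmp_fail S a) b
    \<or> 0 < b \<and> cross S R a (kmp_fail R b)"
proof -
  have a: "prefix_matches S (take a S) = insert a (if 0 < a then prefix_matches S (take (kmp_fail S a) S) else {})"
    using prefix_matches_take[of a S] prefix_matches_take_0[of S] assms by auto
  have b: "prefix_matches R (take b R) = insert b (if 0 < b then prefix_matches R (take (kmp_fail R b) R) else {})"
    using prefix_matches_take[of b R] prefix_matches_take_0[of R] assms by auto
  have "(\<exists>i\<in>A. \<exists>j\<in>B. i + j = M) \<longleftrightarrow> a + b = M \<or> 0 < a \<and> (\<exists>i\<in>A'. \<exists>j\<in>B. i + j = M)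
      \<or> 0 < b \<and> (\<exists>i\<in>A. \<exists>j\<in>B'. i + j = M)"
    if "A = insert a (if 0 < a then A' else {})" "B = insert b (if 0 < b then B' else {})"
    for A A' B B' M
    using that by auto
  from this[OF a b] show ?thesis unfolding cross_def .
qed

section \<open>A program logic with running times\<close>

primrec writes_reg :: "com \<Rightarrow> name set" where
  "writes_reg Skip = {}"
| "writes_reg (Assign x e) = {x}"
| "writes_reg (Store a e f) = {}"
| "writes_reg (Seq p q) = writes_reg p \<union> writes_reg q"
| "writes_reg (Cond b p q) = writes_reg p \<union> writes_reg q"
| "writes_reg (While b p) = writes_reg p"

primrec writes_arr :: "com \<Rightarrow> name set" where
  "writes_arr Skip = {}"
| "writes_arr (Assign x e) = {}"
| "writes_arr (Store a e f) = {a}"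
| "writes_arr (Seq p q) = writes_arr p \<union> writes_arr q"
| "writes_arr (Cond b p q) = writes_arr p \<union> writes_arr q"
| "writes_arr (While b p) = writes_arr p"

text \<open>The frame condition, read off the syntax: facts about registers and arrays that a
  fragment never writes need not appear in its postcondition. Later proofs collect them under names
  such as \<open>fr\<close> and \<open>f1\<close>.\<close>

definition agree :: "com \<Rightarrow> state \<Rightarrow> state \<Rightarrow> bool" where
  "agree p s s' \<longleftrightarrow> (\<forall>x. x \<notin> writes_reg p \<longrightarrow> reg s' x = reg s x) \<and> (\<forall>a. a \<notin> writes_arr p \<longrightarrow> arr s' a = arr s a)"

lemma agree_reg: "agree p s s' \<Longrightarrow> x \<notin> writes_reg p \<Longrightarrow> reg s' x = reg s x"
  and agree_arr: "agree p s s' \<Longrightarrow> a \<notin> writes_arr p \<Longrightarrow> arr s' a = arr s a"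
  by (simp_all add: agree_def)

lemma agree_refl: "agree p s s"
  by (simp add: agree_def)

lemma agree_trans:
  "agree p s s' \<Longrightarrow> agree q s' s'' \<Longrightarrow> writes_reg p \<subseteq> writes_reg r \<Longrightarrow> writes_arr p \<subseteq> writes_arr r \<Longrightarrow>
   writes_reg q \<subseteq> writes_reg r \<Longrightarrow> writes_arr q \<subseteq> writes_arr r \<Longrightarrow> agree r s s''"
  by (auto simp: agree_def) (metis subsetD)+

lemma exec_agree: "exec W p s t s' \<Longrightarrow> agree p s s'"
  by (induction rule: exec.induct) (auto simp: agree_def)

text \<open>Total correctness with a time bound: \<open>exec\<close> derives only halting runs, so
  the existence of one includes termination.\<close>

definition runs_within :: "nat \<Rightarrow> com \<Rightarrow> state \<Rightarrow> nat \<Rightarrow> (state \<Rightarrow> bool) \<Rightarrow> bool" where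
  "runs_within W p s T Q \<longleftrightarrow> (\<exists>t s'. exec W p s t s' \<and> t \<le> T \<and> Q s')"

lemma runs_within_mono:
  assumes "runs_within W p s T Q" "T \<le> T'" "\<And>s'. agree p s s' \<Longrightarrow> Q s' \<Longrightarrow> Q' s'"
  shows "runs_within W p s T' Q'"
  using assms exec_agree unfolding runs_within_def by (meson le_trans)

lemma runs_within_Seq:
  assumes "runs_within W p s T1 R" "\<And>s'. agree p s s' \<Longrightarrow> R s' \<Longrightarrow> runs_within W q s' T2 Q" "T1 + T2 \<le> T"
  shows "runs_within W (Seq p q) s T Q"
proof -
  obtain t1 s1 where 1: "exec W p s t1 s1" "t1 \<le> T1" "R s1" using assms(1) by (auto simp: runs_within_def)
  obtain t2 s2 where 2: "exec W q s1 t2 s2" "t2 \<le> T2" "Q s2"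
    using assms(2)[OF exec_agree[OF 1(1)] 1(3)] by (auto simp: runs_within_def)
  show ?thesis unfolding runs_within_def
    by (intro exI[of _ "t1 + t2"] exI[of _ s2]) (use 1 2 assms(3) in \<open>auto intro: exec_Seq\<close>)
qed

lemma runs_within_Cond:
  assumes "bval W b s \<Longrightarrow> runs_within W p s T Q" "\<not> bval W b s \<Longrightarrow> runs_within W q s T Q" "bcost b + 1 + T \<le> T'"
  shows "runs_within W (Cond b p q) s T' Q"
proof (cases "bval W b s")
  case True
  then obtain t s' where "exec W p s t s'" "t \<le> T" "Q s'" using assms(1) by (auto simp: runs_within_def)
  then show ?thesis unfolding runs_within_def using exec_CondTrue[OF True] assms(3)
    by (metis add_le_mono order.trans order_refl)
next
  case False
  then obtain t s' where "exec W q s t s'" "t \<le> T" "Q s'" using assms(2) by (auto simp: runs_within_def)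
  then show ?thesis unfolding runs_within_def using exec_CondFalse[OF False] assms(3)
    by (metis add_le_mono order.trans order_refl)
qed

text \<open>
  The potential \<open>pot\<close> pays for the remaining iterations, which gives termination as well as the
  running time.
\<close>

lemma runs_within_While:
  assumes "I s"
    and step: "\<And>s'. agree p s s' \<Longrightarrow> I s' \<Longrightarrow> bval W b s' \<Longrightarrow>
      runs_within W p s' (K s') (\<lambda>s''. I s'' \<and> bcost b + 1 + K s' + pot s'' \<le> pot s')"
    and fin: "\<And>s'. agree p s s' \<Longrightarrow> I s' \<Longrightarrow> \<not> bval W b s' \<Longrightarrow> Q s'"
    and T: "pot s + bcost b + 1 \<le> T"
  shows "runs_within W (While b p) s T Q"
proof -
  have "agree p s s' \<Longrightarrow> I s' \<Longrightarrow>
    \<exists>t s''. exec W (While b p) s' t s'' \<and> t \<le> pot s' + bcost b + 1 \<and> Q s''" for s'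
  proof (induction "pot s'" arbitrary: s' rule: less_induct)
    case less
    show ?case
    proof (cases "bval W b s'")
      case True
      obtain t1 s1 where 1: "exec W p s' t1 s1" "t1 \<le> K s'" "I s1"
          "bcost b + 1 + K s' + pot s1 \<le> pot s'"
        using step[OF less.prems True] by (auto simp: runs_within_def)
      have "agree p s s1" using less.prems(1) exec_agree[OF 1(1)] by (auto intro: agree_trans)
      moreover have "pot s1 < pot s'" using 1(4) by simp
      ultimately obtain t2 s2 where 2: "exec W (While b p) s1 t2 s2" "t2 \<le> pot s1 + bcost b + 1" "Q s2"
        using less.hyps 1(3) by blast
      show ?thesis
        by (intro exI[of _ "bcost b + 1 + t1 + t2"] exI[of _ s2])
          (use exec_WhileTrue[OF True 1(1) 2(1)] 1 2 in auto)
    next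
      case False
      then show ?thesis using exec_WhileFalse[OF False] fin[OF less.prems False]
        by (intro exI[of _ "bcost b + 1"] exI[of _ s']) auto
    qed
  qed
  from this[OF agree_refl assms(1)] T show ?thesis unfolding runs_within_def by (meson le_trans)
qed

text \<open>
  The values of \<open>run\<close> and \<open>max_cost\<close> at loops are junk; both are meaningful for \<open>flat\<close> programs only.
\<close>

primrec run :: "nat \<Rightarrow> com \<Rightarrow> state \<Rightarrow> state" where
  "run W Skip s = s"
| "run W (Assign x e) s = s\<lparr>reg := (reg s)(x := aval W e s)\<rparr>"
| "run W (Store a e f) s = s\<lparr>arr := (arr s)(a := (arr s a)(aval W e s := aval W f s))\<rparr>"
| "run W (Seq p q) s = run W q (run W p s)"
| "run W (Cond b p q) s = (if bval W b s then run W p s else run W q s)"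
| "run W (While b p) s = s"

primrec flat :: "com \<Rightarrow> bool" where
  "flat Skip \<longleftrightarrow> True"
| "flat (Assign x e) \<longleftrightarrow> True"
| "flat (Store a e f) \<longleftrightarrow> True"
| "flat (Seq p q) \<longleftrightarrow> flat p \<and> flat q"
| "flat (Cond b p q) \<longleftrightarrow> flat p \<and> flat q"
| "flat (While b p) \<longleftrightarrow> False"

primrec max_cost :: "com \<Rightarrow> nat" where
  "max_cost Skip = 1"
| "max_cost (Assign x e) = acost e + 1"
| "max_cost (Store a e f) = acost e + acost f + 1"
| "max_cost (Seq p q) = max_cost p + max_cost q"
| "max_cost (Cond b p q) = bcost b + 1 + max (max_cost p) (max_cost q)"
| "max_cost (While b p) = 0"

lemma exec_run: "flat p \<Longrightarrow> \<exists>t. exec W p s t (run W p s) \<and> t \<le> max_cost p"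
proof (induction p arbitrary: s)
  case (Seq p q)
  then show ?case by simp (meson add_mono exec_Seq)
next
  case (Cond b p q)
  show ?case
  proof (cases "bval W b s")
    case True
    obtain t where "exec W p s t (run W p s)" "t \<le> max_cost p" using Cond by fastforce
    then show ?thesis using exec_CondTrue[OF True, of p t "run W p s" q] True
      by (intro exI[of _ "bcost b + 1 + t"]) simp
  next
    case False
    obtain t where "exec W q s t (run W q s)" "t \<le> max_cost q" using Cond by fastforce
    then show ?thesis using exec_CondFalse[OF False, of q t "run W q s" p] False
      by (intro exI[of _ "bcost b + 1 + t"]) simp
  qed
qed (auto intro: exec.intros exec_Skip[simplified] exec_Assign[simplified] exec_Store[simplified])

lemma runs_within_flat:
  assumes "flat p" "max_cost p \<le> T" "Q (run W p s)"
  shows "runs_within W p s T Q"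
  using exec_run[OF assms(1), of W s] assms(2,3) unfolding runs_within_def by (meson le_trans)

definition For :: "name \<Rightarrow> name \<Rightarrow> com \<Rightarrow> com" where
  "For x y p = Seq (Assign x (Const 0)) (While (Less (Var x) (Var y))
     (Seq p (Assign x (Plus (Var x) (Const 1)))))"

lemma writes_reg_For [simp]: "writes_reg (For x y p) = insert x (writes_reg p)"
  and writes_arr_For [simp]: "writes_arr (For x y p) = writes_arr p"
  by (auto simp: For_def)

text \<open>The invariant speaks of the state whose counter already shows the round number, hence
  the update by \<open>Suc j\<close> in \<open>step\<close>. The overhead of a round is 8: 4 for the
  test and its branch, 4 for the increment. The final 6 are 2 for the initialisation and 4 for the
  failing test. \<open>N < W\<close> keeps the increment from wrapping.\<close>

lemma runs_within_For:
  assumes y: "reg s y = N" "N < W" and n: "x \<noteq> y" "x \<notin> writes_reg p" "y \<notin> writes_reg p"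
    and I0: "I 0 (s\<lparr>reg := (reg s)(x := 0)\<rparr>)"
    and step: "\<And>j s'. j < N \<Longrightarrow> agree (For x y p) s s' \<Longrightarrow> reg s' x = j \<Longrightarrow> I j s' \<Longrightarrow>
      runs_within W p s' K (\<lambda>s''. I (Suc j) (s''\<lparr>reg := (reg s'')(x := Suc j)\<rparr>))"
    and fin: "\<And>s'. agree (For x y p) s s' \<Longrightarrow> reg s' x = N \<Longrightarrow> I N s' \<Longrightarrow> Q s'"
    and T: "N * (K + 8) + 6 \<le> T"
  shows "runs_within W (For x y p) s T Q"
proof -
  let ?s = "s\<lparr>reg := (reg s)(x := 0)\<rparr>"
  let ?b = "Seq p (Assign x (Plus (Var x) (Const 1)))"
  have ag: "agree (For x y p) s s'" if "agree ?b ?s s'" for s'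
    using that by (auto simp: agree_def)
  have "runs_within W (While (Less (Var x) (Var y)) ?b) ?s (N * (K + 8) + 4) Q"
  proof (rule runs_within_While[where I = "\<lambda>s'. reg s' x \<le> N \<and> I (reg s' x) s'" and K = "\<lambda>_. K + 4"
        and pot = "\<lambda>s'. (N - reg s' x) * (K + 8)"])
    fix s' assume a: "agree ?b ?s s'" and I: "reg s' x \<le> N \<and> I (reg s' x) s'"
      and b: "bval W (Less (Var x) (Var y)) s'"
    have y': "reg s' y = N" using agree_reg[OF a, of y] y n by simp
    have lt: "reg s' x < N" using b y' by simp
    show "runs_within W ?b s' (K + 4) (\<lambda>s''. (reg s'' x \<le> N \<and> I (reg s'' x) s'') \<and>
            bcost (Less (Var x) (Var y)) + 1 + (K + 4) + (N - reg s'' x) * (K + 8)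
            \<le> (N - reg s' x) * (K + 8))"
    proof (rule runs_within_Seq[where R = "\<lambda>s''. I (Suc (reg s' x)) (s''\<lparr>reg := (reg s'')(x := Suc (reg s' x))\<rparr>)"])
      show "runs_within W p s' K (\<lambda>s''. I (Suc (reg s' x)) (s''\<lparr>reg := (reg s'')(x := Suc (reg s' x))\<rparr>))"
        using step[OF lt ag[OF a] refl] I by blast
    next
      fix s1 assume a1: "agree p s' s1"
        and I1: "I (Suc (reg s' x)) (s1\<lparr>reg := (reg s1)(x := Suc (reg s' x))\<rparr>)"
      have x1: "reg s1 x = reg s' x" using agree_reg[OF a1] n by simp
      have "(N - reg s' x) * (K + 8) = (N - Suc (reg s' x)) * (K + 8) + (K + 8)"
        using lt by (metis Suc_diff_Suc add.commute mult_Suc)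
      then show "runs_within W (Assign x (Plus (Var x) (Const 1))) s1 4 (\<lambda>s''. (reg s'' x \<le> N \<and> I (reg s'' x) s'') \<and>
            bcost (Less (Var x) (Var y)) + 1 + (K + 4) + (N - reg s'' x) * (K + 8)
            \<le> (N - reg s' x) * (K + 8))"
        using x1 I1 lt y by (intro runs_within_flat) simp_all
    qed simp
  next
    fix s' assume a: "agree ?b ?s s'" and I: "reg s' x \<le> N \<and> I (reg s' x) s'"
      and b: "\<not> bval W (Less (Var x) (Var y)) s'"
    have y': "reg s' y = N" using agree_reg[OF a, of y] y n by simp
    show "Q s'" using I b y' by (intro fin[OF ag[OF a]]) auto
  qed (use I0 in simp_all)
  moreover have "runs_within W (Assign x (Const 0)) s 2 (\<lambda>s'. s' = ?s)"
    by (rule runs_within_flat) simp_all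
  ultimately show ?thesis unfolding For_def using T by (elim runs_within_Seq) auto
qed

section \<open>Paths from sources\<close>

text \<open>Paths grow at their end, the direction in which an automaton reads labels.
  \<open>E\<close> and \<open>Src\<close> are parameters because the same notion serves the converse
  graph and initial pieces of an edge list.\<close>

inductive src_path :: "('v \<times> 'v) set \<Rightarrow> 'v set \<Rightarrow> 'v \<Rightarrow> 'v list \<Rightarrow> bool" for E Src where
  src_path_base: "v \<in> Src \<Longrightarrow> src_path E Src v [v]"
| src_path_step: "src_path E Src u P \<Longrightarrow> (u, v) \<in> E \<Longrightarrow> src_path E Src v (P @ [v])"

lemma src_path_not_Nil: "src_path E Src v P \<Longrightarrow> P \<noteq> []"
  by (induction rule: src_path.induct) auto

lemma src_path_last: "src_path E Src v P \<Longrightarrow> last P = v"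
  by (induction rule: src_path.induct) auto

lemma src_path_hd: "src_path E Src v P \<Longrightarrow> hd P \<in> Src"
  by (induction rule: src_path.induct) (auto simp: hd_append src_path_not_Nil)

lemma src_path_arcs: "src_path E Src v P \<Longrightarrow> set (vwalk_arcs P) \<subseteq> E"
  by (induction rule: src_path.induct) (auto simp: vwalk_arcs_append src_path_not_Nil src_path_last)

lemma src_path_mono: "src_path E Src v P \<Longrightarrow> E \<subseteq> E' \<Longrightarrow> src_path E' Src v P"
  by (induction rule: src_path.induct) (auto intro: src_path.intros)

lemma src_path_empty: "src_path {} Src v P \<longleftrightarrow> v \<in> Src \<and> P = [v]"
  by (auto elim: src_path.cases intro: src_path.intros)

text \<open>No edge leaves \<open>h\<close>, not even the new one, so the new edge can occur in a
  path only as its last edge.\<close>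

lemma src_path_insert:
  assumes "h \<notin> fst ` insert (t, h) E"
  shows "src_path (insert (t, h) E) Src v P \<longleftrightarrow>
    src_path E Src v P \<or> v = h \<and> (\<exists>Q. P = Q @ [h] \<and> src_path E Src t Q)" (is "?l \<longleftrightarrow> ?r")
proof
  assume ?l then show ?r
  proof (induction rule: src_path.induct)
    case (src_path_step u P v)
    then have "u \<noteq> h" using assms by force
    then show ?case using src_path_step by (auto intro: src_path.intros)
  qed (auto intro: src_path.intros)
next
  assume ?r then show ?l
  proof
    assume "src_path E Src v P" then show ?l by (rule src_path_mono) auto
  next
    assume "v = h \<and> (\<exists>Q. P = Q @ [h] \<and> src_path E Src t Q)"
    then obtain Q where "v = h" "P = Q @ [h]" "src_path E Src t Q" by blast
    moreover from this(3) have "src_path (insert (t, h) E) Src t Q" by (rule src_path_mono) auto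
    ultimately show ?l by (auto intro: src_path.src_path_step)
  qed
qed

text \<open>
  The condition is invariant under reversing both the list and its edges, so that one sorted list
  serves both directions.
\<close>

definition topo :: "('v \<times> 'v) list \<Rightarrow> bool" where
  "topo es \<longleftrightarrow> (\<forall>j < length es. snd (es ! j) \<notin> fst ` set (take (Suc j) es))"

lemma topo_iff_nth: "topo es \<longleftrightarrow> (\<forall>j < length es. \<forall>i \<le> j. snd (es ! j) \<noteq> fst (es ! i))"
proof -
  have "fst ` set (take (Suc j) es) = (\<lambda>i. fst (es ! i)) ` {..j}" if "j < length es" for j
  proof -
    have "set (take (Suc j) es) = (\<lambda>i. es ! i) ` {0..<Suc j}" using that by (simp add: nth_image)
    moreover have "{0..<Suc j} = {..j}" by auto
    ultimately show ?thesis by (simp add: image_image)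
  qed
  then show ?thesis unfolding topo_def by auto
qed

lemma topo_rev:
  assumes "topo es"
  shows "topo (rev (map prod.swap es))"
  unfolding topo_iff_nth
proof (intro allI impI)
  fix j i assume *: "j < length (rev (map prod.swap es))" "i \<le> j"
  then have "length es - Suc i < length es" "length es - Suc j \<le> length es - Suc i" by auto
  with * show "snd (rev (map prod.swap es) ! j) \<noteq> fst (rev (map prod.swap es) ! i)"
    using assms[unfolded topo_iff_nth, rule_format, of "length es - Suc i" "length es - Suc j"]
    by (auto simp: rev_nth)
qed

lemma topo_snoc: "topo (es @ [(t, h)]) \<longleftrightarrow> topo es \<and> h \<notin> fst ` set (es @ [(t, h)])"
  by (auto simp: topo_def nth_append less_Suc_eq)

text \<open>The paths that use only the first \<open>j\<close> edges: exactly those accounted for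
  after \<open>j\<close> rounds of a loop over the sorted list.\<close>

definition src_paths :: "('v \<times> 'v) list \<Rightarrow> 'v set \<Rightarrow> nat \<Rightarrow> 'v \<Rightarrow> 'v list set" where
  "src_paths es Src j v = {P. src_path (set (take j es)) Src v P}"

lemma src_paths_0: "src_paths es Src 0 v = (if v \<in> Src then {[v]} else {})"
  by (auto simp: src_paths_def src_path_empty)

lemma src_paths_Suc:
  assumes "topo es" "j < length es" "es ! j = (t, h)"
  shows "src_paths es Src (Suc j) v = (if v = h then src_paths es Src j h \<union> (\<lambda>Q. Q @ [h]) ` src_paths es Src j t
    else src_paths es Src j v)"
proof -
  have e: "set (take (Suc j) es) = insert (t, h) (set (take j es))"
    using assms by (simp add: take_Suc_conv_app_nth)
  have "h \<notin> fst ` insert (t, h) (set (take j es))" using assms unfolding topo_def e[symmetric] by force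
  from src_path_insert[OF this] show ?thesis by (auto simp: src_paths_def e)
qed

lemma src_paths_mono_full: "src_paths es Src i v \<subseteq> src_paths es Src (length es) v"
  unfolding src_paths_def using src_path_mono set_take_subset[of i es] by fastforce

lemma finite_src_paths: "topo es \<Longrightarrow> j \<le> length es \<Longrightarrow> finite (src_paths es Src j v)"
proof (induction j arbitrary: v)
  case (Suc j)
  then show ?case by (cases "es ! j") (simp add: src_paths_Suc)
qed (simp add: src_paths_0)

text \<open>Prolonged paths end with the edge \<open>(t, h)\<close>, which by distinctness of the
  list is not among the first \<open>j\<close> edges; hence the two sets of paths are
  disjoint.\<close>

lemma card_src_paths_Suc:
  assumes "topo es" "distinct es" "j < length es" "es ! j = (t, h)"
  shows "card (src_paths es Src (Suc j) h) = card (src_paths es Src j h) + card (src_paths es Src j t)"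
proof -
  have "distinct (take (Suc j) es)" using assms by simp
  then have "(t, h) \<notin> set (take j es)" using assms by (simp add: take_Suc_conv_app_nth)
  moreover have "(last Q, h) \<in> set (take j es)" if "src_path (set (take j es)) Src h (Q @ [h])" "Q \<noteq> []" for Q
    using src_path_arcs[OF that(1)] that(2) by (simp add: vwalk_arcs_append)
  ultimately have "src_paths es Src j h \<inter> (\<lambda>Q. Q @ [h]) ` src_paths es Src j t = {}"
    using src_path_last src_path_not_Nil by (fastforce simp: src_paths_def)
  then show ?thesis using assms
    by (simp add: src_paths_Suc card_Un_disjoint finite_src_paths card_image inj_on_def)
qed

text \<open>Appending \<open>v\<close> maps source paths injectively. Applied to the graph and to
  its converse, this gives the monotonicity of \<open>mu_s\<close> and \<open>mu_t\<close> along
  edges.\<close>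

lemma card_src_paths_edge_mono:
  assumes "topo es" "(u, v) \<in> set es"
  shows "card (src_paths es Src (length es) u) \<le> card (src_paths es Src (length es) v)"
proof (rule card_inj_on_le[of "\<lambda>P. P @ [v]"])
  show "(\<lambda>P. P @ [v]) ` src_paths es Src (length es) u \<subseteq> src_paths es Src (length es) v"
    using assms(2) by (auto simp: src_paths_def intro: src_path.intros)
qed (simp_all add: finite_src_paths assms(1) inj_on_def)

section \<open>Walks and their extension to source paths\<close>

definition walk :: "('v \<times> 'v) set \<Rightarrow> 'v set \<Rightarrow> 'v list \<Rightarrow> bool" where
  "walk E V P \<longleftrightarrow> P \<noteq> [] \<and> set P \<subseteq> V \<and> set (vwalk_arcs P) \<subseteq> E"

lemma walk_appendI:
  "walk E V P \<Longrightarrow> walk E V Q \<Longrightarrow> (last P, hd Q) \<in> E \<Longrightarrow> walk E V (P @ Q)"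
  by (auto simp: walk_def vwalk_arcs_append)

lemma walk_append:
  "walk E V (P @ Q) \<Longrightarrow> P \<noteq> [] \<Longrightarrow> Q \<noteq> [] \<Longrightarrow> walk E V P \<and> walk E V Q \<and> (last P, hd Q) \<in> E"
  by (auto simp: walk_def vwalk_arcs_append)

lemma walk_suffix: "walk E V P \<Longrightarrow> suffix Q P \<Longrightarrow> Q \<noteq> [] \<Longrightarrow> walk E V Q"
  by (metis suffix_def append_self_conv2 walk_append)

lemma vwalk_arcs_rev: "vwalk_arcs (rev P) = rev (map prod.swap (vwalk_arcs P))"
proof (induction P rule: vwalk_arcs.induct)
  case (3 x y xs)
  then show ?case using vwalk_arcs_append[of "rev xs @ [y]" "[x]"] by simp
qed auto

lemma walk_rev: "walk (E\<inverse>) V (rev P) \<longleftrightarrow> walk E V P"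
  by (auto simp: walk_def vwalk_arcs_rev)

lemma trancl_vwalk_arcs: "set (vwalk_arcs (a # P)) \<subseteq> E \<Longrightarrow> z \<in> set P \<Longrightarrow> (a, z) \<in> E\<^sup>+"
proof (induction P arbitrary: a)
  case (Cons b P)
  then have "(a, b) \<in> E" "z = b \<or> (b, z) \<in> E\<^sup>+" by auto
  then show ?case by (auto intro: trancl_into_trancl2)
qed simp

text \<open>A repeated vertex would be reachable from itself. Hence the distinctness demanded by
  \<open>vpath\<close> is automatic in a DAG, and walks can be cut and glued freely.\<close>

lemma walk_distinct: "walk E V P \<Longrightarrow> acyclic E \<Longrightarrow> distinct P"
proof (induction P rule: vwalk_arcs.induct)
  case (3 x y xs)
  then show ?case using trancl_vwalk_arcs[of x "y # xs" E x] by (auto simp: walk_def acyclic_def)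
qed auto

lemma src_path_walk: "src_path E Src v P \<Longrightarrow> E \<subseteq> V \<times> V \<Longrightarrow> Src \<subseteq> V \<Longrightarrow> walk E V P"
  by (induction rule: src_path.induct)
    (auto simp: walk_def vwalk_arcs_append src_path_not_Nil src_path_last)

lemma src_path_append: "src_path E Src u P \<Longrightarrow> set (vwalk_arcs (u # R)) \<subseteq> E \<Longrightarrow> src_path E Src (last (u # R)) (P @ R)"
proof (induction R arbitrary: u P)
  case (Cons v R)
  then have "src_path E Src v (P @ [v])" by (auto intro: src_path.intros)
  from Cons.IH[OF this] Cons.prems show ?case by auto
qed simp

definition srcs :: "('v \<times> 'v) set \<Rightarrow> 'v set \<Rightarrow> 'v set" where
  "srcs E V = {v \<in> V. v \<notin> snd ` E}"

lemma walk_src_path: "walk E V P \<Longrightarrow> hd P \<in> Src \<Longrightarrow> src_path E Src (last P) P"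
  using src_path_append[OF src_path_base, of "hd P" Src "tl P" E] by (cases P) (auto simp: walk_def)

locale dag =
  fixes E :: "('v \<times> 'v) set" and V :: "'v set"
  assumes finV: "finite V" and EV: "E \<subseteq> V \<times> V" and acyc: "acyclic E"
begin

lemma finE: "finite E"
  using finV EV by (meson finite_SigmaI finite_subset)

text \<open>Well-founded induction along the edges: going back through predecessors must stop, and
  it stops at a vertex without incoming edges.\<close>

lemma ex_src_path: "v \<in> V \<Longrightarrow> \<exists>P. src_path E (srcs E V) v P"
proof (induction v rule: wf_induct_rule[OF finite_acyclic_wf[OF finE acyc]])
  case (1 v)
  show ?case
  proof (cases "v \<in> srcs E V")
    case False
    then obtain u where "(u, v) \<in> E" using 1 by (auto simp: srcs_def)
    then show ?thesis using 1 EV by (blast intro: src_path.intros)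
  qed (auto intro: src_path.intros)
qed

text \<open>A walk that spells a prefix need not begin in a source, but any source path to its first
  vertex can be put in front. Conversely, a suffix of the label of a path belongs to a suffix of the
  path, which is nonempty because \<open>0 < i\<close>.\<close>

lemma src_path_prefix_matches_iff:
  assumes "0 < i" "i \<le> length S"
  shows "(\<exists>P. src_path E (srcs E V) v P \<and> i \<in> prefix_matches S (map l P)) \<longleftrightarrow>
    (\<exists>Q. walk E V Q \<and> last Q = v \<and> map l Q = take i S)" (is "?l \<longleftrightarrow> ?r")
proof
  assume ?l
  then obtain P where P: "src_path E (srcs E V) v P" "suffix (take i S) (map l P)" by (auto simp: prefix_matches_def)
  then obtain P1 P2 where PP: "P = P1 @ P2" "map l P2 = take i S"
    unfolding suffix_def map_eq_append_conv by auto
  moreover have "P2 \<noteq> []" using assms PP(2) by auto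
  moreover have "walk E V P" using src_path_walk[OF P(1) EV] by (auto simp: srcs_def)
  ultimately show ?r using walk_suffix[of E V P P2] src_path_last[OF P(1)] by (auto simp: suffix_def)
next
  assume ?r
  then obtain Q where Q: "walk E V Q" "last Q = v" "map l Q = take i S" by auto
  then obtain x R where x: "Q = x # R" by (auto simp: walk_def neq_Nil_conv)
  then obtain P where P: "src_path E (srcs E V) x P" using ex_src_path[of x] Q by (auto simp: walk_def)
  then have 1: "src_path E (srcs E V) v (P @ R)" using src_path_append[OF P, of R] Q x by (simp add: walk_def)
  \<comment> \<open>\<open>P\<close> ends in the vertex with which \<open>Q\<close> begins; the
    concatenation must contain it only once.\<close>
  have "P = butlast P @ [x]" using src_path_last[OF P] src_path_not_Nil[OF P] by (metis append_butlast_last_id)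
  then have "P @ R = butlast P @ Q" using x by (metis append.assoc append_Cons append_Nil)
  then have "i \<in> prefix_matches S (map l (P @ R))" using assms Q(3) by (simp add: prefix_matches_def suffix_def)
  then show ?l using 1 by auto
qed

lemma rev_dag: "dag (E\<inverse>) V"
  by standard (use finV EV acyc in auto)

lemma rev_src_path_prefix_matches_iff:
  assumes "0 < j" "j \<le> length S"
  shows "(\<exists>P. src_path (E\<inverse>) (srcs (E\<inverse>) V) v P \<and> j \<in> prefix_matches (rev S) (map l P)) \<longleftrightarrow>
    (\<exists>Q. walk E V Q \<and> hd Q = v \<and> map l Q = drop (length S - j) S)"
proof -
  interpret r: dag "E\<inverse>" V by (rule rev_dag)
  have *: "walk (E\<inverse>) V (rev Q) \<and> last (rev Q) = v \<and> map l (rev Q) = take j (rev S) \<longleftrightarrow>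
    walk E V Q \<and> hd Q = v \<and> map l Q = drop (length S - j) S" for Q
    by (auto simp: last_rev take_rev rev_map walk_rev simp flip: rev_map)
  show ?thesis unfolding r.src_path_prefix_matches_iff[of j "rev S" v l, simplified, OF assms] *[symmetric]
    by (metis rev_rev_ident)
qed

text \<open>A match that neither ends in \<open>A\<close> nor begins outside it starts in
  \<open>A\<close> and leaves it; the edge by which it first leaves splits its label.
  \<open>A\<close> is arbitrary here: its closure under predecessors matters later, for computing
  \<open>F\<close> on \<open>A\<close> and \<open>B\<close> outside without consulting the other
  side.\<close>

lemma match_iff:
  fixes A :: "'v set" and l :: "'v \<Rightarrow> 'b"
  assumes "S \<noteq> []"
  defines "F \<equiv> \<lambda>v. (\<lambda>P. longest_match S (map l P)) ` {P. src_path E (srcs E V) v P}"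
    and "B \<equiv> \<lambda>v. (\<lambda>P. longest_match (rev S) (map l P)) ` {P. src_path (E\<inverse>) (srcs (E\<inverse>) V) v P}"
  shows "(\<exists>P. walk E V P \<and> map l P = S) \<longleftrightarrow>
    (\<exists>v \<in> V \<inter> A. length S \<in> F v) \<or> (\<exists>v \<in> V - A. length S \<in> B v) \<or>
    (\<exists>(u, v) \<in> E. u \<in> A \<and> v \<notin> A \<and> (\<exists>a \<in> F u. \<exists>b \<in> B v. cross S (rev S) a b))" (is "?l \<longleftrightarrow> ?r")
proof -
  let ?m = "length S"
  have m: "0 < ?m" using assms by simp
  have full: "length R = longest_match R w \<longleftrightarrow> length R \<in> prefix_matches R w" for R w :: "'b list"
    using longest_match_in_prefix_matches[of R w] le_longest_match[of "length R" R w] longest_match_le[of R w] by auto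
  have F: "?m \<in> F v \<longleftrightarrow> (\<exists>Q. walk E V Q \<and> last Q = v \<and> map l Q = S)" for v
    using src_path_prefix_matches_iff[OF m order_refl, of v l] full[of S] by (simp add: F_def image_iff)
  have B: "?m \<in> B v \<longleftrightarrow> (\<exists>Q. walk E V Q \<and> hd Q = v \<and> map l Q = S)" for v
    using rev_src_path_prefix_matches_iff[OF m order_refl, of v l] full[of "rev S"] by (simp add: B_def image_iff)
  have C: "(\<exists>a \<in> F u. \<exists>b \<in> B v. cross S (rev S) a b) \<longleftrightarrow>
      (\<exists>i j. i + j = ?m \<and> (\<exists>P. src_path E (srcs E V) u P \<and> i \<in> prefix_matches S (map l P)) \<and>
          (\<exists>P. src_path (E\<inverse>) (srcs (E\<inverse>) V) v P \<and> j \<in> prefix_matches (rev S) (map l P)))" for u v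
    unfolding F_def B_def cross_def by (simp add: prefix_matches_take_longest_match) blast
  show ?thesis
  proof
    assume ?l
    then obtain P where P: "walk E V P" "map l P = S" by auto
    consider "last P \<in> A" | "hd P \<notin> A" | "last P \<notin> A" "hd P \<in> A" by auto
    then show ?r
    proof cases
      case 1
      then have "last P \<in> V \<inter> A" using P by (auto simp: walk_def)
      then show ?thesis using F P by blast
    next
      case 2
      then have "hd P \<in> V - A" using P by (auto simp: walk_def)
      then show ?thesis using B P by blast
    next
      case 3
      define P1 P2 where P12: "P1 = takeWhile (\<lambda>x. x \<in> A) P" "P2 = dropWhile (\<lambda>x. x \<in> A) P"
      have PP: "P = P1 @ P2" by (simp add: P12)
      have n1: "P1 \<noteq> []" using 3 P by (cases P) (auto simp: P12 walk_def)
      have n2: "P2 \<noteq> []" using 3 P by (auto simp: P12 walk_def)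
      have w: "walk E V P1" "walk E V P2" "(last P1, hd P2) \<in> E" using walk_append n1 n2 PP P by blast+
      have "last P1 \<in> set P1" using n1 by simp
      then have A1: "last P1 \<in> A" unfolding P12 by (metis set_takeWhileD)
      have A2: "hd P2 \<notin> A" using n2 unfolding P12 by (metis hd_dropWhile)
      have l: "length P1 + length P2 = ?m" "map l P1 = take (length P1) S"
        "map l P2 = drop (?m - length P2) S"
        using P(2) PP by auto
      have "\<exists>P. src_path E (srcs E V) (last P1) P \<and> length P1 \<in> prefix_matches S (map l P)"
        using src_path_prefix_matches_iff[of "length P1" S "last P1" l] l w n1 by auto
      moreover have "\<exists>P. src_path (E\<inverse>) (srcs (E\<inverse>) V) (hd P2) P \<and> length P2 \<in> prefix_matches (rev S) (map l P)"
        using rev_src_path_prefix_matches_iff[of "length P2" S "hd P2" l] l w n2 by auto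
      ultimately have "\<exists>a \<in> F (last P1). \<exists>b \<in> B (hd P2). cross S (rev S) a b"
        using C l(1) by blast
      then show ?thesis using A1 A2 w(3) by blast
    qed
  next
    assume ?r
    then consider (f) v where "?m \<in> F v" | (b) v where "?m \<in> B v"
      | (c) u v where "(u, v) \<in> E" "\<exists>a \<in> F u. \<exists>b \<in> B v. cross S (rev S) a b" by blast
    then show ?l
    proof cases
      case f then show ?thesis using F by blast
    next
      case b then show ?thesis using B by blast
    next
      case c
      then obtain i j where ij: "i + j = ?m"
        "\<exists>P. src_path E (srcs E V) u P \<and> i \<in> prefix_matches S (map l P)"
        "\<exists>P. src_path (E\<inverse>) (srcs (E\<inverse>) V) v P \<and> j \<in> prefix_matches (rev S) (map l P)"
        using C by blast
      \<comment> \<open>If one length is 0, the other is all of \<open>S\<close>, and a walk on that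
        side alone is a match.\<close>
      consider "i = 0" | "j = 0" | "0 < i" "0 < j" by auto
      then show ?thesis
      proof cases
        case 1 then show ?thesis using ij rev_src_path_prefix_matches_iff[of j S v l] m by auto
      next
        case 2 then show ?thesis using ij src_path_prefix_matches_iff[of i S u l] m by auto
      next
        case 3
        obtain Q1 where Q1: "walk E V Q1" "last Q1 = u" "map l Q1 = take i S"
          using ij src_path_prefix_matches_iff[of i S u l] 3 by auto
        obtain Q2 where Q2: "walk E V Q2" "hd Q2 = v" "map l Q2 = drop (?m - j) S"
          using ij rev_src_path_prefix_matches_iff[of j S v l] 3 by auto
        have "?m - j = i" using ij(1) by simp
        then have "map l (Q1 @ Q2) = S" using Q1 Q2 by simp
        then show ?thesis using walk_appendI[OF Q1(1) Q2(1)] Q1 Q2 c(1) by blast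
      qed
    qed
  qed
qed

end

section \<open>Matches and path counts of the given graph in terms of walks and source paths\<close>

lemma dag_pair_digraph:
  assumes "pair_fin_digraph G" "acyclic (parcs G)"
  shows "dag (parcs G) (pverts G)"
proof -
  interpret pair_fin_digraph G by fact
  show ?thesis by standard (use assms in \<open>auto dest: in_arcsD1 in_arcsD2\<close>)
qed

lemma vpath_walk: "acyclic (parcs G) \<Longrightarrow> vpath P (with_proj G) \<longleftrightarrow> walk (parcs G) (pverts G) P"
  using walk_distinct[of "parcs G" "pverts G" P] by (auto simp: vpath_def vwalk_def walk_def)

lemma mu_s_eq:
  assumes "dag (parcs G) (pverts G)"
  shows "mu_s G v = card {P. src_path (parcs G) (srcs (parcs G) (pverts G)) v P}"
proof -
  interpret dag "parcs G" "pverts G" by fact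
  have src: "is_source G x \<longleftrightarrow> x \<in> srcs (parcs G) (pverts G)" for x
    using finE by (auto simp: is_source_def srcs_def in_degree_def in_arcs_def image_iff) blast
  have "vpath P (with_proj G) \<and> is_source G (hd P) \<and> last P = v \<longleftrightarrow>
    src_path (parcs G) (srcs (parcs G) (pverts G)) v P" for P
    unfolding vpath_walk[OF acyc] src
  proof
    assume "src_path (parcs G) (srcs (parcs G) (pverts G)) v P"
    then show "walk (parcs G) (pverts G) P \<and> hd P \<in> srcs (parcs G) (pverts G) \<and> last P = v"
      using src_path_last src_path_hd src_path_walk[OF _ EV] by (metis (no_types, lifting) mem_Collect_eq srcs_def subsetI)
  qed (auto dest: walk_src_path)
  then show ?thesis by (simp add: mu_s_def)
qed

text \<open>\<open>mu_t\<close> fixes the first vertex of a path, \<open>src_path\<close> the last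
  one; reversing paths is the bijection, and sinks become sources of the converse graph.\<close>

lemma mu_t_eq:
  assumes "dag (parcs G) (pverts G)"
  shows "mu_t G v = card {P. src_path ((parcs G)\<inverse>) (srcs ((parcs G)\<inverse>) (pverts G)) v P}"
proof -
  interpret dag "parcs G" "pverts G" by fact
  have snk: "is_sink G x \<longleftrightarrow> x \<in> srcs ((parcs G)\<inverse>) (pverts G)" for x
    using finE by (auto simp: is_sink_def srcs_def out_degree_def out_arcs_def image_iff) force
  have "{P. vpath P (with_proj G) \<and> hd P = v \<and> is_sink G (last P)} =
    rev ` {P. src_path ((parcs G)\<inverse>) (srcs ((parcs G)\<inverse>) (pverts G)) v P}"
  proof (intro set_eqI iffI)
    fix P assume "P \<in> {P. vpath P (with_proj G) \<and> hd P = v \<and> is_sink G (last P)}"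
    then have P: "walk ((parcs G)\<inverse>) (pverts G) (rev P)" "last (rev P) = v"
      "hd (rev P) \<in> srcs ((parcs G)\<inverse>) (pverts G)"
      by (auto simp: vpath_walk[OF acyc] walk_rev snk hd_rev last_rev)
    from walk_src_path[OF P(1,3)] P(2)
    show "P \<in> rev ` {P. src_path ((parcs G)\<inverse>) (srcs ((parcs G)\<inverse>) (pverts G)) v P}"
      by (metis image_eqI mem_Collect_eq rev_rev_ident)
  next
    fix P assume "P \<in> rev ` {P. src_path ((parcs G)\<inverse>) (srcs ((parcs G)\<inverse>) (pverts G)) v P}"
    then obtain Q where Q: "P = rev Q" "src_path ((parcs G)\<inverse>) (srcs ((parcs G)\<inverse>) (pverts G)) v Q" by auto
    have "walk ((parcs G)\<inverse>) (pverts G) Q"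
      by (rule src_path_walk[OF Q(2)]) (use EV in \<open>auto simp: srcs_def\<close>)
    then have "walk (parcs G) (pverts G) P" using Q(1) by (metis walk_rev rev_rev_ident)
    then show "P \<in> {P. vpath P (with_proj G) \<and> hd P = v \<and> is_sink G (last P)}"
      using src_path_last[OF Q(2)] src_path_hd[OF Q(2)] Q(1)
      by (simp add: vpath_walk[OF acyc] snk hd_rev last_rev)
  qed
  then show ?thesis by (simp add: mu_t_def card_image)
qed

section \<open>Computing the automaton and the crossing table\<close>

abbreviation seq_syntax :: "com \<Rightarrow> com \<Rightarrow> com" (infixr ";;" 60) where
  "p ;; q \<equiv> Seq p q"

definition Eq :: "aexp \<Rightarrow> aexp \<Rightarrow> bexp" where
  "Eq e f = Conj (Neg (Less e f)) (Neg (Less f e))"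

lemma bval_Eq [simp]: "bval W (Eq e f) s \<longleftrightarrow> aval W e s = aval W f s"
  and bcost_Eq [simp]: "bcost (Eq e f) = 2 * acost e + 2 * acost f + 5"
  by (auto simp: Eq_def)

abbreviation At :: "aexp \<Rightarrow> name \<Rightarrow> aexp \<Rightarrow> aexp" where
  "At i w j \<equiv> Plus (Times i (Var w)) j"

text \<open>Row-major addresses stay below the number of cells; as this number is at most
  \<open>W\<close>, address arithmetic modulo \<open>W\<close> is exact.\<close>

lemma index_less: "i < a \<Longrightarrow> j < b \<Longrightarrow> a * b \<le> W \<Longrightarrow> i * b + j < (W :: nat)"
proof -
  assume "i < a" "j < b" "a * b \<le> W"
  then have "Suc i * b \<le> W" by (meson Suc_leI le_trans mult_le_mono1)
  with \<open>j < b\<close> show ?thesis by simp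
qed

lemma index_inj: "j < b \<Longrightarrow> j' < b \<Longrightarrow> i * b + j = i' * b + j' \<longleftrightarrow> i = i' \<and> j = (j' :: nat)"
  by (metis add.commute div_mult_self3 div_less add_0 mod_mult_self3 mod_less less_nat_zero_code)

text \<open>
  The first letter of an array name gives the direction: \<open>f\<close> for the given graph and string, \<open>b\<close>
  for the reversed ones. Transitions under letters that do not occur in \<open>S\<close> lead to state 0, the
  initial contents of all cells, and are never written; so the time does not depend on \<open>\<sigma>\<close>.
\<close>

definition aut_step :: "char \<Rightarrow> com" where
  "aut_step d =
     Assign ''c'' (Cell (d # ''string'') (Var ''j'')) ;;
     Cond (Conj (Less (Var ''a'') (Var ''m'')) (Eq (Cell (d # ''string'') (Var ''a'')) (Var ''c'')))
       (Store (d # ''delta'') (At (Var ''a'') ''sigma'' (Var ''c'')) (Plus (Var ''a'') (Const 1)))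
       (Cond (Less (Const 0) (Var ''a''))
         (Store (d # ''delta'') (At (Var ''a'') ''sigma'' (Var ''c''))
           (Cell (d # ''delta'') (At (Cell (d # ''fail'') (Var ''a'')) ''sigma'' (Var ''c''))))
         Skip)"

definition aut_row :: "char \<Rightarrow> com" where
  "aut_row d = For ''j'' ''m'' (aut_step d) ;;
     Cond (Conj (Less (Const 0) (Var ''a'')) (Less (Var ''a'') (Var ''m'')))
       (Store (d # ''fail'') (Plus (Var ''a'') (Const 1))
         (Cell (d # ''delta'') (At (Cell (d # ''fail'') (Var ''a'')) ''sigma''
           (Cell (d # ''string'') (Var ''a'')))))
       Skip"

definition automaton :: "char \<Rightarrow> com" where
  "automaton d = For ''a'' ''m1'' (aut_row d)"

lemma writes_automaton [simp]:
  "writes_reg (aut_step d) = {''c''}" "writes_arr (aut_step d) = {d # ''delta''}"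
  "writes_reg (aut_row d) = {''j'', ''c''}" "writes_arr (aut_row d) = {d # ''delta'', d # ''fail''}"
  "writes_reg (automaton d) = {''a'', ''j'', ''c''}" "writes_arr (automaton d) = {d # ''delta'', d # ''fail''}"
  by (auto simp: automaton_def aut_row_def aut_step_def)

text \<open>Row \<open>a\<close> looks only into the row of \<open>kmp_fail S a\<close>, which is
  smaller for \<open>0 < a\<close> and thus complete. The failure entry at \<open>Suc a\<close> is
  filled at the end of row \<open>a\<close>, just in time for the next round.\<close>

lemma runs_within_automaton:
  assumes regs: "reg s ''m'' = m" "reg s ''m1'' = m1" "reg s ''sigma'' = \<sigma>"
    and S: "length S = m" "set S \<subseteq> {..<\<sigma>}"
      "\<And>i. i < m \<Longrightarrow> arr s (d # ''string'') i = S ! i"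
    and z: "arr s (d # ''delta'') = (\<lambda>_. 0)" "arr s (d # ''fail'') = (\<lambda>_. 0)"
    and W: "m1 = Suc m" "m1 < W" "m1 * \<sigma> \<le> W"
  shows "runs_within W (automaton d) s (m1 * (m * 60 + 60) + 6)
    (\<lambda>s'. (\<forall>a \<le> m. \<forall>c < \<sigma>. arr s' (d # ''delta'') (a * \<sigma> + c) = kmp_step S a c) \<and>
      (\<forall>a \<le> m. arr s' (d # ''fail'') a = kmp_fail S a))"
proof -
  have ix: "(a * \<sigma> mod W + c) mod W = a * \<sigma> + c" if "a \<le> m" "c < \<sigma>" for a c
    using index_less[of a m1 c \<sigma> W] that W by (simp add: mod_add_left_eq)
  have Sc: "S ! j < \<sigma>" if "j < m" for j using S that nth_mem by blast
  \<comment> \<open>Rows below \<open>a\<close> are complete, and row \<open>a\<close> is complete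
    for the letters in \<open>A\<close>; in the inner loop these are the letters at the first
    \<open>j\<close> positions of \<open>S\<close>.\<close>
  define D where "D a A = (\<lambda>s' :: state. \<forall>a' \<le> m. \<forall>c < \<sigma>. arr s' (d # ''delta'') (a' * \<sigma> + c) =
      (if a' < a \<or> a' = a \<and> c \<in> A then kmp_step S a' c else 0))" for a A
  define I where "I a = (\<lambda>s' :: state. D a {} s' \<and>
      (\<forall>i \<le> m. arr s' (d # ''fail'') i = (if i \<le> a then kmp_fail S i else 0)))" for a
  have D_upd: "D a B s'" if "D a A s" "\<And>a' c. a' \<le> m \<Longrightarrow> c < \<sigma> \<Longrightarrow>
      arr s' (d # ''delta'') (a' * \<sigma> + c) = (if a' = a \<and> c = c0 then kmp_step S a c0 else
      arr s (d # ''delta'') (a' * \<sigma> + c))" "B = insert c0 A" for a A B c0 s s'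
    using that by (auto simp: D_def)
  show ?thesis unfolding automaton_def
  proof (rule runs_within_For[where N = m1 and I = I and K = "m * 60 + 52"])
    fix a s1 assume a: "a < m1" and ag: "agree (For ''a'' ''m1'' (aut_row d)) s s1"
      and ra: "reg s1 ''a'' = a" and I1: "I a s1"
    note fr = agree_reg[OF ag] agree_arr[OF ag]
    show "runs_within W (aut_row d) s1 (m * 60 + 52) (\<lambda>s''. I (Suc a) (s''\<lparr>reg := (reg s'')(''a'' := Suc a)\<rparr>))"
      unfolding aut_row_def
    proof (rule runs_within_Seq[where R = "D a (set S)" and ?T1.0 = "m * 60 + 6" and ?T2.0 = 46])
      show "runs_within W (For ''j'' ''m'' (aut_step d)) s1 (m * 60 + 6) (D a (set S))"
      proof (rule runs_within_For[where N = m and I = "\<lambda>j. D a (set (take j S))" and K = 52])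
        show "D a (set (take 0 S)) (s1\<lparr>reg := (reg s1)(''j'' := 0)\<rparr>)"
          using I1 by (simp add: I_def D_def)
      next
        fix j s2 assume j: "j < m" and ag2: "agree (For ''j'' ''m'' (aut_step d)) s1 s2"
          and rj: "reg s2 ''j'' = j" and D2: "D a (set (take j S)) s2"
        note fr2 = agree_reg[OF ag2] agree_arr[OF ag2]
        have fa: "arr s2 (d # ''fail'') a = kmp_fail S a" using I1 a W by (simp add: fr2 I_def)
        have f2: "(kmp_fail S a * \<sigma> mod W + S ! j) mod W = kmp_fail S a * \<sigma> + S ! j" "kmp_fail S a \<le> m"
          using kmp_fail_le[of S a] S ix Sc[OF j] by auto
        have dd: "arr s2 (d # ''delta'') (kmp_fail S a * \<sigma> + S ! j) = kmp_step S (kmp_fail S a) (S ! j)" if "0 < a"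
          using D2 kmp_fail_less[OF that, of S] a W S Sc[OF j] f2 by (simp add: D_def)
        have T: "set (take (Suc j) S) = insert (S ! j) (set (take j S))"
          using j S by (simp add: take_Suc_conv_app_nth)
        have dr: "kmp_step S a (S ! j) = (if a < m \<and> S ! a = S ! j then Suc a
                      else if 0 < a then kmp_step S (kmp_fail S a) (S ! j) else 0)"
          using kmp_step_rec[of a S "S ! j"] a W S by simp
        have St: "arr s2 (d # ''string'') i = S ! i" if "i < m" for i
          using S that by (simp add: fr2 fr)
        \<comment> \<open>In state 0 a mismatch stores nothing, so the cell has to hold 0 already.
          It does, whether or not the same letter was met at an earlier position.\<close>
        have z0: "arr s2 (d # ''delta'') (0 * \<sigma> + S ! j) = kmp_step S 0 (S ! j)" if "kmp_step S 0 (S ! j) = 0" "a = 0"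
          using D2[unfolded D_def, rule_format, OF le0 Sc[OF j]] that by simp
        have rg: "reg s2 ''a'' = a" "reg s2 ''m'' = m" "reg s2 ''sigma'' = \<sigma>"
          using regs ra by (simp_all add: fr fr2)
        have aj: "(a * \<sigma> mod W + S ! j) mod W = a * \<sigma> + S ! j" using a W j by (intro ix Sc) auto
        have run: "arr (run W (aut_step d) s2) (d # ''delta'') =
            (arr s2 (d # ''delta''))(a * \<sigma> + S ! j := kmp_step S a (S ! j))"
        proof (cases "a < m \<and> S ! a = S ! j")
          case True
          then show ?thesis using j W St rg rj aj dr by (simp add: aut_step_def)
        next
          case F: False
          show ?thesis
          proof (cases "0 < a")
            case True
            have "\<not> (a < m \<and> arr s2 (d # ''string'') a = S ! j)" using F St by auto
            moreover have "kmp_step S a (S ! j) = kmp_step S (kmp_fail S a) (S ! j)" using dr F True by presburger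
            ultimately show ?thesis using St[OF j] rg rj aj True fa dd f2 W
              by (simp add: aut_step_def) blast
          next
            case False
            have "\<not> (a < m \<and> arr s2 (d # ''string'') a = S ! j)" using F St by auto
            moreover have "kmp_step S 0 (S ! j) = 0" using dr F False by auto
            ultimately show ?thesis using St[OF j] rg rj False z0 fun_upd_triv W
              by (simp add: aut_step_def) (metis fun_upd_triv)
          qed
        qed
        show "runs_within W (aut_step d) s2 52 (\<lambda>s''. D a (set (take (Suc j) S)) (s''\<lparr>reg := (reg s'')(''j'' := Suc j)\<rparr>))"
          by (rule runs_within_flat, simp add: aut_step_def, simp add: aut_step_def, rule D_upd[OF D2 _ T])
            (use Sc[OF j] in \<open>simp add: run index_inj\<close>)
      qed (use regs fr W S in simp_all)
    next
      fix s2 assume ag2: "agree (For ''j'' ''m'' (aut_step d)) s1 s2" and D2: "D a (set S) s2"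
      note fr2 = agree_reg[OF ag2] agree_arr[OF ag2]
      have D3: "D (Suc a) {} s2" using D2 kmp_step_notin[of _ S a] by (auto simp: D_def less_Suc_eq)
      have fa: "arr s2 (d # ''fail'') i = (if i \<le> a then kmp_fail S i else 0)" if "i \<le> m" for i
        using I1 that by (simp add: fr2 I_def)
      have f2: "(kmp_fail S a * \<sigma> mod W + S ! a) mod W = kmp_fail S a * \<sigma> + S ! a" "kmp_fail S a \<le> m" if "a < m"
        using kmp_fail_le[of S a] S ix Sc[OF that] by auto
      have dd: "arr s2 (d # ''delta'') (kmp_fail S a * \<sigma> + S ! a) = kmp_fail S (Suc a)" if "0 < a" "a < m"
          using D3 kmp_fail_less[OF that(1), of S] kmp_fail_Suc[OF that(1), of S] a W S Sc[OF that(2)] f2 that by (simp add: D_def)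
      have St: "arr s2 (d # ''string'') i = S ! i" if "i < m" for i
          using S that by (simp add: fr2 fr)
      show "runs_within W (Cond (Conj (Less (Const 0) (Var ''a'')) (Less (Var ''a'') (Var ''m'')))
       (Store (d # ''fail'') (Plus (Var ''a'') (Const 1))
         (Cell (d # ''delta'') (At (Cell (d # ''fail'') (Var ''a'')) ''sigma''
           (Cell (d # ''string'') (Var ''a'')))))
       Skip) s2 46 (\<lambda>s''. I (Suc a) (s''\<lparr>reg := (reg s'')(''a'' := Suc a)\<rparr>))"
        using D3 W a dd f2 fa ra regs St
        by (intro runs_within_flat) (auto simp: I_def D_def fr fr2 le_Suc_eq)
    qed simp
  qed (use regs W z in \<open>auto simp: I_def D_def\<close>)
qed

definition prep_step :: com where
  "prep_step = Store ''fstring'' (Var ''j'') (Cell ''string'' (Var ''j'')) ;;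
     Store ''bstring'' (Minus (Var ''m'') (Plus (Var ''j'') (Const 1))) (Cell ''string'' (Var ''j''))"

definition prep :: com where
  "prep = Assign ''m1'' (Plus (Var ''m'') (Const 1)) ;; For ''j'' ''m'' prep_step"

lemma writes_prep [simp]:
  "writes_reg prep_step = {}" "writes_arr prep_step = {''fstring'', ''bstring''}"
  "writes_reg prep = {''m1'', ''j''}" "writes_arr prep = {''fstring'', ''bstring''}"
  by (auto simp: prep_def prep_step_def)

lemma runs_within_prep:
  assumes regs: "reg s ''m'' = m"
    and S: "length S = m" "\<And>i. i < m \<Longrightarrow> arr s ''string'' i = S ! i"
    and W: "Suc m < W"
  shows "runs_within W prep s (m * 20 + 10)
    (\<lambda>s'. reg s' ''m1'' = Suc m \<and> (\<forall>i < m. arr s' ''fstring'' i = S ! i) \<and>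
      (\<forall>i < m. arr s' ''bstring'' i = rev S ! i))"
  unfolding prep_def
proof (rule runs_within_Seq[where R = "\<lambda>s'. reg s' ''m1'' = Suc m" and ?T1.0 = 4 and ?T2.0 = "m * 20 + 6"])
  show "runs_within W (Assign ''m1'' (Plus (Var ''m'') (Const 1))) s 4 (\<lambda>s'. reg s' ''m1'' = Suc m)"
    using regs W by (intro runs_within_flat) simp_all
next
  fix s1 assume ag: "agree (Assign ''m1'' (Plus (Var ''m'') (Const 1))) s s1" and m1: "reg s1 ''m1'' = Suc m"
  note fr = agree_reg[OF ag] agree_arr[OF ag]
  \<comment> \<open>\<open>bstring\<close> is filled downwards from cell \<open>m - 1\<close>; after
    \<open>j\<close> rounds the filled cells are those with \<open>m - i \<le> j\<close>.\<close>
  let ?I = "\<lambda>j s'. reg s' ''m1'' = Suc m \<and> (\<forall>i < j. arr s' ''fstring'' i = S ! i) \<and>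
      (\<forall>i < m. m - i \<le> j \<longrightarrow> arr s' ''bstring'' i = rev S ! i)"
  show "runs_within W (For ''j'' ''m'' prep_step) s1 (m * 20 + 6) (\<lambda>s'. reg s' ''m1'' = Suc m \<and>
    (\<forall>i < m. arr s' ''fstring'' i = S ! i) \<and> (\<forall>i < m. arr s' ''bstring'' i = rev S ! i))"
  proof (rule runs_within_For[where N = m and I = ?I and K = 12])
    fix j s2 assume j: "j < m" and ag2: "agree (For ''j'' ''m'' prep_step) s1 s2"
      and rj: "reg s2 ''j'' = j" and I: "?I j s2"
    note fr2 = agree_reg[OF ag2] agree_arr[OF ag2]
    show "runs_within W prep_step s2 12 (\<lambda>s''. ?I (Suc j) (s''\<lparr>reg := (reg s'')(''j'' := Suc j)\<rparr>))"
      using I j rj W S regs by (intro runs_within_flat) (auto simp: prep_step_def fr fr2 less_Suc_eq rev_nth)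
  qed (use regs W m1 in \<open>auto simp: fr\<close>)
qed simp

definition cross_step :: com where
  "cross_step =
     Cond (Eq (Plus (Var ''a'') (Var ''b'')) (Var ''m''))
       (Store ''cross'' (At (Var ''a'') ''m1'' (Var ''b'')) (Const 1))
       (Cond (Conj (Less (Const 0) (Var ''a''))
           (Less (Const 0) (Cell ''cross'' (At (Cell ''ffail'' (Var ''a'')) ''m1'' (Var ''b'')))))
         (Store ''cross'' (At (Var ''a'') ''m1'' (Var ''b'')) (Const 1))
         (Cond (Conj (Less (Const 0) (Var ''b''))
             (Less (Const 0) (Cell ''cross'' (At (Var ''a'') ''m1'' (Cell ''bfail'' (Var ''b''))))))
           (Store ''cross'' (At (Var ''a'') ''m1'' (Var ''b'')) (Const 1))
           Skip))"

definition cross_table :: com where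
  "cross_table = For ''a'' ''m1'' (For ''b'' ''m1'' cross_step)"

lemma writes_cross_table [simp]:
  "writes_reg cross_step = {}" "writes_arr cross_step = {''cross''}"
  "writes_reg cross_table = {''a'', ''b''}" "writes_arr cross_table = {''cross''}"
  by (auto simp: cross_table_def cross_step_def)

text \<open>The loops run in row-major order, and both entries consulted at (a, b) come earlier: one
  in a smaller row, one in a smaller column of the same row. The bound \<open>2 * m < W\<close>
  keeps the sum of two states from wrapping.\<close>

lemma runs_within_cross_table:
  assumes regs: "reg s ''m'' = m" "reg s ''m1'' = m1"
    and S: "length S = m" "length R = m"
      "\<And>a. a \<le> m \<Longrightarrow> arr s ''ffail'' a = kmp_fail S a" "\<And>a. a \<le> m \<Longrightarrow> arr s ''bfail'' a = kmp_fail R a"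
    and z: "arr s ''cross'' = (\<lambda>_. 0)"
    and W: "m1 = Suc m" "m1 < W" "m1 * m1 \<le> W" "2 * m < W"
  shows "runs_within W cross_table s (m1 * (m1 * 70 + 14) + 6)
    (\<lambda>s'. \<forall>a \<le> m. \<forall>b \<le> m. arr s' ''cross'' (a * m1 + b) = (if cross S R a b then 1 else 0))"
proof -
  have ix: "(a * m1 mod W + b) mod W = a * m1 + b" if "a \<le> m" "b \<le> m" for a b
    using index_less[of a m1 b m1 W] that W by (simp add: mod_add_left_eq)
  have lt: "x < m1" if "x \<le> m" for x using that W by simp
  define D where "D a b = (\<lambda>s' :: state. \<forall>a' \<le> m. \<forall>b' \<le> m. arr s' ''cross'' (a' * m1 + b') =
      (if (a' < a \<or> a' = a \<and> b' < b) \<and> cross S R a' b' then 1 else 0))" for a b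
  show ?thesis unfolding cross_table_def
  proof (rule runs_within_For[where N = m1 and I = "\<lambda>a. D a 0" and K = "m1 * 70 + 6"])
    fix a s1 assume a: "a < m1" and ag: "agree (For ''a'' ''m1'' (For ''b'' ''m1'' cross_step)) s s1"
      and ra: "reg s1 ''a'' = a" and D1: "D a 0 s1"
    note fr = agree_reg[OF ag] agree_arr[OF ag]
    show "runs_within W (For ''b'' ''m1'' cross_step) s1 (m1 * 70 + 6)
      (\<lambda>s''. D (Suc a) 0 (s''\<lparr>reg := (reg s'')(''a'' := Suc a)\<rparr>))"
    proof (rule runs_within_For[where N = m1 and I = "\<lambda>b. D a b" and K = 62])
      fix b s2 assume b: "b < m1" and ag2: "agree (For ''b'' ''m1'' cross_step) s1 s2"
        and rb: "reg s2 ''b'' = b" and D2: "D a b s2"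
      note fr2 = agree_reg[OF ag2] agree_arr[OF ag2]
      have rg: "reg s2 ''a'' = a" "reg s2 ''m'' = m" "reg s2 ''m1'' = m1"
        using regs ra by (simp_all add: fr fr2)
      have fa: "arr s2 ''ffail'' a = kmp_fail S a" "arr s2 ''bfail'' b = kmp_fail R b"
        using S a b W by (simp_all add: fr fr2)
      have le: "kmp_fail S a \<le> m" "kmp_fail R b \<le> m" "a \<le> m" "b \<le> m" using kmp_fail_le[of S a] kmp_fail_le[of R b] S a b W by auto
      have c1: "arr s2 ''cross'' (kmp_fail S a * m1 + b) = (if cross S R (kmp_fail S a) b then 1 else 0)" if "0 < a"
        using D2 le kmp_fail_less[OF that, of S] S by (simp add: D_def)
      have c2: "arr s2 ''cross'' (a * m1 + kmp_fail R b) = (if cross S R a (kmp_fail R b) then 1 else 0)" if "0 < b"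
        using D2 le kmp_fail_less[OF that, of R] S by (simp add: D_def)
      have c3: "arr s2 ''cross'' (a * m1 + b) = 0" using D2 le by (simp add: D_def)
      have rec: "cross S R a b \<longleftrightarrow> a + b = m \<or> 0 < a \<and> cross S R (kmp_fail S a) b \<or> 0 < b \<and> cross S R a (kmp_fail R b)"
        using cross_rec[of a S b R] le S by simp
      have ab: "(a + b) mod W = a + b" "Suc 0 < W" using le W by auto
      note ixs = ix[OF le(3,4)] ix[OF le(1,4)] ix[OF le(3,2)]
      have bv: "bval W (Eq (Plus (Var ''a'') (Var ''b'')) (Var ''m'')) s2 \<longleftrightarrow> a + b = m"
        "bval W (Conj (Less (Const 0) (Var ''a''))
           (Less (Const 0) (Cell ''cross'' (At (Cell ''ffail'' (Var ''a'')) ''m1'' (Var ''b''))))) s2 \<longleftrightarrow>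
         0 < a \<and> cross S R (kmp_fail S a) b"
        "bval W (Conj (Less (Const 0) (Var ''b''))
             (Less (Const 0) (Cell ''cross'' (At (Var ''a'') ''m1'' (Cell ''bfail'' (Var ''b'')))))) s2 \<longleftrightarrow>
         0 < b \<and> cross S R a (kmp_fail R b)"
        "aval W (At (Var ''a'') ''m1'' (Var ''b'')) s2 = a * m1 + b" "aval W (Const 1) s2 = 1"
        using rg rb ixs ab fa c1 c2 by (auto split: if_splits)
      have run: "arr (run W cross_step s2) ''cross'' = (arr s2 ''cross'')(a * m1 + b := (if cross S R a b then 1 else 0))"
        unfolding cross_step_def run.simps bv rec using c3 by auto
      show "runs_within W cross_step s2 62 (\<lambda>s''. D a (Suc b) (s''\<lparr>reg := (reg s'')(''b'' := Suc b)\<rparr>))"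
        by (rule runs_within_flat, simp add: cross_step_def, simp add: cross_step_def)
          (use D2 b lt in \<open>auto simp: run index_inj D_def less_Suc_eq\<close>)
    qed (use regs W D1 in \<open>auto simp: fr D_def\<close>)
  qed (use regs W z in \<open>auto simp: D_def\<close>)
qed

section \<open>Topologically sorting the edges\<close>

text \<open>
  The edges leaving a vertex are linked from later to earlier ones by their numbers plus one, and 0
  ends the list.
\<close>

primrec prev_edge :: "('v \<times> 'v) list \<Rightarrow> 'v \<Rightarrow> nat \<Rightarrow> nat" where
  "prev_edge es u 0 = 0"
| "prev_edge es u (Suc j) = (if fst (es ! j) = u then Suc j else prev_edge es u j)"

lemma prev_edge_SucD: "prev_edge es u q = Suc j \<Longrightarrow> j < q \<and> fst (es ! j) = u \<and> (\<forall>i < q. j < i \<longrightarrow> fst (es ! i) \<noteq> u)"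
  by (induction q) (auto simp: less_Suc_eq split: if_splits)

lemma prev_edge_0D: "prev_edge es u q = 0 \<Longrightarrow> i < q \<Longrightarrow> fst (es ! i) \<noteq> u"
  by (induction q) (auto simp: less_Suc_eq split: if_splits)

definition pending :: "('v \<times> 'v) list \<Rightarrow> nat list \<Rightarrow> 'v \<Rightarrow> nat" where
  "pending es js v = card {i. i < length es \<and> i \<notin> set js \<and> snd (es ! i) = v}"

lemma pending_eq_0_iff: "pending es js v = 0 \<longleftrightarrow> (\<forall>i < length es. snd (es ! i) = v \<longrightarrow> i \<in> set js)"
proof -
  have "finite {i. i < length es \<and> i \<notin> set js \<and> snd (es ! i) = v}" by simp
  then show ?thesis unfolding pending_def by auto
qed

lemma pending_snoc:
  assumes "j < length es" "j \<notin> set js"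
  shows "pending es (js @ [j]) v = (if v = snd (es ! j) then pending es js v - 1 else pending es js v)"
proof -
  let ?A = "{i. i < length es \<and> i \<notin> set js \<and> snd (es ! i) = v}"
  have "{i. i < length es \<and> i \<notin> set (js @ [j]) \<and> snd (es ! i) = v} = (if v = snd (es ! j) then ?A - {j} else ?A)"
    by auto
  then show ?thesis using assms unfolding pending_def by (auto simp: card_Diff_singleton)
qed

text \<open>
  The first \<open>qh\<close> vertices of the queue \<open>qs\<close> have been removed, \<open>js\<close> are the numbers of the edges
  already output, and those edges leaving the current vertex \<open>cu\<close> whose numbers are below \<open>cq\<close>
  are still to be output.
\<close>

definition kahn :: "(nat \<times> nat) list \<Rightarrow> nat \<Rightarrow> nat list \<Rightarrow> nat list \<Rightarrow> nat \<Rightarrow> nat \<Rightarrow> nat \<Rightarrow> bool" where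
  "kahn es n qs js qh cu cq \<longleftrightarrow>
    distinct js \<and> topo (map ((!) es) js) \<and> distinct qs \<and> qh \<le> length qs \<and> cq \<le> length es \<and>
    set qs = {v. v < n \<and> pending es js v = 0} \<and> (cq = 0 \<or> cu \<in> set (take qh qs)) \<and>
    set js = {i. i < length es \<and> fst (es ! i) \<in> set (take qh qs) \<and> \<not> (fst (es ! i) = cu \<and> i < cq)}"

lemma kahn_length_le:
  assumes "kahn es n qs js qh cu cq"
  shows "length js \<le> length es" "length qs \<le> n"
proof -
  have "card (set js) \<le> card {..<length es}" using assms
    by (intro card_mono) (auto simp: kahn_def)
  then show "length js \<le> length es" using assms distinct_card[of js] unfolding kahn_def by simp
  have "card (set qs) \<le> card {..<n}" using assms
    by (intro card_mono) (auto simp: kahn_def)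
  then show "length qs \<le> n" using assms distinct_card[of qs] unfolding kahn_def by simp
qed

text \<open>The edge being output still counts as pending at its head, so the head is not in
  \<open>qs\<close>, whereas the tails of all edges output so far, this one included, lie in the
  removed part of \<open>qs\<close>. This separation is the \<open>topo\<close> condition for the
  longer list.\<close>

lemma kahn_edge:
  assumes k: "kahn es n qs js qh cu cq" and p: "prev_edge es cu cq = Suc j" and V: "snd (es ! j) < n"
  shows "j < length es" "fst (es ! j) = cu" "j \<notin> set js" "0 < pending es js (snd (es ! j))"
    "kahn es n (if pending es js (snd (es ! j)) = 1 then qs @ [snd (es ! j)] else qs) (js @ [j]) qh cu j"
proof -
  let ?h = "snd (es ! j)"
  have dj: "distinct js" and kt: "topo (map ((!) es) js)" and dq: "distinct qs" and qh: "qh \<le> length qs"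
    and cq: "cq \<le> length es" and sq: "v \<in> set qs \<longleftrightarrow> v < n \<and> pending es js v = 0"
    and cu: "cq = 0 \<or> cu \<in> set (take qh qs)"
    and sj: "i \<in> set js \<longleftrightarrow> i < length es \<and> fst (es ! i) \<in> set (take qh qs) \<and> \<not> (fst (es ! i) = cu \<and> i < cq)"
    for v i using k unfolding kahn_def by blast+
  have jq: "j < cq" "fst (es ! j) = cu" and nb: "\<And>i. i < cq \<Longrightarrow> j < i \<Longrightarrow> fst (es ! i) \<noteq> cu"
    using prev_edge_SucD[OF p] by auto
  then show j: "j < length es" "fst (es ! j) = cu" using cq by auto
  show js: "j \<notin> set js" using sj jq by auto
  have r: "pending es js ?h \<noteq> 0" using j js by (auto simp: pending_eq_0_iff)
  then show "0 < pending es js ?h" by simp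
  have h: "?h \<notin> set qs" using sq r by auto
  have cu: "cu \<in> set (take qh qs)" using cu jq by auto
  have "fst (es ! i) \<in> set (take qh qs)" if "i \<in> set (js @ [j])" for i
    using that sj[of i] cu j(2) by (cases "i = j") auto
  then have fs: "fst ` set (map ((!) es) (js @ [j])) \<subseteq> set (take qh qs)"
    unfolding set_map by blast
  have "?h \<notin> fst ` set (map ((!) es) (js @ [j]))" using fs h set_take_subset[of qh qs] by blast
  then have t: "topo (map ((!) es) (js @ [j]))"
    using kt topo_snoc[of "map ((!) es) js" "fst (es ! j)" ?h] by simp
  have rs: "pending es (js @ [j]) v = 0 \<longleftrightarrow> (if v = ?h then pending es js ?h = 1 else pending es js v = 0)" for v
    using pending_snoc[OF j(1) js, of v] r by auto
  have sj': "set (js @ [j]) = {i. i < length es \<and> fst (es ! i) \<in> set (take qh qs) \<and> \<not> (fst (es ! i) = cu \<and> i < j)}"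
  proof (intro set_eqI)
    fix i
    have "i = j \<or> fst (es ! i) \<noteq> cu \<or> i < j \<or> cq \<le> i" using nb[of i] by linarith
    then show "i \<in> set (js @ [j]) \<longleftrightarrow> i \<in> {i. i < length es \<and> fst (es ! i) \<in> set (take qh qs) \<and> \<not> (fst (es ! i) = cu \<and> i < j)}"
      using sj[of i] jq j cu by auto
  qed
  let ?qs = "if pending es js ?h = 1 then qs @ [?h] else qs"
  have "set ?qs = {v. v < n \<and> pending es (js @ [j]) v = 0}"
  proof (intro set_eqI)
    fix v
    show "v \<in> set ?qs \<longleftrightarrow> v \<in> {v. v < n \<and> pending es (js @ [j]) v = 0}"
      using sq[of v] V r unfolding mem_Collect_eq rs by (cases "v = ?h") auto
  qed
  moreover have "take qh ?qs = take qh qs" "qh \<le> length ?qs" "distinct ?qs" using qh dq h by auto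
  ultimately show "kahn es n ?qs (js @ [j]) qh cu j"
    unfolding kahn_def using t dj js cu j sj' by simp
qed

text \<open>Setting \<open>cq\<close> to \<open>length es\<close> declares every edge out of the new
  vertex as still to be output. None of them has been output, since by distinctness of
  \<open>qs\<close> the vertex was not removed before. The list of the old vertex must be exhausted,
  lest its edges be lost.\<close>

lemma kahn_pop:
  assumes k: "kahn es n qs js qh cu cq" and p: "prev_edge es cu cq = 0" and q: "qh < length qs"
  shows "kahn es n qs js (Suc qh) (qs ! qh) (length es)"
proof -
  have t: "set (take (Suc qh) qs) = insert (qs ! qh) (set (take qh qs))"
    using q by (simp add: take_Suc_conv_app_nth)
  have "distinct (take (Suc qh) qs)" using k by (simp add: kahn_def)
  then have "qs ! qh \<notin> set (take qh qs)" using q by (simp add: take_Suc_conv_app_nth)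
  then show ?thesis using k q prev_edge_0D[OF p] unfolding kahn_def t by auto
qed

text \<open>Well-founded induction along the edges: if all predecessors of a vertex are in
  \<open>qs\<close>, and all of \<open>qs\<close> has been removed, then every edge into the vertex
  has been output, so it is in \<open>qs\<close> as well. A cycle would block the algorithm
  here.\<close>

lemma kahn_final:
  assumes k: "kahn es n qs js qh cu cq" and p: "prev_edge es cu cq = 0" and q: "qh = length qs"
    and V: "set es \<subseteq> {..<n} \<times> {..<n}" and ac: "acyclic (set es)"
  shows "set js = {..<length es}"
proof -
  have js: "set js = {i. i < length es \<and> fst (es ! i) \<in> set qs}"
    using k prev_edge_0D[OF p] q by (auto simp: kahn_def)
  have "v < n \<Longrightarrow> v \<in> set qs" for v
  proof (induction v rule: wf_induct_rule[OF finite_acyclic_wf[OF finite_set ac]])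
    case (1 v)
    have "pending es js v = 0" unfolding pending_eq_0_iff
    proof (intro allI impI)
      fix i assume i: "i < length es" "snd (es ! i) = v"
      then have "(fst (es ! i), v) \<in> set es" by (metis nth_mem prod.collapse)
      then have "fst (es ! i) \<in> set qs" using 1 V by blast
      then show "i \<in> set js" using i js by simp
    qed
    then show ?case using 1 k by (simp add: kahn_def)
  qed
  moreover have "fst (es ! i) < n" if "i < length es" for i using V nth_mem[OF that] by force
  ultimately show ?thesis using js by auto
qed

definition link_step :: com where
  "link_step = Assign ''t'' (Cell ''tail'' (Var ''j'')) ;; Assign ''h'' (Cell ''head'' (Var ''j'')) ;;
     Store ''next'' (Var ''j'') (Cell ''first'' (Var ''t'')) ;;
     Store ''first'' (Var ''t'') (Plus (Var ''j'') (Const 1)) ;;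
     Store ''deg'' (Var ''h'') (Plus (Cell ''deg'' (Var ''h'')) (Const 1))"

definition enqueue_step :: com where
  "enqueue_step = Cond (Less (Cell ''deg'' (Var ''v'')) (Const 1))
     (Store ''queue'' (Var ''qt'') (Var ''v'') ;; Assign ''qt'' (Plus (Var ''qt'') (Const 1))) Skip"

text \<open>One round outputs an edge or removes a vertex; flattening the nested loops in this way
  lets a single potential bound the rounds by edges plus vertices. The reversed list is written from
  its end, at \<open>e - cnt\<close> with \<open>cnt\<close> already increased.\<close>

definition kahn_step :: com where
  "kahn_step = Cond (Less (Const 0) (Var ''p''))
     (Assign ''j'' (Minus (Var ''p'') (Const 1)) ;; Assign ''p'' (Cell ''next'' (Var ''j'')) ;;
      Assign ''t'' (Cell ''tail'' (Var ''j'')) ;; Assign ''v'' (Cell ''head'' (Var ''j'')) ;;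
      Store ''ftail'' (Var ''cnt'') (Var ''t'') ;; Store ''fhead'' (Var ''cnt'') (Var ''v'') ;;
      Assign ''cnt'' (Plus (Var ''cnt'') (Const 1)) ;;
      Store ''btail'' (Minus (Var ''e'') (Var ''cnt'')) (Var ''v'') ;;
      Store ''bhead'' (Minus (Var ''e'') (Var ''cnt'')) (Var ''t'') ;;
      Store ''deg'' (Var ''v'') (Minus (Cell ''deg'' (Var ''v'')) (Const 1)) ;;
      enqueue_step)
     (Assign ''p'' (Cell ''first'' (Cell ''queue'' (Var ''qh''))) ;;
      Assign ''qh'' (Plus (Var ''qh'') (Const 1)))"

definition toposort :: com where
  "toposort = For ''j'' ''e'' link_step ;; For ''v'' ''n'' enqueue_step ;;
     While (Neg (Conj (Neg (Less (Var ''qh'') (Var ''qt''))) (Less (Var ''p'') (Const 1)))) kahn_step"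

lemma writes_toposort [simp]:
  "writes_reg link_step = {''t'', ''h''}" "writes_arr link_step = {''next'', ''first'', ''deg''}"
  "writes_reg enqueue_step = {''qt''}" "writes_arr enqueue_step = {''queue''}"
  "writes_reg kahn_step = {''j'', ''p'', ''t'', ''v'', ''cnt'', ''qt'', ''qh''}"
  "writes_arr kahn_step = {''ftail'', ''fhead'', ''btail'', ''bhead'', ''deg'', ''queue''}"
  "writes_reg toposort = {''j'', ''p'', ''t'', ''h'', ''v'', ''cnt'', ''qt'', ''qh''}"
  "writes_arr toposort = {''next'', ''first'', ''ftail'', ''fhead'', ''btail'', ''bhead'', ''deg'', ''queue''}"
  by (auto simp: link_step_def enqueue_step_def kahn_step_def toposort_def)

lemma card_less_Suc_filter:
  "card {i. i < Suc j \<and> P i} = card {i. i < j \<and> P i} + (if P j then 1 else 0)"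
proof -
  have "{i. i < Suc j \<and> P i} = (if P j then insert j {i. i < j \<and> P i} else {i. i < j \<and> P i})"
    by (auto simp: less_Suc_eq)
  then show ?thesis by auto
qed

lemma runs_within_link:
  assumes regs: "reg s ''e'' = length es"
    and es: "\<And>i. i < length es \<Longrightarrow> arr s ''tail'' i = fst (es ! i)"
      "\<And>i. i < length es \<Longrightarrow> arr s ''head'' i = snd (es ! i)"
    and z: "arr s ''first'' = (\<lambda>_. 0)" "arr s ''deg'' = (\<lambda>_. 0)"
    and W: "Suc (length es) < W"
  shows "runs_within W (For ''j'' ''e'' link_step) s (length es * 40 + 6)
    (\<lambda>s'. (\<forall>u. arr s' ''first'' u = prev_edge es u (length es)) \<and>
      (\<forall>i < length es. arr s' ''next'' i = prev_edge es (fst (es ! i)) i) \<and>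
      (\<forall>v. arr s' ''deg'' v = pending es [] v))"
proof -
  let ?I = "\<lambda>j s'. (\<forall>u. arr s' ''first'' u = prev_edge es u j) \<and>
      (\<forall>i < j. arr s' ''next'' i = prev_edge es (fst (es ! i)) i) \<and>
      (\<forall>v. arr s' ''deg'' v = card {i. i < j \<and> snd (es ! i) = v})"
  show ?thesis
  proof (rule runs_within_For[where N = "length es" and I = ?I and K = 32])
    fix j s1 assume j: "j < length es" and ag: "agree (For ''j'' ''e'' link_step) s s1"
      and rj: "reg s1 ''j'' = j" and I: "?I j s1"
    note fr = agree_reg[OF ag] agree_arr[OF ag]
    have c: "card {i. i < j \<and> snd (es ! i) = v} \<le> j" for v
      using card_mono[of "{..<j}" "{i. i < j \<and> snd (es ! i) = v}"] by auto
    have c: "Suc (card {i. i < j \<and> snd (es ! i) = v}) < W" for v using c[of v] j W by simp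
    show "runs_within W link_step s1 32 (\<lambda>s''. ?I (Suc j) (s''\<lparr>reg := (reg s'')(''j'' := Suc j)\<rparr>))"
      using I j rj W c by (intro runs_within_flat) (auto simp: link_step_def fr es All_less_Suc card_less_Suc_filter)
  qed (use regs W z in \<open>auto simp: pending_def\<close>)
qed

lemma runs_within_enqueue:
  assumes regs: "reg s ''n'' = n" "reg s ''qt'' = 0"
    and d: "\<And>v. arr s ''deg'' v = pending es [] v" and W: "Suc n < W"
  shows "runs_within W (For ''v'' ''n'' enqueue_step) s (n * 24 + 6)
    (\<lambda>s'. \<exists>qs. kahn es n qs [] 0 0 0 \<and> reg s' ''qt'' = length qs \<and>
       (\<forall>i < length qs. arr s' ''queue'' i = qs ! i))"
proof -
  let ?I = "\<lambda>j s'. \<exists>qs. distinct qs \<and> set qs = {v. v < j \<and> pending es [] v = 0} \<and> reg s' ''qt'' = length qs \<and>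
       (\<forall>i < length qs. arr s' ''queue'' i = qs ! i)"
  show ?thesis
  proof (rule runs_within_For[where N = n and I = ?I and K = 16])
    fix j s1 assume j: "j < n" and ag: "agree (For ''v'' ''n'' enqueue_step) s s1"
      and rj: "reg s1 ''v'' = j" and I: "?I j s1"
    note fr = agree_reg[OF ag] agree_arr[OF ag]
    obtain qs where qs: "distinct qs" "set qs = {v. v < j \<and> pending es [] v = 0}" "reg s1 ''qt'' = length qs"
       "\<forall>i < length qs. arr s1 ''queue'' i = qs ! i" using I by auto
    have "length qs \<le> j" using card_mono[of "{..<j}" "set qs"] qs distinct_card[OF qs(1)] by auto
    then have lq: "Suc (length qs) < W" "Suc 0 < W" using W j by auto
    show "runs_within W enqueue_step s1 16 (\<lambda>s''. ?I (Suc j) (s''\<lparr>reg := (reg s'')(''v'' := Suc j)\<rparr>))"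
    proof (rule runs_within_flat)
      show "?I (Suc j) ((run W enqueue_step s1)\<lparr>reg := (reg (run W enqueue_step s1))(''v'' := Suc j)\<rparr>)"
        by (rule exI[of _ "if pending es [] j = 0 then qs @ [j] else qs"])
          (use qs rj lq d in \<open>auto simp: enqueue_step_def fr less_Suc_eq nth_append\<close>)
    qed (simp_all add: enqueue_step_def)
  qed (use regs W in \<open>auto simp: kahn_def topo_def\<close>)
qed


definition kahn_list_rep :: "(nat \<times> nat) list \<Rightarrow> nat list \<Rightarrow> nat list \<Rightarrow> nat \<Rightarrow> nat \<Rightarrow> state \<Rightarrow> bool" where
  "kahn_list_rep es qs js qh p s \<longleftrightarrow> reg s ''qh'' = qh \<and> reg s ''p'' = p \<and> reg s ''cnt'' = length js \<and>
     reg s ''qt'' = length qs \<and> (\<forall>i < length qs. arr s ''queue'' i = qs ! i) \<and>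
     (\<forall>v. arr s ''deg'' v = pending es js v) \<and>
     (\<forall>i < length js. arr s ''ftail'' i = fst (es ! (js ! i)) \<and> arr s ''fhead'' i = snd (es ! (js ! i)) \<and>
        arr s ''btail'' (length es - Suc i) = snd (es ! (js ! i)) \<and>
        arr s ''bhead'' (length es - Suc i) = fst (es ! (js ! i)))"

lemma kahn_list_rep_edge:
  assumes r: "kahn_list_rep es qs js qh (Suc j) s"
    and e: "reg s ''e'' = length es" "arr s ''next'' j = p'" "arr s ''tail'' j = fst (es ! j)"
      "arr s ''head'' j = snd (es ! j)"
    and j: "j < length es" "j \<notin> set js" "0 < pending es js (snd (es ! j))" "length js < length es"
    and W: "Suc (length es) < W" "Suc (length qs) < W"
  shows "kahn_list_rep es (if pending es js (snd (es ! j)) = 1 then qs @ [snd (es ! j)] else qs) (js @ [j]) qh p'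
    (run W kahn_step s)"
proof -
  let ?h = "snd (es ! j)"
  have q: "\<forall>i < length qs. arr s ''queue'' i = qs ! i" and d: "\<And>v. arr s ''deg'' v = pending es js v"
    and rg: "reg s ''qh'' = qh" "reg s ''p'' = Suc j" "reg s ''cnt'' = length js" "reg s ''qt'' = length qs"
    and a: "\<forall>i < length js. arr s ''ftail'' i = fst (es ! (js ! i)) \<and> arr s ''fhead'' i = snd (es ! (js ! i)) \<and>
        arr s ''btail'' (length es - Suc i) = snd (es ! (js ! i)) \<and>
        arr s ''bhead'' (length es - Suc i) = fst (es ! (js ! i))"
    using r by (auto simp: kahn_list_rep_def)
  have W1: "Suc 0 < W" "Suc (length js) < W" using W j by auto
  let ?s = "run W kahn_step s"
  have 1: "reg ?s ''qh'' = qh" "reg ?s ''p'' = p'" "reg ?s ''cnt'' = Suc (length js)"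
    "reg ?s ''qt'' = (if pending es js ?h = 1 then Suc (length qs) else length qs)"
    "arr ?s ''queue'' = (if pending es js ?h = 1 then (arr s ''queue'')(length qs := ?h) else arr s ''queue'')"
    "arr ?s ''deg'' = (arr s ''deg'')(?h := pending es js ?h - 1)"
    "arr ?s ''ftail'' = (arr s ''ftail'')(length js := fst (es ! j))"
    "arr ?s ''fhead'' = (arr s ''fhead'')(length js := ?h)"
    "arr ?s ''btail'' = (arr s ''btail'')(length es - Suc (length js) := ?h)"
    "arr ?s ''bhead'' = (arr s ''bhead'')(length es - Suc (length js) := fst (es ! j))"
    using rg e d j(3) W1 W by (simp_all add: kahn_step_def enqueue_step_def)
  have ne: "length es - Suc i \<noteq> length es - Suc (length js)" if "i < length js" for i
    using that j(4) by auto
  show ?thesis unfolding kahn_list_rep_def 1 using a q d ne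
    by (auto simp: pending_snoc[OF j(1,2)] nth_append less_Suc_eq)
qed

lemma runs_within_toposort:
  assumes regs: "reg s ''e'' = length es" "reg s ''n'' = n" "reg s ''qt'' = 0" "reg s ''qh'' = 0"
      "reg s ''cnt'' = 0" "reg s ''p'' = 0"
    and es: "\<And>i. i < length es \<Longrightarrow> arr s ''tail'' i = fst (es ! i)"
      "\<And>i. i < length es \<Longrightarrow> arr s ''head'' i = snd (es ! i)"
    and z: "arr s ''first'' = (\<lambda>_. 0)" "arr s ''deg'' = (\<lambda>_. 0)"
    and W: "Suc (length es) < W" "Suc n < W"
    and g: "set es \<subseteq> {..<n} \<times> {..<n}" "acyclic (set es)" "distinct es"
  shows "runs_within W toposort s (length es * 140 + n * 140 + 30)
    (\<lambda>s'. \<exists>os. set os = set es \<and> distinct os \<and> length os = length es \<and> topo os \<and>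
      (\<forall>j < length es. arr s' ''ftail'' j = fst (os ! j) \<and> arr s' ''fhead'' j = snd (os ! j)) \<and>
      (\<forall>j < length es. arr s' ''btail'' j = fst (rev (map prod.swap os) ! j) \<and>
         arr s' ''bhead'' j = snd (rev (map prod.swap os) ! j)))"
  unfolding toposort_def
proof (rule runs_within_Seq[where ?T1.0 = "length es * 40 + 6" and ?T2.0 = "length es * 100 + n * 140 + 24"])
  show "runs_within W (For ''j'' ''e'' link_step) s (length es * 40 + 6)
    (\<lambda>s'. (\<forall>u. arr s' ''first'' u = prev_edge es u (length es)) \<and>
      (\<forall>i < length es. arr s' ''next'' i = prev_edge es (fst (es ! i)) i) \<and>
      (\<forall>v. arr s' ''deg'' v = pending es [] v))"
    by (rule runs_within_link) (use regs es z W in auto)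
next
  let ?b = "Neg (Conj (Neg (Less (Var ''qh'') (Var ''qt''))) (Less (Var ''p'') (Const 1)))"
  let ?post = "(\<lambda>s'. \<exists>os. set os = set es \<and> distinct os \<and> length os = length es \<and> topo os \<and>
      (\<forall>j < length es. arr s' ''ftail'' j = fst (os ! j) \<and> arr s' ''fhead'' j = snd (os ! j)) \<and>
      (\<forall>j < length es. arr s' ''btail'' j = fst (rev (map prod.swap os) ! j) \<and>
         arr s' ''bhead'' j = snd (rev (map prod.swap os) ! j)))"
  fix s1 assume ag1: "agree (For ''j'' ''e'' link_step) s s1"
    and s1: "(\<forall>u. arr s1 ''first'' u = prev_edge es u (length es)) \<and>
      (\<forall>i < length es. arr s1 ''next'' i = prev_edge es (fst (es ! i)) i) \<and>
      (\<forall>v. arr s1 ''deg'' v = pending es [] v)"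
  note fr1 = agree_reg[OF ag1] agree_arr[OF ag1]
  show "runs_within W (For ''v'' ''n'' enqueue_step ;; While ?b kahn_step) s1 (length es * 100 + n * 140 + 24) ?post"
  proof (rule runs_within_Seq[where ?T1.0 = "n * 24 + 6" and ?T2.0 = "length es * 100 + n * 100 + 14"])
    show "runs_within W (For ''v'' ''n'' enqueue_step) s1 (n * 24 + 6)
    (\<lambda>s'. \<exists>qs. kahn es n qs [] 0 0 0 \<and> reg s' ''qt'' = length qs \<and>
       (\<forall>i < length qs. arr s' ''queue'' i = qs ! i))"
      by (rule runs_within_enqueue) (use regs s1 W in \<open>auto simp: fr1\<close>)
  next
    fix s2 assume ag2: "agree (For ''v'' ''n'' enqueue_step) s1 s2"
      and s2: "\<exists>qs. kahn es n qs [] 0 0 0 \<and> reg s2 ''qt'' = length qs \<and>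
       (\<forall>i < length qs. arr s2 ''queue'' i = qs ! i)"
    note fr2 = agree_reg[OF ag2] agree_arr[OF ag2]
    let ?I = "\<lambda>s'. \<exists>qs js qh cu cq. kahn es n qs js qh cu cq \<and> kahn_list_rep es qs js qh (prev_edge es cu cq) s'"
    show "runs_within W (While ?b kahn_step) s2 (length es * 100 + n * 100 + 14) ?post"
    \<comment> \<open>A round costs at most 80 for the body and 10 for the test and branch. It
      lowers the number of remaining edges or vertices by one, which is worth 100.\<close>
    proof (rule runs_within_While[where I = ?I and K = "\<lambda>_. 80" and
          pot = "\<lambda>s'. 100 * ((length es - reg s' ''cnt'') + (n - reg s' ''qh''))"])
      obtain qs where "kahn es n qs [] 0 0 0" "reg s2 ''qt'' = length qs"
        "\<forall>i < length qs. arr s2 ''queue'' i = qs ! i" using s2 by auto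
      \<comment> \<open>No vertex is current at the start: \<open>cq = 0\<close> makes its edge list
        empty, and the vertex 0 is a mere placeholder.\<close>
      then have "kahn es n qs [] 0 0 0 \<and> kahn_list_rep es qs [] 0 (prev_edge es 0 0) s2"
        using s1 regs by (simp add: kahn_list_rep_def fr1 fr2)
      then show "?I s2" by blast
    next
      fix s3 assume ag3: "agree kahn_step s2 s3" and I: "?I s3" and b: "bval W ?b s3"
      note fr3 = agree_reg[OF ag3] agree_arr[OF ag3]
      obtain qs js qh cu cq where k: "kahn es n qs js qh cu cq" and r: "kahn_list_rep es qs js qh (prev_edge es cu cq) s3"
        using I by blast
      note le = kahn_length_le[OF k]
      have rg: "reg s3 ''p'' = prev_edge es cu cq" "reg s3 ''qh'' = qh" "reg s3 ''qt'' = length qs"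
        "reg s3 ''cnt'' = length js" using r by (auto simp: kahn_list_rep_def)
      have W1: "Suc 0 < W" using W by simp
      have mc: "flat kahn_step" "max_cost kahn_step \<le> 80" by (simp_all add: kahn_step_def enqueue_step_def)
      have "?I (run W kahn_step s3) \<and> Suc ((length es - reg (run W kahn_step s3) ''cnt'') +
          (n - reg (run W kahn_step s3) ''qh'')) \<le> (length es - length js) + (n - qh)"
      proof (cases "prev_edge es cu cq")
        case (Suc j)
        have "j < length es" using prev_edge_SucD[OF Suc] k by (auto simp: kahn_def)
        then have "es ! j \<in> {..<n} \<times> {..<n}" using g(1) nth_mem by blast
        then have jV: "snd (es ! j) < n" by (simp add: mem_Times_iff)
        note ke = kahn_edge[OF k Suc jV]
        have "length (js @ [j]) \<le> length es" using kahn_length_le[OF ke(5)] by simp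
        then have lj: "length js < length es" by simp
        have "kahn_list_rep es (if pending es js (snd (es ! j)) = 1 then qs @ [snd (es ! j)] else qs) (js @ [j]) qh
            (prev_edge es cu j) (run W kahn_step s3)"
          by (rule kahn_list_rep_edge) (use r Suc s1 regs es ke lj W le in \<open>auto simp: fr1 fr2 fr3\<close>)
        with ke(5) have "?I (run W kahn_step s3)"
          and "reg (run W kahn_step s3) ''cnt'' = Suc (length js)" "reg (run W kahn_step s3) ''qh'' = qh"
          by (blast, simp_all add: kahn_list_rep_def)
        then show ?thesis using lj by simp
      next
        case 0
        then have q: "qh < length qs" using b rg W1 by simp
        have "arr s3 ''queue'' qh = qs ! qh" "\<And>u. arr s3 ''first'' u = prev_edge es u (length es)"
          using r q s1 by (auto simp: kahn_list_rep_def fr2 fr3)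
        then have r': "kahn_list_rep es qs js (Suc qh) (prev_edge es (qs ! qh) (length es)) (run W kahn_step s3)"
          and c: "reg (run W kahn_step s3) ''cnt'' = length js" "reg (run W kahn_step s3) ''qh'' = Suc qh"
          using r 0 q W1 W le by (simp_all add: kahn_list_rep_def kahn_step_def)
        have "?I (run W kahn_step s3)" using kahn_pop[OF k 0 q] r' by blast
        then show ?thesis using q le c by simp
      qed
      then show "runs_within W kahn_step s3 80 (\<lambda>s''. ?I s'' \<and> bcost ?b + 1 + 80 +
          100 * ((length es - reg s'' ''cnt'') + (n - reg s'' ''qh'')) \<le>
          100 * ((length es - reg s3 ''cnt'') + (n - reg s3 ''qh'')))"
        using mc rg by (intro runs_within_flat) simp_all
    next
      fix s3 assume ag3: "agree kahn_step s2 s3" and I: "?I s3" and b: "\<not> bval W ?b s3"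
      obtain qs js qh cu cq where k: "kahn es n qs js qh cu cq" and r: "kahn_list_rep es qs js qh (prev_edge es cu cq) s3"
        using I by blast
      have p0: "prev_edge es cu cq = 0" and q: "qh = length qs" using b r k W by (auto simp: kahn_list_rep_def kahn_def)
      have js: "set js = {..<length es}" using kahn_final[OF k p0 q g(1,2)] .
      have dj: "distinct js" using k by (simp add: kahn_def)
      have lj: "length js = length es" using distinct_card[OF dj] js by simp
      define os where "os = map ((!) es) js"
      have lo: "length os = length es" by (simp add: os_def lj)
      have "set os = set es" unfolding os_def set_map js by (metis lessThan_atLeast0 nth_image order_refl take_all)
      moreover have "distinct os" unfolding os_def using dj g(3) js by (auto simp: distinct_map inj_on_nth)
      moreover have "topo os" using k by (simp add: kahn_def os_def)
      moreover have a: "arr s3 ''ftail'' i = fst (os ! i)" "arr s3 ''fhead'' i = snd (os ! i)"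
        "arr s3 ''btail'' (length es - Suc i) = snd (os ! i)"
        "arr s3 ''bhead'' (length es - Suc i) = fst (os ! i)" if "i < length es" for i
        using r that lj by (auto simp: kahn_list_rep_def os_def)
      moreover have "arr s3 ''btail'' i = fst (rev (map prod.swap os) ! i)"
        "arr s3 ''bhead'' i = snd (rev (map prod.swap os) ! i)" if "i < length es" for i
        using a(3,4)[of "length es - Suc i"] that lo by (auto simp: rev_nth Suc_diff_Suc)
      ultimately show "?post s3" using lo by (intro exI[of _ os]) simp
    qed (use regs in \<open>simp_all add: fr1 fr2\<close>)
  qed simp
qed simp

section \<open>Counting paths and propagating automaton states\<close>

definition mark_step :: "char \<Rightarrow> com" where
  "mark_step d = Store (d # ''ns'') (Cell (d # ''head'') (Var ''j'')) (Const 1)"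

text \<open>\<open>ns\<close> marks the vertices that are not sources. Before any edge is used, a
  source has one path, consisting of itself, and every other vertex has none.\<close>

definition count_paths_init :: "char \<Rightarrow> com" where
  "count_paths_init d = Store (d # ''mu'') (Var ''v'') (Minus (Const 1) (Cell (d # ''ns'') (Var ''v'')))"

text \<open>
  The counts are cut off at \<open>m + 1\<close> because they need not fit into a machine word. This does no harm:
  no vertex has more than \<open>m + 1\<close> states.
\<close>

definition count_paths_step :: "char \<Rightarrow> com" where
  "count_paths_step d = Assign ''t'' (Cell (d # ''tail'') (Var ''j'')) ;;
     Assign ''h'' (Cell (d # ''head'') (Var ''j'')) ;;
     Assign ''x'' (Plus (Cell (d # ''mu'') (Var ''h'')) (Cell (d # ''mu'') (Var ''t''))) ;;
     Cond (Less (Var ''m1'') (Var ''x'')) (Store (d # ''mu'') (Var ''h'') (Var ''m1''))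
       (Store (d # ''mu'') (Var ''h'') (Var ''x''))"

definition count_paths :: "char \<Rightarrow> com" where
  "count_paths d = For ''j'' ''e'' (mark_step d) ;; For ''v'' ''n'' (count_paths_init d) ;; For ''j'' ''e'' (count_paths_step d)"

lemma writes_count_paths [simp]:
  "writes_reg (mark_step d) = {}" "writes_arr (mark_step d) = {d # ''ns''}"
  "writes_reg (count_paths_init d) = {}" "writes_arr (count_paths_init d) = {d # ''mu''}"
  "writes_reg (count_paths_step d) = {''t'', ''h'', ''x''}" "writes_arr (count_paths_step d) = {d # ''mu''}"
  "writes_reg (count_paths d) = {''j'', ''v'', ''t'', ''h'', ''x''}" "writes_arr (count_paths d) = {d # ''ns'', d # ''mu''}"
  by (auto simp: mark_step_def count_paths_init_def count_paths_step_def count_paths_def)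

lemma runs_within_count_paths:
  assumes regs: "reg s ''e'' = length es" "reg s ''n'' = n" "reg s ''m1'' = m1"
    and es: "\<And>i. i < length es \<Longrightarrow> arr s (d # ''tail'') i = fst (es ! i)"
      "\<And>i. i < length es \<Longrightarrow> arr s (d # ''head'') i = snd (es ! i)"
    and z: "arr s (d # ''ns'') = (\<lambda>_. 0)"
    and W: "length es < W" "n < W" "2 * m1 < W" "0 < m1"
    and g: "set es \<subseteq> {..<n} \<times> {..<n}" "topo es" "distinct es"
  shows "runs_within W (count_paths d) s (length es * 50 + n * 14 + 18)
    (\<lambda>s'. \<forall>v < n. arr s' (d # ''ns'') v = of_bool (v \<in> snd ` set es) \<and>
       arr s' (d # ''mu'') v = min m1 (card (src_paths es (srcs (set es) {..<n}) (length es) v)))"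
  unfolding count_paths_def
proof (rule runs_within_Seq[where ?T1.0 = "length es * 12 + 6" and ?T2.0 = "length es * 38 + n * 14 + 12"])
  let ?Src = "srcs (set es) {..<n}"
  let ?ns = "\<lambda>j s'. \<forall>v. arr s' (d # ''ns'') v = of_bool (v \<in> snd ` set (take j es))"
  show "runs_within W (For ''j'' ''e'' (mark_step d)) s (length es * 12 + 6) (?ns (length es))"
  proof (rule runs_within_For[where N = "length es" and I = ?ns and K = 4])
    fix j s1 assume j: "j < length es" and ag: "agree (For ''j'' ''e'' (mark_step d)) s s1"
      and rj: "reg s1 ''j'' = j" and I: "?ns j s1"
    note fr = agree_reg[OF ag] agree_arr[OF ag]
    show "runs_within W (mark_step d) s1 4 (\<lambda>s''. ?ns (Suc j) (s''\<lparr>reg := (reg s'')(''j'' := Suc j)\<rparr>))"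
      using I j rj W es by (intro runs_within_flat) (auto simp: mark_step_def fr take_Suc_conv_app_nth)
  qed (use regs W z in auto)
next
  let ?Src = "srcs (set es) {..<n}"
  let ?post = "\<lambda>s'. \<forall>v < n. arr s' (d # ''ns'') v = of_bool (v \<in> snd ` set es) \<and>
       arr s' (d # ''mu'') v = min m1 (card (src_paths es ?Src (length es) v))"
  fix s1 assume ag1: "agree (For ''j'' ''e'' (mark_step d)) s s1"
    and s1: "\<forall>v. arr s1 (d # ''ns'') v = of_bool (v \<in> snd ` set (take (length es) es))"
  note fr1 = agree_reg[OF ag1] agree_arr[OF ag1]
  show "runs_within W (For ''v'' ''n'' (count_paths_init d) ;; For ''j'' ''e'' (count_paths_step d)) s1
    (length es * 38 + n * 14 + 12) ?post"
  proof (rule runs_within_Seq[where ?T1.0 = "n * 14 + 6" and ?T2.0 = "length es * 38 + 6"])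
    let ?I = "\<lambda>w s'. \<forall>v < w. arr s' (d # ''mu'') v = of_bool (v \<notin> snd ` set es)"
    show "runs_within W (For ''v'' ''n'' (count_paths_init d)) s1 (n * 14 + 6) (?I n)"
    proof (rule runs_within_For[where N = n and I = ?I and K = 6])
      fix v s2 assume v: "v < n" and ag2: "agree (For ''v'' ''n'' (count_paths_init d)) s1 s2"
        and rv: "reg s2 ''v'' = v" and I: "?I v s2"
      note fr2 = agree_reg[OF ag2] agree_arr[OF ag2]
      show "runs_within W (count_paths_init d) s2 6 (\<lambda>s''. ?I (Suc v) (s''\<lparr>reg := (reg s'')(''v'' := Suc v)\<rparr>))"
        using I rv W s1 by (intro runs_within_flat) (auto simp: count_paths_init_def fr2 less_Suc_eq)
    qed (use regs W in \<open>auto simp: fr1\<close>)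
  next
    fix s2 assume ag2: "agree (For ''v'' ''n'' (count_paths_init d)) s1 s2"
      and s2: "\<forall>v < n. arr s2 (d # ''mu'') v = of_bool (v \<notin> snd ` set es)"
    note fr2 = agree_reg[OF ag2] agree_arr[OF ag2]
    let ?I = "\<lambda>j s'. \<forall>v < n. arr s' (d # ''mu'') v = min m1 (card (src_paths es ?Src j v))"
    show "runs_within W (For ''j'' ''e'' (count_paths_step d)) s2 (length es * 38 + 6) ?post"
    proof (rule runs_within_For[where N = "length es" and I = ?I and K = 30])
      fix j s3 assume j: "j < length es" and ag3: "agree (For ''j'' ''e'' (count_paths_step d)) s2 s3"
        and rj: "reg s3 ''j'' = j" and I: "?I j s3"
      note fr3 = agree_reg[OF ag3] agree_arr[OF ag3]
      obtain t h where th: "es ! j = (t, h)" by fastforce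
      have thn: "t < n" "h < n" using g(1) nth_mem[OF j] th by auto
      \<comment> \<open>Cutting off the summands first does not change the cut-off sum, and the sum
        of two cut-off counts is at most \<open>2 * m1\<close>, so the addition does not
        wrap.\<close>
      let ?x = "min m1 (card (src_paths es ?Src j h)) + min m1 (card (src_paths es ?Src j t))"
      have x: "?x < W" using W by simp
      have mh: "min m1 (card (src_paths es ?Src (Suc j) h)) = min m1 ?x"
        using card_src_paths_Suc[OF g(2,3) j th, of ?Src] by simp
      have "reg s3 ''m1'' = m1" using regs by (simp add: fr1 fr2 fr3)
      then have run: "arr (run W (count_paths_step d) s3) (d # ''mu'') = (arr s3 (d # ''mu''))(h := min m1 ?x)"
        using I thn th rj j x es by (simp add: count_paths_step_def fr1 fr2 fr3 min_def)
      have "?I (Suc j) ((run W (count_paths_step d) s3)\<lparr>reg := (reg (run W (count_paths_step d) s3))(''j'' := Suc j)\<rparr>)"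
        unfolding run.simps using I mh src_paths_Suc[OF g(2) j th, of ?Src] by (auto simp: run)
      then show "runs_within W (count_paths_step d) s3 30 (\<lambda>s''. ?I (Suc j) (s''\<lparr>reg := (reg s'')(''j'' := Suc j)\<rparr>))"
        by (intro runs_within_flat) (simp_all add: count_paths_step_def)
    next
      fix s3 assume ag3: "agree (For ''j'' ''e'' (count_paths_step d)) s2 s3" and I: "?I (length es) s3"
      note fr3 = agree_reg[OF ag3] agree_arr[OF ag3]
      show "?post s3" using I s1 by (simp add: fr2 fr3)
    next
      show "?I 0 (s2\<lparr>reg := (reg s2)(''j'' := 0)\<rparr>)" using s2 W(4) by (auto simp: src_paths_0 srcs_def)
    qed (use regs W in \<open>auto simp: fr1 fr2\<close>)
  qed simp
qed simp

section \<open>Dividing the vertices and propagating sets of states\<close>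

definition side_step :: com where
  "side_step = Cond (Less (Cell ''bmu'' (Var ''v'')) (Cell ''fmu'' (Var ''v'')))
     (Store ''bside'' (Var ''v'') (Const 1)) (Store ''fside'' (Var ''v'') (Const 1))"

definition sides :: com where
  "sides = For ''v'' ''n'' side_step"

lemma writes_sides [simp]:
  "writes_reg side_step = {}" "writes_arr side_step = {''bside'', ''fside''}"
  "writes_reg sides = {''v''}" "writes_arr sides = {''bside'', ''fside''}"
  by (auto simp: side_step_def sides_def)

lemma runs_within_sides:
  assumes regs: "reg s ''n'' = n"
    and z: "arr s ''bside'' = (\<lambda>_. 0)" "arr s ''fside'' = (\<lambda>_. 0)"
    and W: "n < W" "1 < W"
  shows "runs_within W sides s (n * 20 + 6)
    (\<lambda>s'. \<forall>v < n. arr s' ''fside'' v = of_bool (arr s ''fmu'' v \<le> arr s ''bmu'' v) \<and>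
       arr s' ''bside'' v = of_bool (\<not> arr s ''fmu'' v \<le> arr s ''bmu'' v))"
proof -
  let ?I = "\<lambda>w s'. \<forall>v. arr s' ''fside'' v = of_bool (v < w \<and> arr s ''fmu'' v \<le> arr s ''bmu'' v) \<and>
       arr s' ''bside'' v = of_bool (v < w \<and> \<not> arr s ''fmu'' v \<le> arr s ''bmu'' v)"
  show ?thesis unfolding sides_def
  proof (rule runs_within_For[where N = n and I = ?I and K = 12])
    fix v s1 assume v: "v < n" and ag: "agree (For ''v'' ''n'' side_step) s s1"
      and rv: "reg s1 ''v'' = v" and I: "?I v s1"
    note fr = agree_reg[OF ag] agree_arr[OF ag]
    show "runs_within W side_step s1 12 (\<lambda>s''. ?I (Suc v) (s''\<lparr>reg := (reg s'')(''v'' := Suc v)\<rparr>))"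
      using I rv W by (intro runs_within_flat) (auto simp: side_step_def fr less_Suc_eq)
  qed (use regs W z in auto)
qed

text \<open>The states of a vertex are stored twice: as a bit table \<open>seen\<close> for
  membership in constant time, and as a list, so that enumerating them costs their number and not m
  + 1.\<close>

definition push :: "char \<Rightarrow> com" where
  "push d = Cond (Less (Cell (d # ''seen'') (At (Var ''h'') ''m1'' (Var ''x''))) (Const 1))
     (Store (d # ''seen'') (At (Var ''h'') ''m1'' (Var ''x'')) (Const 1) ;;
      Store (d # ''list'') (At (Var ''h'') ''m1'' (Cell (d # ''size'') (Var ''h''))) (Var ''x'') ;;
      Store (d # ''size'') (Var ''h'') (Plus (Cell (d # ''size'') (Var ''h'')) (Const 1)))
     Skip"

text \<open>The automaton starts in state 0, so the address in the transition table is the label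
  alone.\<close>

definition init_step :: "char \<Rightarrow> com" where
  "init_step d = Cond (Conj (Less (Cell (d # ''ns'') (Var ''h'')) (Const 1)) (Less (Const 0) (Cell (d # ''side'') (Var ''h''))))
     (Assign ''x'' (Cell (d # ''delta'') (Cell ''label'' (Var ''h''))) ;; push d) Skip"

definition extend_step :: "char \<Rightarrow> com" where
  "extend_step d = Assign ''x'' (Cell (d # ''delta'')
       (At (Cell (d # ''list'') (At (Var ''t'') ''m1'' (Var ''i''))) ''sigma'' (Cell ''label'' (Var ''h'')))) ;;
     push d"

definition pass_edge :: "char \<Rightarrow> com" where
  "pass_edge d = (Assign ''t'' (Cell (d # ''tail'') (Var ''j'')) ;;
     Assign ''h'' (Cell (d # ''head'') (Var ''j'')) ;;
     Assign ''k'' (Cell (d # ''size'') (Var ''t''))) ;;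
     Cond (Less (Const 0) (Cell (d # ''side'') (Var ''h'')))
       (For ''i'' ''k'' (extend_step d)) Skip"

definition pass :: "char \<Rightarrow> com" where
  "pass d = For ''h'' ''n'' (init_step d) ;; For ''j'' ''e'' (pass_edge d)"

lemma writes_pass [simp]:
  "writes_reg (push d) = {}" "writes_arr (push d) = {d # ''seen'', d # ''list'', d # ''size''}"
  "writes_reg (init_step d) = {''x''}" "writes_arr (init_step d) = {d # ''seen'', d # ''list'', d # ''size''}"
  "writes_reg (extend_step d) = {''x''}" "writes_arr (extend_step d) = {d # ''seen'', d # ''list'', d # ''size''}"
  "writes_reg (pass_edge d) = {''t'', ''h'', ''k'', ''i'', ''x''}" "writes_arr (pass_edge d) = {d # ''seen'', d # ''list'', d # ''size''}"
  "writes_reg (pass d) = {''j'', ''t'', ''h'', ''k'', ''i'', ''x''}" "writes_arr (pass d) = {d # ''seen'', d # ''list'', d # ''size''}"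
  by (auto simp: push_def init_step_def extend_step_def pass_edge_def pass_def)

lemma flat_push [simp]: "flat (push d)" "max_cost (push d) = 30"
  by (simp_all add: push_def)

definition list_rep :: "char \<Rightarrow> nat \<Rightarrow> nat \<Rightarrow> nat \<Rightarrow> (nat \<Rightarrow> nat list) \<Rightarrow> state \<Rightarrow> bool" where
  "list_rep d n m m1 L s \<longleftrightarrow> (\<forall>v < n. distinct (L v) \<and> set (L v) \<subseteq> {..m} \<and>
     arr s (d # ''size'') v = length (L v) \<and>
     (\<forall>i < length (L v). arr s (d # ''list'') (v * m1 + i) = L v ! i) \<and>
     (\<forall>x \<le> m. arr s (d # ''seen'') (v * m1 + x) = of_bool (x \<in> set (L v))))"

lemma list_rep_cong:
  "list_rep d n m m1 L s \<Longrightarrow> arr s' (d # ''size'') = arr s (d # ''size'') \<Longrightarrow>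
   arr s' (d # ''list'') = arr s (d # ''list'') \<Longrightarrow> arr s' (d # ''seen'') = arr s (d # ''seen'') \<Longrightarrow>
   list_rep d n m m1 L s'"
  by (simp add: list_rep_def)

lemma list_rep_reg [simp]: "list_rep d n m m1 L (s\<lparr>reg := f\<rparr>) \<longleftrightarrow> list_rep d n m m1 L s"
  by (simp add: list_rep_def)

lemma list_rep_push:
  assumes r: "list_rep d n m m1 L s" and rg: "reg s ''h'' = h" "reg s ''x'' = x" "reg s ''m1'' = m1"
    and hx: "h < n" "x \<le> m" and W: "m1 = Suc m" "m1 < W" "n * m1 \<le> W"
  shows "list_rep d n m m1 (L(h := if x \<in> set (L h) then L h else L h @ [x])) (run W (push d) s)"
proof (cases "x \<in> set (L h)")
  case True
  have ix: "(h * m1 mod W + x) mod W = h * m1 + x"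
    using index_less[of h n x m1 W] hx W by (simp add: mod_add_left_eq)
  have "Suc 0 < W" "arr s (d # ''seen'') (h * m1 + x) = 1" using W r hx True by (auto simp: list_rep_def)
  then have "run W (push d) s = s" using rg unfolding push_def by (simp add: ix)
  then show ?thesis using r True by simp
next
  case False
  have ix: "(h * m1 mod W + i) mod W = h * m1 + i" if "i < m1" for i
    using index_less[of h n i m1 W] hx W that by (simp add: mod_add_left_eq)
  have L: "distinct (L v)" "set (L v) \<subseteq> {..m}" "arr s (d # ''size'') v = length (L v)"
    "\<And>i. i < length (L v) \<Longrightarrow> arr s (d # ''list'') (v * m1 + i) = L v ! i"
    "\<And>x. x \<le> m \<Longrightarrow> arr s (d # ''seen'') (v * m1 + x) = of_bool (x \<in> set (L v))" if "v < n" for v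
    using r that by (auto simp: list_rep_def)
  have len: "length (L v) \<le> m1" if "v < n" for v
    using card_mono[of "{..m}" "set (L v)"] L[OF that] distinct_card[of "L v"] W by simp
  \<comment> \<open>The old states together with the new one are at most m + 1 in number, so the
    next free index is still inside the row of \<open>h\<close>.\<close>
  have "card (insert x (set (L h))) \<le> card {..m}" using L[OF hx(1)] hx by (intro card_mono) auto
  then have lh: "length (L h) < m1" using False L[OF hx(1)] distinct_card[of "L h"] W by simp
  have xm: "x < m1" using hx W by simp
  have W1: "Suc 0 < W" "Suc (length (L h)) < W" using W lh by auto
  let ?s = "run W (push d) s"
  have run: "arr ?s (d # ''seen'') = (arr s (d # ''seen''))(h * m1 + x := 1)"
    "arr ?s (d # ''list'') = (arr s (d # ''list''))(h * m1 + length (L h) := x)"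
    "arr ?s (d # ''size'') = (arr s (d # ''size''))(h := Suc (length (L h)))"
    using rg W1 False hx L(5)[OF hx] unfolding push_def
    by (simp_all add: ix[OF xm] ix[OF lh] L(3)[OF hx(1)])
  have ne1: "v * m1 + y = h * m1 + x \<longleftrightarrow> v = h \<and> y = x" if "y \<le> m" for v y
    using index_inj[of y m1 x v h] that W xm by simp
  have ne2: "v * m1 + i = h * m1 + length (L h) \<longleftrightarrow> v = h \<and> i = length (L h)" if "i < m1" for v i
    using index_inj[of i m1 "length (L h)" v h] that lh by simp
  show ?thesis unfolding list_rep_def
  proof (intro allI impI)
    fix v assume v: "v < n"
    show "distinct ((L(h := if x \<in> set (L h) then L h else L h @ [x])) v) \<and>
         set ((L(h := if x \<in> set (L h) then L h else L h @ [x])) v) \<subseteq> {..m} \<and>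
         arr ?s (d # ''size'') v = length ((L(h := if x \<in> set (L h) then L h else L h @ [x])) v) \<and>
         (\<forall>i<length ((L(h := if x \<in> set (L h) then L h else L h @ [x])) v).
             arr ?s (d # ''list'') (v * m1 + i) = (L(h := if x \<in> set (L h) then L h else L h @ [x])) v ! i) \<and>
         (\<forall>xa\<le>m. arr ?s (d # ''seen'') (v * m1 + xa) =
             of_bool (xa \<in> set ((L(h := if x \<in> set (L h) then L h else L h @ [x])) v)))"
      using L[OF v] len[OF v] lh False hx
      by (cases "v = h") (auto simp: run ne1 ne2 less_Suc_eq nth_append)
  qed
qed


text \<open>One direction of the propagation, used for the sorted edges with \<open>S\<close> and
  \<open>A\<close>, and for the reversed ones with \<open>rev S\<close> and the complement of
  \<open>A\<close>. Closure of \<open>A\<close> under predecessors means that states on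
  \<open>A\<close> depend on states on \<open>A\<close> only, so the bound \<open>k\<close> is asked
  for there only.\<close>

locale direction =
  fixes W n m m1 \<sigma> k :: nat and d :: char and es :: "(nat \<times> nat) list" and S :: "nat list"
    and l :: "nat \<Rightarrow> nat" and A :: "nat set"
  assumes g: "set es \<subseteq> {..<n} \<times> {..<n}" "topo es"
    and S: "length S = m" and l: "\<And>v. v < n \<Longrightarrow> l v < \<sigma>"
    and A: "\<And>u v. (u, v) \<in> set es \<Longrightarrow> v \<in> A \<Longrightarrow> u \<in> A"
    and W: "m1 = Suc m" "m1 < W" "n < W" "length es < W" "n * m1 \<le> W" "m1 * \<sigma> \<le> W"
    and k: "\<And>v. v < n \<Longrightarrow> v \<in> A \<Longrightarrow>
      card ((\<lambda>P. longest_match S (map l P)) ` src_paths es (srcs (set es) {..<n}) (length es) v) \<le> k"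
begin

definition states :: "nat \<Rightarrow> nat \<Rightarrow> nat set" where
  "states j v = (\<lambda>P. longest_match S (map l P)) ` src_paths es (srcs (set es) {..<n}) j v"

lemma states_0: "states 0 v = (if v \<in> srcs (set es) {..<n} then {kmp_step S 0 (l v)} else {})"
  by (simp add: states_def src_paths_0 kmp_step_def)

lemma states_Suc:
  assumes "j < length es" "es ! j = (t, h)"
  shows "states (Suc j) v = (if v = h then states j h \<union> (\<lambda>a. kmp_step S a (l h)) ` states j t else states j v)"
  unfolding states_def src_paths_Suc[OF g(2) assms] by (auto simp: image_Un image_image longest_match_snoc)

text \<open>The states after \<open>j\<close> edges are among the final ones, so the bound on the
  final sets limits the work at every edge.\<close>

lemma states_le: "v < n \<Longrightarrow> v \<in> A \<Longrightarrow> card (states j v) \<le> k"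
proof -
  assume "v < n" "v \<in> A"
  moreover have "card (states j v) \<le> card (states (length es) v)"
    unfolding states_def by (intro card_mono image_mono src_paths_mono_full finite_imageI finite_src_paths g) simp
  ultimately show ?thesis using k unfolding states_def by fastforce
qed

definition env :: "state \<Rightarrow> bool" where
  "env s \<longleftrightarrow> reg s ''n'' = n \<and> reg s ''e'' = length es \<and> reg s ''m1'' = m1 \<and> reg s ''sigma'' = \<sigma> \<and>
    (\<forall>i < length es. arr s (d # ''tail'') i = fst (es ! i) \<and> arr s (d # ''head'') i = snd (es ! i)) \<and>
    (\<forall>v < n. arr s (d # ''ns'') v = of_bool (v \<in> snd ` set es) \<and> arr s (d # ''side'') v = of_bool (v \<in> A) \<and>
       arr s ''label'' v = l v) \<and>
    (\<forall>a \<le> m. \<forall>c < \<sigma>. arr s (d # ''delta'') (a * \<sigma> + c) = kmp_step S a c)"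

lemma env_cong:
  assumes "env s" "\<And>x. x \<in> {''n'', ''e'', ''m1'', ''sigma''} \<Longrightarrow> reg s' x = reg s x"
    "\<And>a. a \<in> {d # ''tail'', d # ''head'', d # ''ns'', d # ''side'', ''label'', d # ''delta''} \<Longrightarrow> arr s' a = arr s a"
  shows "env s'"
  using assms unfolding env_def by simp

lemma env_agree: "env s \<Longrightarrow> agree p s s' \<Longrightarrow> writes_reg p \<inter> {''n'', ''e'', ''m1'', ''sigma''} = {} \<Longrightarrow>
    writes_arr p \<inter> {d # ''tail'', d # ''head'', d # ''ns'', d # ''side'', ''label'', d # ''delta''} = {} \<Longrightarrow> env s'"
  by (erule env_cong) (auto simp: agree_def)

definition lists_at :: "nat \<Rightarrow> (nat \<Rightarrow> nat list) \<Rightarrow> state \<Rightarrow> bool" where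
  "lists_at j L s \<longleftrightarrow> list_rep d n m m1 L s \<and> (\<forall>v < n. set (L v) = (if v \<in> A then states j v else {}))"

lemma runs_within_init:
  assumes e: "env s" and r: "list_rep d n m m1 (\<lambda>_. []) s"
  shows "runs_within W (For ''h'' ''n'' (init_step d)) s (n * 60 + 6) (\<lambda>s'. \<exists>L. lists_at 0 L s')"
proof -
  let ?I = "\<lambda>w s'. \<exists>L. list_rep d n m m1 L s' \<and> (\<forall>v < n. set (L v) = (if v < w \<and> v \<in> A then states 0 v else {}))"
  show ?thesis
  proof (rule runs_within_For[where N = n and I = ?I and K = 52])
    fix h s1 assume h: "h < n" and ag: "agree (For ''h'' ''n'' (init_step d)) s s1"
      and rh: "reg s1 ''h'' = h" and I: "?I h s1"
    have e1: "env s1" by (rule env_agree[OF e ag]) auto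
    obtain L where L: "list_rep d n m m1 L s1" "\<And>v. v < n \<Longrightarrow> set (L v) = (if v < h \<and> v \<in> A then states 0 v else {})"
      using I by blast
    have W1: "1 < W" using W by simp
    have ev: "arr s1 (d # ''ns'') h = of_bool (h \<in> snd ` set es)" "arr s1 (d # ''side'') h = of_bool (h \<in> A)"
       "arr s1 ''label'' h = l h" "arr s1 (d # ''delta'') (l h) = kmp_step S 0 (l h)" "reg s1 ''m1'' = m1"
      using e1 h l[OF h] unfolding env_def by (auto dest: spec[of _ 0])
    have src: "h \<in> srcs (set es) {..<n} \<longleftrightarrow> h \<notin> snd ` set es" using h by (simp add: srcs_def)
    let ?s = "run W (init_step d) s1"
    have "\<exists>L'. list_rep d n m m1 L' ?s \<and> (\<forall>v < n. set (L' v) = (if v < Suc h \<and> v \<in> A then states 0 v else {}))"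
    proof (cases "h \<notin> snd ` set es \<and> h \<in> A")
      case True
      let ?x = "kmp_step S 0 (l h)"
      let ?s1 = "s1\<lparr>reg := (reg s1)(''x'' := ?x)\<rparr>"
      have s: "?s = run W (push d) ?s1" using True ev rh W1 by (simp add: init_step_def)
      have "list_rep d n m m1 (L(h := if ?x \<in> set (L h) then L h else L h @ [?x])) ?s" unfolding s
        by (rule list_rep_push) (use L(1) rh ev h W kmp_step_le[of S 0] S in \<open>auto elim: list_rep_cong\<close>)
      moreover have "set ((L(h := if ?x \<in> set (L h) then L h else L h @ [?x])) v) =
          (if v < Suc h \<and> v \<in> A then states 0 v else {})" if "v < n" for v
        using L(2)[OF that] L(2)[OF h] True h src by (cases "v = h") (simp_all add: states_0 less_Suc_eq)
      ultimately show ?thesis by blast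
    next
      case False
      then have "?s = s1" using ev rh W1 by (auto simp: init_step_def)
      moreover have "set (L v) = (if v < Suc h \<and> v \<in> A then states 0 v else {})" if "v < n" for v
        using L(2)[OF that] False src by (cases "v = h") (auto simp: states_0 less_Suc_eq)
      ultimately show ?thesis using L(1) by metis
    qed
    then have "?I (Suc h) (?s\<lparr>reg := (reg ?s)(''h'' := Suc h)\<rparr>)" by simp
    then show "runs_within W (init_step d) s1 52 (\<lambda>s''. ?I (Suc h) (s''\<lparr>reg := (reg s'')(''h'' := Suc h)\<rparr>))"
      by (intro runs_within_flat) (simp_all add: init_step_def)
  next
    show "?I 0 (s\<lparr>reg := (reg s)(''h'' := 0)\<rparr>)" using r by (intro exI[of _ "\<lambda>_. []"]) simp
  next
    fix s' assume "?I n s'"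
    then show "\<exists>L. lists_at 0 L s'" unfolding lists_at_def by meson
  qed (use e[unfolded env_def] W(3) in simp_all)
qed

text \<open>If the head is in \<open>A\<close>, so is the tail; its list then holds all its states
  for the first \<open>j\<close> edges and has at most \<open>k\<close> entries. If the head is
  outside, there is nothing to record.\<close>

lemma runs_within_pass_edge:
  assumes e: "env s" and j: "j < length es" "reg s ''j'' = j" and L: "lists_at j L s"
  shows "runs_within W (pass_edge d) s (k * 80 + 30) (\<lambda>s'. \<exists>L. lists_at (Suc j) L s')"
  unfolding pass_edge_def
proof -
  obtain t h where th: "es ! j = (t, h)" by fastforce
  have "(t, h) \<in> set es" using th j by (metis nth_mem)
  then have thn: "t < n" "h < n" using g(1) by auto
  \<comment> \<open>Tail and head differ, so the list being traversed is not the one being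
    extended.\<close>
  have tneh: "t \<noteq> h" using g(2) th j unfolding topo_iff_nth by fastforce
  have tA: "t \<in> A" if "h \<in> A" using A[OF \<open>(t, h) \<in> set es\<close> that] .
  let ?c1 = "Assign ''t'' (Cell (d # ''tail'') (Var ''j'')) ;;
     Assign ''h'' (Cell (d # ''head'') (Var ''j'')) ;; Assign ''k'' (Cell (d # ''size'') (Var ''t''))"
  have Lr: "list_rep d n m m1 L s" and LF: "\<And>v. v < n \<Longrightarrow> set (L v) = (if v \<in> A then states j v else {})"
    using L by (auto simp: lists_at_def)
  have sz: "arr s (d # ''size'') t = length (L t)" using Lr thn by (auto simp: list_rep_def)
  have dL: "distinct (L t)" using Lr thn by (auto simp: list_rep_def)
  have "length (L t) \<le> m1"
    using Lr thn card_mono[of "{..m}" "set (L t)"] distinct_card[OF dL] W by (auto simp: list_rep_def)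
  then have lW: "length (L t) < W" using W by simp
  have lk: "length (L t) \<le> k" if "h \<in> A"
    using states_le[OF thn(1) tA[OF that], of j] LF[OF thn(1)] tA[OF that] distinct_card[OF dL] by simp
  show "runs_within W (?c1 ;; Cond (Less (Const 0) (Cell (d # ''side'') (Var ''h'')))
       (For ''i'' ''k'' (extend_step d)) Skip) s (k * 80 + 30) (\<lambda>s'. \<exists>L. lists_at (Suc j) L s')"
  proof (rule runs_within_Seq[where ?T1.0 = 9 and ?T2.0 = "k * 80 + 20" and
        R = "\<lambda>s'. reg s' ''t'' = t \<and> reg s' ''h'' = h \<and> reg s' ''k'' = length (L t)"])
    show "runs_within W ?c1 s 9 (\<lambda>s'. reg s' ''t'' = t \<and> reg s' ''h'' = h \<and> reg s' ''k'' = length (L t))"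
      using e j th sz by (intro runs_within_flat) (auto simp: env_def)
  next
    fix s1 assume ag1: "agree ?c1 s s1" and s1: "reg s1 ''t'' = t \<and> reg s1 ''h'' = h \<and> reg s1 ''k'' = length (L t)"
    have e1: "env s1" by (rule env_agree[OF e ag1]) auto
    have r1: "list_rep d n m m1 L s1" using Lr by (rule list_rep_cong) (auto simp: agree_arr[OF ag1])
    have W1: "1 < W" using W by simp
    have sd: "arr s1 (d # ''side'') h = of_bool (h \<in> A)" using e1 thn by (auto simp: env_def)
    show "runs_within W (Cond (Less (Const 0) (Cell (d # ''side'') (Var ''h'')))
       (For ''i'' ''k'' (extend_step d)) Skip) s1 (k * 80 + 20) (\<lambda>s'. \<exists>L. lists_at (Suc j) L s')"
    proof (rule runs_within_Cond[where T = "k * 80 + 6"])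
      assume "\<not> bval W (Less (Const 0) (Cell (d # ''side'') (Var ''h''))) s1"
      then have "h \<notin> A" using sd s1 by auto
      then have "lists_at (Suc j) L s1" using r1 LF by (auto simp: lists_at_def states_Suc[OF j(1) th])
      then show "runs_within W Skip s1 (k * 80 + 6) (\<lambda>s'. \<exists>L. lists_at (Suc j) L s')"
        by (intro runs_within_flat) auto
    next
      assume "bval W (Less (Const 0) (Cell (d # ''side'') (Var ''h''))) s1"
      then have hA: "h \<in> A" using sd s1 by (auto split: if_splits)
      let ?f = "\<lambda>a. kmp_step S a (l h)"
      let ?I = "\<lambda>i s'. \<exists>L'. list_rep d n m m1 L' s' \<and> (\<forall>v. v \<noteq> h \<longrightarrow> L' v = L v) \<and>
        set (L' h) = states j h \<union> ?f ` set (take i (L t))"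
      show "runs_within W (For ''i'' ''k'' (extend_step d)) s1 (k * 80 + 6) (\<lambda>s'. \<exists>L. lists_at (Suc j) L s')"
      proof (rule runs_within_For[where N = "length (L t)" and I = ?I and K = 60])
        fix i s2 assume i: "i < length (L t)" and ag2: "agree (For ''i'' ''k'' (extend_step d)) s1 s2"
          and ri: "reg s2 ''i'' = i" and I: "?I i s2"
        have e2: "env s2" by (rule env_agree[OF e1 ag2]) auto
        have rg: "reg s2 ''t'' = t" "reg s2 ''h'' = h" using s1 by (simp_all add: agree_reg[OF ag2])
        obtain L' where L': "list_rep d n m m1 L' s2" "\<And>v. v \<noteq> h \<Longrightarrow> L' v = L v"
          "set (L' h) = states j h \<union> ?f ` set (take i (L t))" using I by blast
        let ?a = "L t ! i" let ?x = "kmp_step S ?a (l h)"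
        have "set (L t) \<subseteq> {..m}" using Lr thn(1) unfolding list_rep_def by blast
        then have am: "?a \<le> m" using nth_mem[OF i] by auto
        have "i < m1" using i \<open>length (L t) \<le> m1\<close> by simp
        then have ix1: "(t * m1 mod W + i) mod W = t * m1 + i"
          using index_less[of t n i m1 W] thn W by (simp add: mod_add_left_eq)
        have ix2: "(?a * \<sigma> mod W + l h) mod W = ?a * \<sigma> + l h"
          using index_less[of ?a m1 "l h" \<sigma> W] l[OF thn(2)] am W by (simp add: mod_add_left_eq)
        have "L' t = L t" using L'(2) tneh by blast
        then have li: "arr s2 (d # ''list'') (t * m1 + i) = ?a"
          using L'(1) thn(1) i unfolding list_rep_def by metis
        have ev: "reg s2 ''m1'' = m1" "reg s2 ''sigma'' = \<sigma>" "arr s2 ''label'' h = l h"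
          "arr s2 (d # ''delta'') (?a * \<sigma> + l h) = ?x"
          using e2 thn l[OF thn(2)] am unfolding env_def by auto
        let ?s2 = "s2\<lparr>reg := (reg s2)(''x'' := ?x)\<rparr>"
        let ?s = "run W (extend_step d) s2"
        have s: "?s = run W (push d) ?s2" using rg ri ev li ix1 ix2 by (simp add: extend_step_def)
        have "list_rep d n m m1 (L'(h := if ?x \<in> set (L' h) then L' h else L' h @ [?x])) ?s" unfolding s
          by (rule list_rep_push) (use L'(1) rg ev thn W kmp_step_le[of S ?a] S in \<open>auto elim: list_rep_cong\<close>)
        then have "list_rep d n m m1 (L'(h := if ?x \<in> set (L' h) then L' h else L' h @ [?x]))
            (?s\<lparr>reg := (reg ?s)(''i'' := Suc i)\<rparr>)" by (rule list_rep_cong) simp_all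
        then have "?I (Suc i) (?s\<lparr>reg := (reg ?s)(''i'' := Suc i)\<rparr>)"
          by (rule exI[of _ "L'(h := if ?x \<in> set (L' h) then L' h else L' h @ [?x])", OF conjI])
            (use L' i in \<open>auto simp: take_Suc_conv_app_nth\<close>)
        then show "runs_within W (extend_step d) s2 60 (\<lambda>s''. ?I (Suc i) (s''\<lparr>reg := (reg s'')(''i'' := Suc i)\<rparr>))"
          by (intro runs_within_flat) (simp_all add: extend_step_def)
      next
        have "list_rep d n m m1 L (s1\<lparr>reg := (reg s1)(''i'' := 0)\<rparr>)" using r1 by (rule list_rep_cong) simp_all
        then show "?I 0 (s1\<lparr>reg := (reg s1)(''i'' := 0)\<rparr>)" using LF[OF thn(2)] hA by auto
      next
        fix s' assume "?I (length (L t)) s'"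
        then obtain L' where L': "list_rep d n m m1 L' s'" "\<And>v. v \<noteq> h \<Longrightarrow> L' v = L v"
          "set (L' h) = states j h \<union> ?f ` set (L t)" by auto
        have "set (L' v) = (if v \<in> A then states (Suc j) v else {})" if "v < n" for v
          using L' LF[OF that] LF[OF thn(1)] tA hA by (cases "v = h") (auto simp: states_Suc[OF j(1) th])
        then show "\<exists>L. lists_at (Suc j) L s'" using L'(1) unfolding lists_at_def by blast
      next
        show "length (L t) * (60 + 8) + 6 \<le> k * 80 + 6" using mult_le_mono[OF lk[OF hA], of 68 80] by simp
      qed (use s1 lW in auto)
    qed simp
  qed simp
qed

lemma runs_within_pass:
  assumes e: "env s" and r: "list_rep d n m m1 (\<lambda>_. []) s"
  shows "runs_within W (pass d) s (n * 60 + length es * (k * 80 + 38) + 12) (\<lambda>s'. \<exists>L. lists_at (length es) L s')"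
  unfolding pass_def
proof (rule runs_within_Seq[OF runs_within_init[OF e r], where ?T2.0 = "length es * (k * 80 + 38) + 6"])
  fix s1 assume ag1: "agree (For ''h'' ''n'' (init_step d)) s s1" and s1: "\<exists>L. lists_at 0 L s1"
  have e1: "env s1" by (rule env_agree[OF e ag1]) auto
  have upd: "\<exists>L. lists_at j L (s'\<lparr>reg := f\<rparr>)" if "\<exists>L. lists_at j L s'" for j s' f
    using that unfolding lists_at_def by simp
  show "runs_within W (For ''j'' ''e'' (pass_edge d)) s1 (length es * (k * 80 + 38) + 6) (\<lambda>s'. \<exists>L. lists_at (length es) L s')"
  proof (rule runs_within_For[where N = "length es" and I = "\<lambda>j s'. \<exists>L. lists_at j L s'" and K = "k * 80 + 30"])
    fix j s2 assume j: "j < length es" and ag2: "agree (For ''j'' ''e'' (pass_edge d)) s1 s2"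
      and rj: "reg s2 ''j'' = j" and I: "\<exists>L. lists_at j L s2"
    have e2: "env s2" by (rule env_agree[OF e1 ag2]) auto
    from I obtain L where L: "lists_at j L s2" by blast
    show "runs_within W (pass_edge d) s2 (k * 80 + 30) (\<lambda>s''. \<exists>L. lists_at (Suc j) L (s''\<lparr>reg := (reg s'')(''j'' := Suc j)\<rparr>))"
      by (rule runs_within_mono[OF runs_within_pass_edge[OF e2 j rj L]]) (simp_all add: upd)
  qed (use e1[unfolded env_def] W(4) s1 upd in simp_all)
qed simp

end

section \<open>Combining both directions\<close>

definition hit_step :: com where
  "hit_step = Cond (Less (Const 0) (Cell ''cross'' (At (Cell ''flist'' (At (Var ''t'') ''m1'' (Var ''i''))) ''m1''
       (Cell ''blist'' (At (Var ''h'') ''m1'' (Var ''k''))))))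
     (Assign ''result'' (Const 1)) Skip"

definition scan_edge :: com where
  "scan_edge = (Assign ''t'' (Cell ''ftail'' (Var ''j'')) ;; Assign ''h'' (Cell ''fhead'' (Var ''j'')) ;;
     Assign ''x'' (Cell ''fsize'' (Var ''t'')) ;; Assign ''y'' (Cell ''bsize'' (Var ''h''))) ;;
     Cond (Conj (Less (Const 0) (Cell ''fside'' (Var ''t''))) (Less (Const 0) (Cell ''bside'' (Var ''h''))))
       (For ''i'' ''x'' (For ''k'' ''y'' hit_step)) Skip"

definition scan :: com where
  "scan = For ''j'' ''e'' scan_edge"

definition full_step :: com where
  "full_step = Cond (Conj (Less (Cell ''fseen'' (At (Var ''v'') ''m1'' (Var ''m''))) (Const 1))
       (Less (Cell ''bseen'' (At (Var ''v'') ''m1'' (Var ''m''))) (Const 1)))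
     Skip (Assign ''result'' (Const 1))"

definition full :: com where
  "full = For ''v'' ''n'' full_step"

lemma writes_scan [simp]:
  "writes_reg hit_step = {''result''}" "writes_arr hit_step = {}"
  "writes_reg scan_edge = {''t'', ''h'', ''x'', ''y'', ''i'', ''k'', ''result''}" "writes_arr scan_edge = {}"
  "writes_reg scan = {''j'', ''t'', ''h'', ''x'', ''y'', ''i'', ''k'', ''result''}" "writes_arr scan = {}"
  "writes_reg full_step = {''result''}" "writes_arr full_step = {}"
  "writes_reg full = {''v'', ''result''}" "writes_arr full = {}"
  by (auto simp: hit_step_def scan_edge_def scan_def full_step_def full_def)

lemma list_rep_length_le:
  assumes "list_rep d n m m1 L s" "v < n" "m1 = Suc m"
  shows "length (L v) \<le> m1"
proof -
  have "distinct (L v)" "set (L v) \<subseteq> {..m}" using assms by (auto simp: list_rep_def)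
  then show ?thesis using card_mono[of "{..m}" "set (L v)"] distinct_card[of "L v"] assms(3) by simp
qed

lemma runs_within_hit:
  assumes rg: "reg s ''t'' = t" "reg s ''h'' = h" "reg s ''m1'' = m1" "reg s ''i'' = i" "reg s ''k'' = q"
      "reg s ''result'' = of_bool P"
    and L: "list_rep CHR ''f'' n m m1 L s" and M: "list_rep CHR ''b'' n m m1 M s"
    and X: "\<And>a b. a \<le> m \<Longrightarrow> b \<le> m \<Longrightarrow> arr s ''cross'' (a * m1 + b) = of_bool (X a b)"
    and W: "m1 = Suc m" "m1 < W" "n * m1 \<le> W" "m1 * m1 \<le> W"
    and b: "t < n" "h < n" "i < length (L t)" "q < length (M h)"
  shows "runs_within W hit_step s 25 (\<lambda>s'. reg s' ''result'' = of_bool (P \<or> X (L t ! i) (M h ! q)))"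
proof -
  have a: "arr s ''flist'' (t * m1 + i) = L t ! i" "arr s ''blist'' (h * m1 + q) = M h ! q"
    using L M b by (auto simp: list_rep_def)
  have "set (L t) \<subseteq> {..m}" "set (M h) \<subseteq> {..m}" using L M b by (auto simp: list_rep_def)
  then have le: "L t ! i \<le> m" "M h ! q \<le> m" using nth_mem b(3,4) by blast+
  have "i < m1" "q < m1" using list_rep_length_le[OF L b(1) W(1)] list_rep_length_le[OF M b(2) W(1)] b by auto
  then have ix: "(t * m1 mod W + i) mod W = t * m1 + i" "(h * m1 mod W + q) mod W = h * m1 + q"
    using index_less[of t n i m1 W] index_less[of h n q m1 W] b W by (simp_all add: mod_add_left_eq)
  have ix2: "(L t ! i * m1 mod W + M h ! q) mod W = L t ! i * m1 + M h ! q"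
    using index_less[of "L t ! i" m1 "M h ! q" m1 W] le W by (simp add: mod_add_left_eq)
  have "1 < W" using W by simp
  then show ?thesis using rg a ix ix2 X[OF le]
    by (intro runs_within_flat) (simp_all add: hit_step_def)
qed

text \<open>The double loop is entered only on edges from \<open>A\<close> to its complement, where
  both lists have at most \<open>k\<close> entries. The quadratic dependence on \<open>k\<close>
  arises here alone.\<close>

lemma runs_within_scan:
  assumes regs: "reg s ''e'' = length es" "reg s ''m1'' = m1" "reg s ''result'' = 0"
    and es: "\<And>i. i < length es \<Longrightarrow> arr s ''ftail'' i = fst (es ! i)"
      "\<And>i. i < length es \<Longrightarrow> arr s ''fhead'' i = snd (es ! i)"
    and sd: "\<And>v. v < n \<Longrightarrow> arr s ''fside'' v = of_bool (v \<in> A)"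
      "\<And>v. v < n \<Longrightarrow> arr s ''bside'' v = of_bool (v \<notin> A)"
    and g: "set es \<subseteq> {..<n} \<times> {..<n}"
    and L: "list_rep CHR ''f'' n m m1 L s" and M: "list_rep CHR ''b'' n m m1 M s"
    and X: "\<And>a b. a \<le> m \<Longrightarrow> b \<le> m \<Longrightarrow> arr s ''cross'' (a * m1 + b) = of_bool (X a b)"
    and W: "m1 = Suc m" "m1 < W" "n * m1 \<le> W" "m1 * m1 \<le> W" "length es < W"
    and k: "\<And>v. v < n \<Longrightarrow> v \<in> A \<Longrightarrow> length (L v) \<le> k" "\<And>v. v < n \<Longrightarrow> v \<notin> A \<Longrightarrow> length (M v) \<le> k"
  shows "runs_within W scan s (length es * (k * (k * 33 + 14) + 40) + 6)
    (\<lambda>s'. reg s' ''result'' = of_bool (\<exists>(u, v) \<in> set es. u \<in> A \<and> v \<notin> A \<and>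
       (\<exists>a \<in> set (L u). \<exists>b \<in> set (M v). X a b)))"
proof -
  let ?Q = "\<lambda>(u, v). u \<in> A \<and> v \<notin> A \<and> (\<exists>a \<in> set (L u). \<exists>b \<in> set (M v). X a b)"
  let ?I = "\<lambda>j s'. reg s' ''result'' = of_bool (\<exists>e \<in> set (take j es). ?Q e)"
  have list_rep_arr: "list_rep d n m m1 L s'" if "list_rep d n m m1 L s" "arr s' = arr s" for d L s'
    using that by (simp add: list_rep_def)
  show ?thesis unfolding scan_def
  proof (rule runs_within_For[where N = "length es" and I = ?I and K = "k * (k * 33 + 14) + 32"])
    fix j s1 assume j: "j < length es" and ag: "agree (For ''j'' ''e'' scan_edge) s s1"
      and rj: "reg s1 ''j'' = j" and I: "?I j s1"
    have a1: "arr s1 = arr s" using agree_arr[OF ag] by auto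
    note fr = agree_reg[OF ag]
    obtain t h where th: "es ! j = (t, h)" by fastforce
    have "(t, h) \<in> set es" using th j by (metis nth_mem)
    then have thn: "t < n" "h < n" using g(1) by auto
    define P where "P = (\<exists>e \<in> set (take j es). ?Q e)"
    have T: "(\<exists>e \<in> set (take (Suc j) es). ?Q e) \<longleftrightarrow> P \<or> ?Q (t, h)"
      using j th by (auto simp: take_Suc_conv_app_nth P_def)
    let ?c1 = "Assign ''t'' (Cell ''ftail'' (Var ''j'')) ;; Assign ''h'' (Cell ''fhead'' (Var ''j'')) ;;
     Assign ''x'' (Cell ''fsize'' (Var ''t'')) ;; Assign ''y'' (Cell ''bsize'' (Var ''h''))"
    let ?R = "\<lambda>s'. reg s' ''t'' = t \<and> reg s' ''h'' = h \<and> reg s' ''x'' = length (L t) \<and>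
       reg s' ''y'' = length (M h) \<and> reg s' ''result'' = of_bool P"
    have sz: "arr s ''fsize'' t = length (L t)" "arr s ''bsize'' h = length (M h)"
      using L M thn by (auto simp: list_rep_def)
    have "length (L t) \<le> m1" "length (M h) \<le> m1" using list_rep_length_le[OF L thn(1) W(1)]
      list_rep_length_le[OF M thn(2) W(1)] by auto
    then have lW: "length (L t) < W" "length (M h) < W" using W by auto
    show "runs_within W scan_edge s1 (k * (k * 33 + 14) + 32) (\<lambda>s''. ?I (Suc j) (s''\<lparr>reg := (reg s'')(''j'' := Suc j)\<rparr>))"
      unfolding scan_edge_def T
    proof (rule runs_within_Seq[where ?T1.0 = 12 and ?T2.0 = "k * (k * 33 + 14) + 20" and R = ?R])
      show "runs_within W ?c1 s1 12 ?R"
        using rj I es j th sz by (intro runs_within_flat) (simp_all add: a1 P_def)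
    next
      fix s2 assume ag2: "agree ?c1 s1 s2" and s2: "?R s2"
      have a2: "arr s2 = arr s" using agree_arr[OF ag2] a1 by auto
      have m2: "reg s2 ''m1'' = m1" using agree_reg[OF ag2] fr regs by simp
      have bv: "bval W (Conj (Less (Const 0) (Cell ''fside'' (Var ''t''))) (Less (Const 0) (Cell ''bside'' (Var ''h'')))) s2
        \<longleftrightarrow> t \<in> A \<and> h \<notin> A" using s2 sd thn W by (simp add: a2)
      show "runs_within W (Cond (Conj (Less (Const 0) (Cell ''fside'' (Var ''t''))) (Less (Const 0) (Cell ''bside'' (Var ''h''))))
       (For ''i'' ''x'' (For ''k'' ''y'' hit_step)) Skip) s2 (k * (k * 33 + 14) + 20)
         (\<lambda>s''. reg (s''\<lparr>reg := (reg s'')(''j'' := Suc j)\<rparr>) ''result'' = of_bool (P \<or> ?Q (t, h)))"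
      proof (rule runs_within_Cond[where T = "k * (k * 33 + 14) + 6"], unfold bv)
        assume "\<not> (t \<in> A \<and> h \<notin> A)"
        then show "runs_within W Skip s2 (k * (k * 33 + 14) + 6)
          (\<lambda>s''. reg (s''\<lparr>reg := (reg s'')(''j'' := Suc j)\<rparr>) ''result'' = of_bool (P \<or> ?Q (t, h)))"
          using s2 by (intro runs_within_flat) auto
      next
        assume th_A: "t \<in> A \<and> h \<notin> A"
        have lk: "length (L t) \<le> k" "length (M h) \<le> k" using k thn th_A by auto
        let ?J = "\<lambda>i s'. reg s' ''result'' = of_bool (P \<or> (\<exists>i' < i. \<exists>b \<in> set (M h). X (L t ! i') b))"
        show "runs_within W (For ''i'' ''x'' (For ''k'' ''y'' hit_step)) s2 (k * (k * 33 + 14) + 6)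
          (\<lambda>s''. reg (s''\<lparr>reg := (reg s'')(''j'' := Suc j)\<rparr>) ''result'' = of_bool (P \<or> ?Q (t, h)))"
        proof (rule runs_within_For[where N = "length (L t)" and I = ?J and K = "k * 33 + 6"])
          fix i s3 assume i: "i < length (L t)" and ag3: "agree (For ''i'' ''x'' (For ''k'' ''y'' hit_step)) s2 s3"
            and ri: "reg s3 ''i'' = i" and J: "?J i s3"
          have a3: "arr s3 = arr s" using agree_arr[OF ag3] a2 by auto
          note fr3 = agree_reg[OF ag3]
          define P2 where "P2 \<longleftrightarrow> P \<or> (\<exists>i' < i. \<exists>b \<in> set (M h). X (L t ! i') b)"
          let ?K = "\<lambda>q s'. reg s' ''result'' = of_bool (P2 \<or> (\<exists>q' < q. X (L t ! i) (M h ! q')))"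
          show "runs_within W (For ''k'' ''y'' hit_step) s3 (k * 33 + 6) (\<lambda>s''. ?J (Suc i) (s''\<lparr>reg := (reg s'')(''i'' := Suc i)\<rparr>))"
          proof (rule runs_within_For[where N = "length (M h)" and I = ?K and K = 25])
            fix q s4 assume q: "q < length (M h)" and ag4: "agree (For ''k'' ''y'' hit_step) s3 s4"
              and rq: "reg s4 ''k'' = q" and K: "?K q s4"
            have a4: "arr s4 = arr s" using agree_arr[OF ag4] a3 by auto
            note fr4 = agree_reg[OF ag4]
            have "runs_within W hit_step s4 25 (\<lambda>s'. reg s' ''result'' =
                of_bool ((P2 \<or> (\<exists>q' < q. X (L t ! i) (M h ! q'))) \<or> X (L t ! i) (M h ! q)))"
              by (rule runs_within_hit[OF _ _ _ _ _ _ list_rep_arr[OF L a4] list_rep_arr[OF M a4] _ W(1-4) thn i q])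
                (use s2 m2 ri rq K X in \<open>simp_all add: fr3 fr4 a4\<close>)
            then show "runs_within W hit_step s4 25 (\<lambda>s''. ?K (Suc q) (s''\<lparr>reg := (reg s'')(''k'' := Suc q)\<rparr>))"
              by (rule runs_within_mono) (auto simp: less_Suc_eq)
          next
            fix s' assume "?K (length (M h)) s'"
            moreover have "(\<exists>q' < length (M h). X (L t ! i) (M h ! q')) \<longleftrightarrow> (\<exists>b \<in> set (M h). X (L t ! i) b)"
              by (metis in_set_conv_nth)
            ultimately show "?J (Suc i) (s'\<lparr>reg := (reg s')(''i'' := Suc i)\<rparr>)"
              by (auto simp: P2_def less_Suc_eq)
          next
            show "length (M h) * (25 + 8) + 6 \<le> k * 33 + 6" using lk by simp
          qed (use s2 lW J in \<open>simp_all add: fr3 P2_def\<close>)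
        next
          fix s' assume "?J (length (L t)) s'"
          moreover have "(\<exists>i' < length (L t). \<exists>b \<in> set (M h). X (L t ! i') b) \<longleftrightarrow>
              (\<exists>a \<in> set (L t). \<exists>b \<in> set (M h). X a b)" by (metis in_set_conv_nth)
          ultimately show "reg (s'\<lparr>reg := (reg s')(''j'' := Suc j)\<rparr>) ''result'' = of_bool (P \<or> ?Q (t, h))"
            using th_A by simp
        next
          show "length (L t) * (k * 33 + 6 + 8) + 6 \<le> k * (k * 33 + 14) + 6"
            using mult_le_mono1[OF lk(1), of "k * 33 + 14"] by (simp add: add.commute)
        qed (use s2 lW in simp_all)
      qed simp
    qed simp
  qed (use regs W in auto)
qed

text \<open>A match that lies in one part appears as the state \<open>m\<close> in a list of that
  part; the bit tables reveal it without a search through the lists.\<close>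

lemma runs_within_full:
  assumes regs: "reg s ''n'' = n" "reg s ''m1'' = m1" "reg s ''m'' = m" "reg s ''result'' = of_bool P"
    and L: "list_rep CHR ''f'' n m m1 L s" and M: "list_rep CHR ''b'' n m m1 M s"
    and W: "m1 = Suc m" "m1 < W" "n * m1 \<le> W" "n < W"
  shows "runs_within W full s (n * 30 + 6)
    (\<lambda>s'. reg s' ''result'' = of_bool (P \<or> (\<exists>v < n. m \<in> set (L v) \<or> m \<in> set (M v))))"
proof -
  let ?I = "\<lambda>w s'. reg s' ''result'' = of_bool (P \<or> (\<exists>v < w. m \<in> set (L v) \<or> m \<in> set (M v)))"
  show ?thesis unfolding full_def
  proof (rule runs_within_For[where N = n and I = ?I and K = 22])
    fix v s1 assume v: "v < n" and ag: "agree (For ''v'' ''n'' full_step) s s1"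
      and rv: "reg s1 ''v'' = v" and I: "?I v s1"
    note fr = agree_reg[OF ag] agree_arr[OF ag]
    have ix: "(v * m1 mod W + m) mod W = v * m1 + m"
      using index_less[of v n m m1 W] v W by (simp add: mod_add_left_eq)
    have a: "arr s ''fseen'' (v * m1 + m) = of_bool (m \<in> set (L v))"
      "arr s ''bseen'' (v * m1 + m) = of_bool (m \<in> set (M v))" using L M v by (auto simp: list_rep_def)
    have "1 < W" using W by simp
    then show "runs_within W full_step s1 22 (\<lambda>s''. ?I (Suc v) (s''\<lparr>reg := (reg s'')(''v'' := Suc v)\<rparr>))"
      using I rv regs a ix by (intro runs_within_flat) (auto simp: full_step_def fr less_Suc_eq)
  qed (use regs W in auto)
qed

definition matcher :: com where
  "matcher = prep ;; automaton CHR ''f'' ;; automaton CHR ''b'' ;; cross_table ;; toposort ;;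
     count_paths CHR ''f'' ;; count_paths CHR ''b'' ;; sides ;; pass CHR ''f'' ;; pass CHR ''b'' ;; scan ;; full"

text \<open>For the empty string the state 0 is already the full length, so a match would be
  reported in every nonempty graph, whereas a path has at least one vertex.\<close>

definition guarded_matcher :: com where
  "guarded_matcher = Cond (Less (Const 0) (Var ''m'')) matcher Skip"

lemma set_rev_swap: "set (rev (map prod.swap es)) = (set es)\<inverse>"
  by auto

lemma runs_within_obtain:
  assumes "runs_within W p s T Q"
  obtains t s' where "exec W p s t s'" "t \<le> T" "agree p s s'" "Q s'"
  using assms exec_agree unfolding runs_within_def by blast

definition run_time :: "nat \<Rightarrow> nat \<Rightarrow> nat \<Rightarrow> nat \<Rightarrow> nat" where
  "run_time n e m k = (m * 20 + 10) + 2 * (Suc m * (m * 60 + 60) + 6) + (Suc m * (Suc m * 70 + 14) + 6) +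
     (e * 140 + n * 140 + 30) + 2 * (e * 50 + n * 14 + 18) + (n * 20 + 6) +
     2 * (n * 60 + e * (k * 80 + 38) + 12) + (e * (k * (k * 33 + 14) + 40) + 6) + (n * 30 + 6)"

text \<open>Terms linear in the graph or in \<open>k\<close> are absorbed by (n + e) k^2, which
  takes \<open>0 < k\<close>; terms linear in \<open>m\<close> and constants by m^2, which takes
  \<open>0 < m\<close>. For the empty graph \<open>st_width\<close> is the maximum of an empty set
  and unspecified, but then all terms with \<open>k\<close> carry the factor 0.\<close>

lemma run_time_le:
  assumes "0 < m" "n + e = 0 \<or> 0 < k"
  shows "run_time n e m k \<le> 2000 * ((n + e) * k\<^sup>2 + m\<^sup>2 + 1)"
proof -
  have m: "m \<le> m * m" "1 \<le> m * m" using assms(1) by (cases m; simp)+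
  have 1: "n * x + e * y \<le> (n + e) * k\<^sup>2 * z" if "x \<le> z" "y \<le> z * k\<^sup>2" for x y z
  proof (cases "n + e = 0")
    case False
    then have "0 < k" using assms(2) by blast
    then have "1 \<le> k\<^sup>2" by (simp add: Suc_le_eq)
    then have "x \<le> z * k\<^sup>2" using that(1) by (metis le_trans mult.right_neutral mult_le_mono2)
    then have "n * x + e * y \<le> n * (z * k\<^sup>2) + e * (z * k\<^sup>2)" using that(2) by (intro add_mono mult_le_mono2)
    then show ?thesis by (simp add: algebra_simps)
  qed simp
  \<comment> \<open>Since 1 and \<open>k\<close> are at most k^2, the coefficient of
    \<open>e\<close> is at most (356 + 174 + 33) k^2, and 600 exceeds this factor as well as
    338.\<close>
  have "n * 338 + e * (356 + k * 174 + k * k * 33) \<le> (n + e) * k\<^sup>2 * 600"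
  proof (cases "n + e = 0")
    case False
    then have k: "k \<le> k * k" "1 \<le> k * k" using assms(2) by (cases k; simp)+
    have "356 + k * 174 + k * k * 33 \<le> 600 * k\<^sup>2" using k unfolding power2_eq_square by linarith
    then show ?thesis by (intro 1) auto
  qed simp
  moreover have "run_time n e m k = (n * 338 + e * (356 + k * 174 + k * k * 33)) + (190 * (m * m) + 414 * m + 340)"
    by (simp add: run_time_def algebra_simps)
  moreover have "190 * (m * m) + 414 * m + 340 \<le> 2000 * m\<^sup>2"
    using m unfolding power2_eq_square by linarith
  moreover have "r \<le> 2000 * (x + y + 1)" if "a \<le> x * 600" "r = a + b" "b \<le> 2000 * y" for r a b x y :: nat
  proof -
    have "x * 600 \<le> 2000 * x" by simp
    then have "a \<le> 2000 * x" using that(1) by (rule le_trans[rotated])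
    then show ?thesis using that(2,3) by simp
  qed
  ultimately show ?thesis by blast
qed

locale matching_input =
  fixes W n \<sigma> :: nat and G :: "nat pair_pre_digraph" and l :: "nat \<Rightarrow> nat" and S :: "nat list"
    and es :: "(nat \<times> nat) list"
  assumes G: "pair_fin_digraph G" "acyclic (parcs G)" "pverts G = {..<n}"
    and l: "\<forall>v \<in> pverts G. l v \<in> {..<\<sigma>}" and S: "set S \<subseteq> {..<\<sigma>}"
    and es: "distinct es" "set es = parcs G"
    and W: "(card (pverts G) + card (parcs G) + length S + \<sigma> + 2)\<^sup>2 \<le> W"
begin

sublocale dag "set es" "{..<n}"
  using dag_pair_digraph[OF G(1,2)] es G by simp

text \<open>The largest arrays are indexed by pairs and have n (m + 1), (m + 1) \<sigma> and (m +
  1)^2 cells, which is why a word must hold the square of the input size. The summand 2 gives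
  \<open>2 * ?N \<le> ?N * ?N\<close>, whence the strict bounds.\<close>

lemma word_bounds:
  "Suc (length es) < W" "Suc n < W" "2 * Suc (length S) < W" "n * Suc (length S) \<le> W"
  "Suc (length S) * \<sigma> \<le> W" "Suc (length S) * Suc (length S) \<le> W"
proof -
  have e: "card (parcs G) = length es" using es distinct_card by metis
  let ?N = "n + length es + length S + \<sigma> + 2"
  have W': "?N * ?N \<le> W" using W G(3) e by (simp add: power2_eq_square)
  have 2: "2 * ?N \<le> ?N * ?N" by (rule mult_le_mono1) simp
  have "2 * ?N \<le> W" using 2 W' by (rule le_trans)
  then show "Suc (length es) < W" "Suc n < W" "2 * Suc (length S) < W" by simp_all
  have *: "x * y \<le> W" if "x \<le> ?N" "y \<le> ?N" for x y using mult_le_mono[OF that] W' by linarith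
  show "n * Suc (length S) \<le> W" "Suc (length S) * \<sigma> \<le> W" "Suc (length S) * Suc (length S) \<le> W"
    by (rule *; simp)+
qed

lemma has_match_walk: "has_match G l S \<longleftrightarrow> (\<exists>P. walk (set es) {..<n} P \<and> map l P = S)"
  unfolding has_match_def vpath_walk[OF G(2)] es G(3) ..

lemma mu_eq:
  assumes "set os = set es"
  shows "mu_s G v = card (src_paths os (srcs (set os) {..<n}) (length os) v)"
    "mu_t G v = card (src_paths (rev (map prod.swap os)) (srcs (set (rev (map prod.swap os))) {..<n}) (length os) v)"
proof -
  have d: "dag (parcs G) (pverts G)" using dag_pair_digraph[OF G(1,2)] .
  have r: "set (rev (map prod.swap os)) = (parcs G)\<inverse>" unfolding set_rev_swap using assms es by simp
  show "mu_s G v = card (src_paths os (srcs (set os) {..<n}) (length os) v)"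
    using mu_s_eq[OF d] assms es G(3) by (simp add: src_paths_def)
  show "mu_t G v = card (src_paths (rev (map prod.swap os)) (srcs (set (rev (map prod.swap os))) {..<n}) (length os) v)"
    using mu_t_eq[OF d] r G(3) by (simp add: src_paths_def)
qed

lemma min_le_st_width: "v < n \<Longrightarrow> min (mu_s G v) (mu_t G v) \<le> st_width G"
  unfolding st_width_def using G(3) by (intro Max_ge) auto

text \<open>Vertex 0 is reached from a source and reaches a sink, so its two sets of paths are
  nonempty. The sorted list supplies their finiteness, without which a cardinality could be 0 by
  convention.\<close>

lemma st_width_pos:
  assumes "0 < n" "topo os" "set os = set es"
  shows "0 < st_width G"
proof -
  interpret r: dag "(set es)\<inverse>" "{..<n}" by (rule rev_dag)
  let ?ro = "rev (map prod.swap os)"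
  have ro: "set ?ro = (set es)\<inverse>" unfolding set_rev_swap assms(3) ..
  have "src_paths os (srcs (set os) {..<n}) (length os) 0 \<noteq> {}"
    using ex_src_path[of 0] assms by (simp add: src_paths_def)
  then have 1: "0 < mu_s G 0" unfolding mu_eq(1)[OF assms(3)]
    using finite_src_paths[OF assms(2)] by (simp add: card_gt_0_iff)
  have "src_paths ?ro (srcs (set ?ro) {..<n}) (length os) 0 \<noteq> {}"
    unfolding src_paths_def using r.ex_src_path[of 0] assms ro by simp
  then have 2: "0 < mu_t G 0" unfolding mu_eq(2)[OF assms(3)]
    using finite_src_paths[OF topo_rev[OF assms(2)]] by (simp add: card_gt_0_iff)
  show ?thesis using 1 2 min_le_st_width[OF assms(1)] by linarith
qed

text \<open>Positivity of the width is part of the postcondition because its proof takes the sorted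
  list that the run produces.\<close>

lemma runs_within_matcher:
  assumes m0: "S \<noteq> []"
  shows "runs_within W matcher (input_state n es \<sigma> l S)
    (run_time n (length es) (length S) (st_width G))
    (\<lambda>s. reg s ''result'' = of_bool (has_match G l S) \<and> (n + length es = 0 \<or> 0 < st_width G))"
proof -
  define m m1 k where "m = length S" and "m1 = Suc m" and "k = st_width G"
  let ?R = "rev S"
  have Wb: "Suc (length es) < W" "Suc n < W" "m1 < W" "2 * m1 < W" "2 * m < W" "n * m1 \<le> W"
    "m1 * \<sigma> \<le> W" "m1 * m1 \<le> W" "n < W" "length es < W" "0 < m1" "1 < W" "m1 = Suc m"
    using word_bounds by (auto simp: m_def m1_def)
  have lm: "length S = m" "length ?R = m" by (simp_all add: m_def)
  have lc: "list_cells xs i = xs ! i" if "i < length xs" for xs i using that by (simp add: list_cells_def)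
  have lv: "l v < \<sigma>" if "v < n" for v using l that G(3) by auto
  have esV: "set es \<subseteq> {..<n} \<times> {..<n}" using EV .
  define s0 where "s0 = input_state n es \<sigma> l S"
  have i0: "reg s0 ''n'' = n" "reg s0 ''e'' = length es" "reg s0 ''sigma'' = \<sigma>" "reg s0 ''m'' = m"
    by (simp_all add: s0_def input_state_def m_def)
  have z0: "reg s0 x = 0" if "x \<notin> {''n'', ''e'', ''sigma'', ''m''}" for x
    using that by (simp add: s0_def input_state_def)
  have za: "arr s0 a = (\<lambda>_. 0)" if "a \<notin> {''tail'', ''head'', ''label'', ''string''}" for a
    using that by (simp add: s0_def input_state_def)
  have ia: "\<And>i. i < length es \<Longrightarrow> arr s0 ''tail'' i = fst (es ! i)"
    "\<And>i. i < length es \<Longrightarrow> arr s0 ''head'' i = snd (es ! i)"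
    "\<And>v. v < n \<Longrightarrow> arr s0 ''label'' v = l v" "\<And>i. i < m \<Longrightarrow> arr s0 ''string'' i = S ! i"
    by (simp_all add: s0_def input_state_def lc m_def)

  obtain t1 s1 where x1: "exec W prep s0 t1 s1" "t1 \<le> m * 20 + 10" and g1: "agree prep s0 s1"
    and p1: "reg s1 ''m1'' = m1" "\<forall>i < m. arr s1 ''fstring'' i = S ! i" "\<forall>i < m. arr s1 ''bstring'' i = ?R ! i"
    using runs_within_prep[OF i0(4) lm(1) ia(4), of W] Wb by (auto elim!: runs_within_obtain)
  note f1 = agree_reg[OF g1] agree_arr[OF g1]

  obtain t2 s2 where x2: "exec W (automaton CHR ''f'') s1 t2 s2" "t2 \<le> m1 * (m * 60 + 60) + 6"
    and g2: "agree (automaton CHR ''f'') s1 s2"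
    and p2: "\<forall>a \<le> m. \<forall>c < \<sigma>. arr s2 ''fdelta'' (a * \<sigma> + c) = kmp_step S a c" "\<forall>a \<le> m. arr s2 ''ffail'' a = kmp_fail S a"
  proof (rule runs_within_obtain[OF runs_within_automaton[of s1 m m1 \<sigma> S "CHR ''f''" W]])
  qed (use p1 i0 za lm S Wb in \<open>simp_all add: f1\<close>)
  note f2 = agree_reg[OF g2] agree_arr[OF g2]

  obtain t3 s3 where x3: "exec W (automaton CHR ''b'') s2 t3 s3" "t3 \<le> m1 * (m * 60 + 60) + 6"
    and g3: "agree (automaton CHR ''b'') s2 s3"
    and p3: "\<forall>a \<le> m. \<forall>c < \<sigma>. arr s3 ''bdelta'' (a * \<sigma> + c) = kmp_step ?R a c" "\<forall>a \<le> m. arr s3 ''bfail'' a = kmp_fail ?R a"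
  proof (rule runs_within_obtain[OF runs_within_automaton[of s2 m m1 \<sigma> ?R "CHR ''b''" W]])
  qed (use p1 i0 za lm S Wb in \<open>simp_all add: f1 f2\<close>)
  note f3 = agree_reg[OF g3] agree_arr[OF g3]

  obtain t4 s4 where x4: "exec W cross_table s3 t4 s4" "t4 \<le> m1 * (m1 * 70 + 14) + 6"
    and g4: "agree cross_table s3 s4"
    and p4: "\<forall>a \<le> m. \<forall>b \<le> m. arr s4 ''cross'' (a * m1 + b) = (if cross S ?R a b then 1 else 0)"
  proof (rule runs_within_obtain[OF runs_within_cross_table[of s3 m m1 S ?R W]])
  qed (use p1 p2 p3 i0 za lm Wb in \<open>simp_all add: f1 f2 f3\<close>)
  note f4 = agree_reg[OF g4] agree_arr[OF g4]

  have "runs_within W toposort s4 (length es * 140 + n * 140 + 30)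
    (\<lambda>s'. \<exists>os. set os = set es \<and> distinct os \<and> length os = length es \<and> topo os \<and>
      (\<forall>j < length es. arr s' ''ftail'' j = fst (os ! j) \<and> arr s' ''fhead'' j = snd (os ! j)) \<and>
      (\<forall>j < length es. arr s' ''btail'' j = fst (rev (map prod.swap os) ! j) \<and>
         arr s' ''bhead'' j = snd (rev (map prod.swap os) ! j)))"
    by (rule runs_within_toposort) (use i0 z0 za ia Wb(1,2) esV acyc es(1) in \<open>simp_all add: f1 f2 f3 f4\<close>)
  then obtain t5 s5 os where x5: "exec W toposort s4 t5 s5" "t5 \<le> length es * 140 + n * 140 + 30"
    and g5: "agree toposort s4 s5"
    and os: "set os = set es" "distinct os" "length os = length es" "topo os"
    and p5: "\<forall>j < length es. arr s5 ''ftail'' j = fst (os ! j) \<and> arr s5 ''fhead'' j = snd (os ! j)"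
      "\<forall>j < length es. arr s5 ''btail'' j = fst (rev (map prod.swap os) ! j) \<and>
         arr s5 ''bhead'' j = snd (rev (map prod.swap os) ! j)"
    by (elim runs_within_obtain exE conjE)
  note f5 = agree_reg[OF g5] agree_arr[OF g5]

  define ro where "ro = rev (map prod.swap os)"
  have ro: "set ro = (set es)\<inverse>" "distinct ro" "length ro = length es" "topo ro"
    using os topo_rev[OF os(4)] unfolding ro_def set_rev_swap by (simp_all add: distinct_map)
  have osV: "set os \<subseteq> {..<n} \<times> {..<n}" "set ro \<subseteq> {..<n} \<times> {..<n}" using esV os ro by auto

  obtain t6 s6 where x6: "exec W (count_paths CHR ''f'') s5 t6 s6" "t6 \<le> length es * 50 + n * 14 + 18"
    and g6: "agree (count_paths CHR ''f'') s5 s6"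
    and p6: "\<forall>v < n. arr s6 ''fns'' v = of_bool (v \<in> snd ` set os) \<and>
       arr s6 ''fmu'' v = min m1 (card (src_paths os (srcs (set os) {..<n}) (length os) v))"
  proof (rule runs_within_obtain[OF runs_within_count_paths[of s5 os n m1 "CHR ''f''" W]])
  qed (use i0 za p1 p5 os osV Wb in \<open>simp_all add: f1 f2 f3 f4 f5\<close>)
  note f6 = agree_reg[OF g6] agree_arr[OF g6]

  obtain t7 s7 where x7: "exec W (count_paths CHR ''b'') s6 t7 s7" "t7 \<le> length es * 50 + n * 14 + 18"
    and g7: "agree (count_paths CHR ''b'') s6 s7"
    and p7: "\<forall>v < n. arr s7 ''bns'' v = of_bool (v \<in> snd ` set ro) \<and>
       arr s7 ''bmu'' v = min m1 (card (src_paths ro (srcs (set ro) {..<n}) (length ro) v))"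
  proof (rule runs_within_obtain[OF runs_within_count_paths[of s6 ro n m1 "CHR ''b''" W]])
  qed (use i0 za p1 p5[folded ro_def] ro osV Wb in \<open>simp_all add: f1 f2 f3 f4 f5 f6\<close>)
  note f7 = agree_reg[OF g7] agree_arr[OF g7]

  have mu: "card (src_paths os (srcs (set os) {..<n}) (length os) v) = mu_s G v"
    "card (src_paths ro (srcs (set ro) {..<n}) (length ro) v) = mu_t G v" for v
    using mu_eq[OF os(1), of v] ro(3) os(3) by (simp_all add: ro_def)
  have mus: "arr s7 ''fmu'' v = min m1 (mu_s G v)" "arr s7 ''bmu'' v = min m1 (mu_t G v)" if "v < n" for v
    using p6 p7 that mu by (simp_all add: f7)
  define A where "A = {v. min m1 (mu_s G v) \<le> min m1 (mu_t G v)}"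

  obtain t8 s8 where x8: "exec W sides s7 t8 s8" "t8 \<le> n * 20 + 6" and g8: "agree sides s7 s8"
    and p8: "\<forall>v < n. arr s8 ''fside'' v = of_bool (arr s7 ''fmu'' v \<le> arr s7 ''bmu'' v) \<and>
       arr s8 ''bside'' v = of_bool (\<not> arr s7 ''fmu'' v \<le> arr s7 ''bmu'' v)"
  proof (rule runs_within_obtain[OF runs_within_sides[of s7 n W]])
  qed (use i0 za Wb in \<open>simp_all add: f1 f2 f3 f4 f5 f6 f7\<close>)
  note f8 = agree_reg[OF g8] agree_arr[OF g8]
  have sd: "arr s8 ''fside'' v = of_bool (v \<in> A)" "arr s8 ''bside'' v = of_bool (v \<in> - A)" if "v < n" for v
    using p8 mus that by (simp_all add: A_def)

  have mono: "mu_s G u \<le> mu_s G v" "mu_t G v \<le> mu_t G u" if "(u, v) \<in> set os" for u v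
  proof -
    show "mu_s G u \<le> mu_s G v"
      using card_src_paths_edge_mono[OF os(4) that, of "srcs (set os) {..<n}"] unfolding mu .
    have "(v, u) \<in> set ro" using that os(1) ro(1) by simp
    from card_src_paths_edge_mono[OF ro(4) this, of "srcs (set ro) {..<n}"]
    show "mu_t G v \<le> mu_t G u" unfolding mu .
  qed
  \<comment> \<open>Two bounds at once: one state per path, and at most \<open>m + 1\<close> states
    altogether.\<close>
  have card_states: "card ((\<lambda>P. longest_match T (map l P)) ` X) \<le> min m1 (card X)" if "finite X" "length T = m"
    for T :: "nat list" and X
  proof -
    have "(\<lambda>P. longest_match T (map l P)) ` X \<subseteq> {..m}" using longest_match_le[of T] that by auto
    then have "card ((\<lambda>P. longest_match T (map l P)) ` X) \<le> card {..m}" by (intro card_mono) auto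
    then show ?thesis using card_image_le[OF that(1)] Wb(13) by simp
  qed
  interpret F: direction W n m m1 \<sigma> k "CHR ''f''" os S l A
  proof
    show "u \<in> A" if "(u, v) \<in> set os" "v \<in> A" for u v using mono[OF that(1)] that(2) unfolding A_def by auto
  next
    fix v assume v: "v < n" "v \<in> A"
    have "card ((\<lambda>P. longest_match S (map l P)) ` src_paths os (srcs (set os) {..<n}) (length os) v) \<le> min m1 (mu_s G v)"
      using card_states[OF finite_src_paths[OF os(4) order_refl] lm(1)] mu by metis
    \<comment> \<open>Membership in \<open>A\<close> bounds the cut-off \<open>mu_s\<close> by both
      counts, hence by their minimum, even if the uncut counts compare the other way.\<close>
    then show "card ((\<lambda>P. longest_match S (map l P)) ` src_paths os (srcs (set os) {..<n}) (length os) v) \<le> k"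
      using v min_le_st_width[OF v(1)] unfolding A_def k_def by auto
  qed (use osV os lm lv Wb in auto)
  interpret B: direction W n m m1 \<sigma> k "CHR ''b''" ro ?R l "- A"
  proof
    show "u \<in> - A" if "(u, v) \<in> set ro" "v \<in> - A" for u v
      using mono[of v u] that ro(1) os(1) unfolding A_def by auto
  next
    fix v assume v: "v < n" "v \<in> - A"
    have "card ((\<lambda>P. longest_match ?R (map l P)) ` src_paths ro (srcs (set ro) {..<n}) (length ro) v) \<le> min m1 (mu_t G v)"
      using card_states[OF finite_src_paths[OF ro(4) order_refl] lm(2)] mu by metis
    then show "card ((\<lambda>P. longest_match ?R (map l P)) ` src_paths ro (srcs (set ro) {..<n}) (length ro) v) \<le> k"
      using v min_le_st_width[OF v(1)] unfolding A_def k_def by auto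
  qed (use osV ro lm lv Wb in auto)

  have eF: "F.env s8" unfolding F.env_def
    using i0 p1 p2 p5 p6 os sd ia(3) by (simp add: f1 f2 f3 f4 f5 f6 f7 f8)
  obtain t9 s9 L where x9: "exec W (pass CHR ''f'') s8 t9 s9" "t9 \<le> n * 60 + length es * (k * 80 + 38) + 12"
    and g9: "agree (pass CHR ''f'') s8 s9" and L: "F.lists_at (length es) L s9"
  proof (rule runs_within_obtain[OF F.runs_within_pass[OF eF]])
    show "list_rep CHR ''f'' n m m1 (\<lambda>_. []) s8"
      using za by (simp add: list_rep_def f1 f2 f3 f4 f5 f6 f7 f8)
  qed (use os in auto)
  note f9 = agree_reg[OF g9] agree_arr[OF g9]

  have eB: "B.env s9" unfolding B.env_def
    using i0 p1 p3 p5[folded ro_def] p7 ro sd ia(3) by (simp add: f1 f2 f3 f4 f5 f6 f7 f8 f9)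
  obtain t10 s10 M where x10: "exec W (pass CHR ''b'') s9 t10 s10" "t10 \<le> n * 60 + length es * (k * 80 + 38) + 12"
    and g10: "agree (pass CHR ''b'') s9 s10" and M: "B.lists_at (length es) M s10"
  proof (rule runs_within_obtain[OF B.runs_within_pass[OF eB]])
    show "list_rep CHR ''b'' n m m1 (\<lambda>_. []) s9"
      using za by (simp add: list_rep_def f1 f2 f3 f4 f5 f6 f7 f8 f9)
  qed (use ro in auto)
  note f10 = agree_reg[OF g10] agree_arr[OF g10]

  have repL: "list_rep CHR ''f'' n m m1 L s10" and repM: "list_rep CHR ''b'' n m m1 M s10"
    using L M by (auto simp: F.lists_at_def B.lists_at_def f10 elim!: list_rep_cong)
  have setL: "set (L v) = (if v \<in> A then F.states (length es) v else {})"
    and setM: "set (M v) = (if v \<in> - A then B.states (length es) v else {})" if "v < n" for v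
    using L M that unfolding F.lists_at_def B.lists_at_def by blast+
  have lenL: "length (L v) \<le> k" if "v < n" "v \<in> A" for v
    using F.states_le[OF that, of "length es"] setL[OF that(1)] that repL distinct_card[of "L v"] by (simp add: list_rep_def)
  have lenM: "length (M v) \<le> k" if "v < n" "v \<notin> A" for v
    using B.states_le[of v "length es"] setM[OF that(1)] that repM distinct_card[of "M v"] by (simp add: list_rep_def)

  define C where "C \<longleftrightarrow> (\<exists>(u, v) \<in> set os. u \<in> A \<and> v \<notin> A \<and>
       (\<exists>a \<in> set (L u). \<exists>b \<in> set (M v). cross S ?R a b))"
  obtain t11 s11 where x11: "exec W scan s10 t11 s11" "t11 \<le> length es * (k * (k * 33 + 14) + 40) + 6"
    and g11: "agree scan s10 s11" and p11: "reg s11 ''result'' = of_bool C"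
  proof (rule runs_within_obtain[OF runs_within_scan[of s10 os m1 n A m L M "cross S ?R" W k]])
  qed (use i0 z0 p1 p4 p5 os sd osV repL repM lenL lenM Wb in
      \<open>simp_all add: f1 f2 f3 f4 f5 f6 f7 f8 f9 f10 C_def\<close>)
  note f11 = agree_reg[OF g11] agree_arr[OF g11]

  obtain t12 s12 where x12: "exec W full s11 t12 s12" "t12 \<le> n * 30 + 6"
    and p12: "reg s12 ''result'' = of_bool (C \<or> (\<exists>v < n. m \<in> set (L v) \<or> m \<in> set (M v)))"
  proof (rule runs_within_obtain[OF runs_within_full[of s11 n m1 m C L M W]])
    show "list_rep CHR ''f'' n m m1 L s11" "list_rep CHR ''b'' n m m1 M s11"
      by (rule list_rep_cong[OF repL] list_rep_cong[OF repM]; simp add: f11)+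
  qed (use i0 p1 p11 Wb in \<open>simp_all add: f1 f2 f3 f4 f5 f6 f7 f8 f9 f10 f11\<close>)

  have FSF: "F.states (length es) v = (\<lambda>P. longest_match S (map l P)) ` {P. src_path (set es) (srcs (set es) {..<n}) v P}" for v
    using os by (simp add: F.states_def src_paths_def)
  have FSB: "B.states (length es) v = (\<lambda>P. longest_match ?R (map l P)) ` {P. src_path ((set es)\<inverse>) (srcs ((set es)\<inverse>) {..<n}) v P}" for v
    using ro by (simp add: B.states_def src_paths_def)
  have "has_match G l S \<longleftrightarrow> (\<exists>v \<in> {..<n} \<inter> A. m \<in> F.states (length es) v) \<or>
    (\<exists>v \<in> {..<n} - A. m \<in> B.states (length es) v) \<or>
    (\<exists>(u, v) \<in> set es. u \<in> A \<and> v \<notin> A \<and> (\<exists>a \<in> F.states (length es) u. \<exists>b \<in> B.states (length es) v. cross S ?R a b))"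
    unfolding has_match_walk FSF FSB m_def by (rule match_iff[OF m0])
  \<comment> \<open>\<open>L\<close> is empty outside \<open>A\<close> and \<open>M\<close> is empty
    inside, so searching all vertices for the state \<open>m\<close> respects the two sides.\<close>
  moreover have "(\<exists>v < n. m \<in> set (L v) \<or> m \<in> set (M v)) \<longleftrightarrow>
    (\<exists>v \<in> {..<n} \<inter> A. m \<in> F.states (length es) v) \<or> (\<exists>v \<in> {..<n} - A. m \<in> B.states (length es) v)"
    using setL setM by (auto split: if_splits)
  moreover have "C \<longleftrightarrow> (\<exists>(u, v) \<in> set es. u \<in> A \<and> v \<notin> A \<and>
      (\<exists>a \<in> F.states (length es) u. \<exists>b \<in> B.states (length es) v. cross S ?R a b))"
    unfolding C_def os(1)
  proof (rule bex_cong[OF refl])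
    fix e assume e: "e \<in> set es"
    obtain u v where uv: "e = (u, v)" by fastforce
    then have "u < n" "v < n" using e esV by auto
    then show "(case e of (u, v) \<Rightarrow> u \<in> A \<and> v \<notin> A \<and> (\<exists>a \<in> set (L u). \<exists>b \<in> set (M v). cross S ?R a b)) \<longleftrightarrow>
      (case e of (u, v) \<Rightarrow> u \<in> A \<and> v \<notin> A \<and>
        (\<exists>a \<in> F.states (length es) u. \<exists>b \<in> B.states (length es) v. cross S ?R a b))"
      using setL[of u] setM[of v] uv by auto
  qed
  ultimately have res: "reg s12 ''result'' = of_bool (has_match G l S)" using p12 by auto
  have "0 < n" if "n + length es \<noteq> 0"
  proof (rule ccontr)
    assume "\<not> 0 < n"
    then have "es = []" using esV by auto
    then show False using that \<open>\<not> 0 < n\<close> by simp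
  qed
  then have pos: "n + length es = 0 \<or> 0 < st_width G" using st_width_pos[OF _ os(4,1)] by metis
  have "exec W matcher s0 (t1 + (t2 + (t3 + (t4 + (t5 + (t6 + (t7 + (t8 + (t9 + (t10 + (t11 + t12))))))))))) s12"
    unfolding matcher_def
    by (rule exec_Seq[OF x1(1) exec_Seq[OF x2(1) exec_Seq[OF x3(1) exec_Seq[OF x4(1) exec_Seq[OF x5(1) exec_Seq[OF x6(1) exec_Seq[OF x7(1) exec_Seq[OF x8(1) exec_Seq[OF x9(1) exec_Seq[OF x10(1) exec_Seq[OF x11(1) x12(1)]]]]]]]]]]])
  moreover have "t1 + (t2 + (t3 + (t4 + (t5 + (t6 + (t7 + (t8 + (t9 + (t10 + (t11 + t12)))))))))) \<le> run_time n (length es) m k"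
    unfolding run_time_def m1_def[symmetric]
  proof -
    have "t1 + (t2 + (t3 + (t4 + (t5 + (t6 + (t7 + (t8 + (t9 + (t10 + (t11 + t12))))))))))
        \<le> a1 + 2 * a2 + a4 + a5 + 2 * a6 + a8 + 2 * a9 + a11 + a12"
      if "t1 \<le> a1" "t2 \<le> a2" "t3 \<le> a2" "t4 \<le> a4" "t5 \<le> a5" "t6 \<le> a6" "t7 \<le> a6" "t8 \<le> a8" "t9 \<le> a9"
        "t10 \<le> a9" "t11 \<le> a11" "t12 \<le> a12" for a1 a2 a4 a5 a6 a8 a9 a11 a12
      using that by linarith
    from this[OF x1(2) x2(2) x3(2) x4(2) x5(2) x6(2) x7(2) x8(2) x9(2) x10(2) x11(2) x12(2)]
    show "t1 + (t2 + (t3 + (t4 + (t5 + (t6 + (t7 + (t8 + (t9 + (t10 + (t11 + t12)))))))))) \<le>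
      m * 20 + 10 + 2 * (m1 * (m * 60 + 60) + 6) + (m1 * (m1 * 70 + 14) + 6) +
      (length es * 140 + n * 140 + 30) + 2 * (length es * 50 + n * 14 + 18) + (n * 20 + 6) +
      2 * (n * 60 + length es * (k * 80 + 38) + 12) + (length es * (k * (k * 33 + 14) + 40) + 6) + (n * 30 + 6)" .
  qed
  ultimately show ?thesis unfolding runs_within_def s0_def[symmetric] m_def[symmetric] k_def[symmetric]
    using res pos[folded k_def] by blast
qed

end

theorem theorem2:
  shows "\<exists>(prog :: com) (c :: nat) (C :: nat).
    \<forall>(G :: nat pair_pre_digraph) (n :: nat) (\<sigma> :: nat) (l :: nat \<Rightarrow> nat) (S :: nat list)
      (es :: (nat \<times> nat) list) (w :: nat).
      pair_fin_digraph G \<longrightarrow> acyclic (parcs G) \<longrightarrow> pverts G = {..<n} \<longrightarrow>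
      (\<forall>v \<in> pverts G. l v \<in> {..<\<sigma>}) \<longrightarrow> set S \<subseteq> {..<\<sigma>} \<longrightarrow>
      distinct es \<longrightarrow> set es = parcs G \<longrightarrow>
      (card (pverts G) + card (parcs G) + length S + \<sigma> + 2) ^ c \<le> 2 ^ w \<longrightarrow>
      (\<exists>t s. exec (2 ^ w) prog (input_state n es \<sigma> l S) t s \<and>
        reg s ''result'' = (if has_match G l S then 1 else 0) \<and>
        t \<le> C * ((card (pverts G) + card (parcs G)) * (st_width G)\<^sup>2 + (length S)\<^sup>2 + 1))"
\<comment> \<open>The exponent 2 is that of \<open>word_bounds\<close>. The guard costs 4 units on
  top of the factor 2000 from \<open>run_time_le\<close>; the summand 1 in the bound lets 2010 cover
  them, also for the empty string.\<close>
proof (rule exI[of _ guarded_matcher], rule exI[of _ 2], rule exI[of _ 2010], intro allI impI)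
  fix G :: "nat pair_pre_digraph" and n \<sigma> l and S :: "nat list" and es :: "(nat \<times> nat) list" and w :: nat
  assume a: "pair_fin_digraph G" "acyclic (parcs G)" "pverts G = {..<n}"
    "\<forall>v \<in> pverts G. l v \<in> {..<\<sigma>}" "set S \<subseteq> {..<\<sigma>}" "distinct es" "set es = parcs G"
    "(card (pverts G) + card (parcs G) + length S + \<sigma> + 2)\<^sup>2 \<le> 2 ^ w"
  interpret matching_input "2 ^ w" n \<sigma> G l S es using a by (intro matching_input.intro)
  let ?s = "input_state n es \<sigma> l S"
  let ?N = "(card (pverts G) + card (parcs G)) * (st_width G)\<^sup>2 + (length S)\<^sup>2 + 1"
  have m: "reg ?s ''m'' = length S" by (simp add: input_state_def)
  have c: "card (pverts G) = n" "card (parcs G) = length es" using a distinct_card[of es] by auto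
  have "runs_within (2 ^ w) guarded_matcher ?s (2010 * ?N) (\<lambda>s. reg s ''result'' = (if has_match G l S then 1 else 0))"
    unfolding guarded_matcher_def
  proof (rule runs_within_Cond[where T = "2000 * ?N"])
    assume "\<not> bval (2 ^ w) (Less (Const 0) (Var ''m'')) ?s"
    then have "S = []" using m by simp
    then have "\<not> has_match G l S" by (auto simp: has_match_def vpath_def vwalk_def)
    then show "runs_within (2 ^ w) Skip ?s (2000 * ?N) (\<lambda>s. reg s ''result'' = (if has_match G l S then 1 else 0))"
      by (intro runs_within_flat) (simp_all add: input_state_def)
  next
    assume "bval (2 ^ w) (Less (Const 0) (Var ''m'')) ?s"
    then have S0: "S \<noteq> []" using m by auto
    obtain t s where e: "exec (2 ^ w) matcher ?s t s" and t: "t \<le> run_time n (length es) (length S) (st_width G)"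
      and r: "reg s ''result'' = of_bool (has_match G l S)" and p: "n + length es = 0 \<or> 0 < st_width G"
      using runs_within_matcher[OF S0] by (auto simp: runs_within_def)
    have "t \<le> 2000 * ?N" using t run_time_le[of "length S" n "length es" "st_width G"] p S0 c by simp
    then show "runs_within (2 ^ w) matcher ?s (2000 * ?N) (\<lambda>s. reg s ''result'' = (if has_match G l S then 1 else 0))"
      unfolding runs_within_def using e r by (intro exI[of _ t] exI[of _ s]) simp
  qed simp
  then show "\<exists>t s. exec (2 ^ w) guarded_matcher ?s t s \<and> reg s ''result'' = (if has_match G l S then 1 else 0) \<and>
      t \<le> 2010 * ?N" unfolding runs_within_def by blast
qed

end
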